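(* Let $n\ge1$, $k\ge 2$ and $N=\binom{n+3}{3}-1$, and assume that $\mathrm{Sec}_k(\mathcal{G}_{n,3})\ne\mathbb{P}^N$ (in the statements about $k=2$ below, this assumption is made for $k=2$). Then: (i) The moment variety $\mathcal{G}_{n,3}$ is $k$-defective. (ii) In particular, for $k=2$, the model has two more parameters than the dimension of the secant variety, i.e. $$n(n+3)+1-\dim\bigl(\mathrm{Sec}_2(\mathcal{G}_{n,3})\bigr)=2.$$ (iii) For $k=2$: if $n\ge3$ and we fix distinct first coordinates $\mu_{11}\neq\mu_{21}$ in $\mathbb{C}$ for the two mean vectors, then the remaining parameters are identified uniquely; that is, for a general point $m\in\mathrm{Sec}_2(\mathcal{G}_{n,3})$ there is exactly one choice of the remaining model parameters (mixture parameter, remaining coordinates of the two mean vectors, and two covariance matrices) whose moment vector is $m$.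
   Context: Work over $\mathbb{C}$. Let $n,d,k\ge 1$ and $N=\binom{n+d}{d}-1$ (here $d=3$). The coordinates on $\mathbb{P}^N$ are the moments $m_{i_1\cdots i_n}$ with $i_1+\cdots+i_n\le d$, and $\mathbb{A}^N=\{m_{0\cdots0}=1\}\subset\mathbb{P}^N$. Consider the map from the space of model parameters to $\mathbb{A}^N$ given by the identity of generating functions (truncated to total degree $\le d$) $$\sum_{i_1,\dots,i_n\ge 0}\frac{m_{i_1\cdots i_n}}{i_1!\cdots i_n!}t_1^{i_1}\cdots t_n^{i_n}=\sum_{\ell=1}^k\lambda_\ell\exp(t_1\mu_{\ell1}+\cdots+t_n\mu_{\ell n})\exp\Bigl(\tfrac12\sum_{i,j=1}^n\sigma_{\ell ij}t_it_j\Bigr).$$ The model parameters are the mean vectors $(\mu_{\ell 1},\dots,\mu_{\ell n})$, the symmetric covariance matrices $(\sigma_{\ell ij})$, and the mixture parameters $\lambda_\ell$ subject to $\lambda_1+\cdots+\lambda_k=1$; there are $kn(n+3)/2+k-1$ parameters. The variety $\mathrm{Sec}_k(\mathcal{G}_{n,d})\subset\mathbb{P}^N$ is the Zariski closure of the image of this map; for $k=1$ it is the Gaussian moment variety $\mathcal{G}_{n,d}$. The variety $\mathcal{G}_{n,d}$ is called $k$-defective if $\dim\mathrm{Sec}_k(\mathcal{G}_{n,d})<\min\{N,\,kn(n+3)/2+k-1\}$. *)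

theory Defs
  imports "HOL-Analysis.Analysis" "HOL-Library.Poly_Mapping" "HOL-Library.Extended_Nat"
begin

text \<open>
  A multivariate polynomial with variables in a type \<open>'i\<close> is a finitely supported map
  from monomials (exponent vectors, \<open>'i \<Rightarrow>\<^sub>0 nat\<close>) to coefficients; multiplication is the
  convolution product provided by \<open>Poly_Mapping\<close>.
\<close>

abbreviation "keys \<equiv> Poly_Mapping.keys"
abbreviation "lookup \<equiv> Poly_Mapping.lookup"

type_synonym 'i monomial = "'i \<Rightarrow>\<^sub>0 nat"
type_synonym 'i mpolynomial = "('i \<Rightarrow>\<^sub>0 nat) \<Rightarrow>\<^sub>0 complex"

definition total_degree :: "'i monomial \<Rightarrow> nat" where
  "total_degree m = (\<Sum>x\<in>keys m. lookup m x)"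

definition monomial_value :: "('i \<Rightarrow> complex) \<Rightarrow> 'i monomial \<Rightarrow> complex" where
  "monomial_value v m = (\<Prod>x\<in>keys m. v x ^ lookup m x)"

definition poly_value :: "('i \<Rightarrow> complex) \<Rightarrow> 'i mpolynomial \<Rightarrow> complex" where
  "poly_value v p = (\<Sum>m\<in>keys p. lookup p m * monomial_value v m)"

definition homogeneous_in :: "'i set \<Rightarrow> 'i mpolynomial \<Rightarrow> bool" where
  "homogeneous_in I p \<longleftrightarrow>
     (\<forall>m\<in>keys p. keys m \<subseteq> I) \<and> (\<exists>e. \<forall>m\<in>keys p. total_degree m = e)"

text \<open>
  Projective space with homogeneous coordinates indexed by a finite set \<open>I\<close>, of dimension
  \<open>card I - 1\<close>.  A point is the set of all its homogeneous coordinate vectors; coordinate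
  vectors are extensional, i.e. \<open>undefined\<close> outside \<open>I\<close>.
\<close>

definition proj_point :: "'i set \<Rightarrow> ('i \<Rightarrow> complex) \<Rightarrow> ('i \<Rightarrow> complex) set" where
  "proj_point I v = {(\<lambda>i\<in>I. c * v i) | c. c \<noteq> 0}"

definition proj_space :: "'i set \<Rightarrow> ('i \<Rightarrow> complex) set set" where
  "proj_space I = {proj_point I v | v. \<exists>i\<in>I. v i \<noteq> 0}"

definition zero_locus :: "'i set \<Rightarrow> 'i mpolynomial set \<Rightarrow> ('i \<Rightarrow> complex) set set" where
  "zero_locus I F = {P \<in> proj_space I. \<forall>f\<in>F. \<forall>v\<in>P. poly_value v f = 0}"

definition algebraic_set :: "'i set \<Rightarrow> ('i \<Rightarrow> complex) set set \<Rightarrow> bool" where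
  "algebraic_set I Z \<longleftrightarrow> (\<exists>F. (\<forall>f\<in>F. homogeneous_in I f) \<and> Z = zero_locus I F)"

definition zariski :: "'i set \<Rightarrow> ('i \<Rightarrow> complex) set topology" where
  "zariski I = topology (\<lambda>U. U \<subseteq> proj_space I \<and> algebraic_set I (proj_space I - U))"

text \<open>
  The lemmas up to \<open>closedin_zariski\<close> check that the predicate passed to \<open>topology\<close> above
  really is a topology, so that its closed sets are exactly the algebraic sets.
\<close>

lemma total_degree_superset:
  assumes "finite A" "keys m \<subseteq> A"
  shows "total_degree m = (\<Sum>x\<in>A. lookup m x)"
  unfolding total_degree_def
  by (rule sum.mono_neutral_left) (use assms in \<open>auto simp: in_keys_iff\<close>)

lemma monomial_value_superset:
  assumes "finite A" "keys m \<subseteq> A"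
  shows "monomial_value v m = (\<Prod>x\<in>A. v x ^ lookup m x)"
  unfolding monomial_value_def
  by (rule prod.mono_neutral_left) (use assms in \<open>auto simp: in_keys_iff\<close>)

lemma total_degree_add: "total_degree (m + m') = total_degree m + total_degree m'"
proof -
  let ?A = "keys m \<union> keys m'"
  have "keys (m + m') \<subseteq> ?A" by (rule keys_add)
  then show ?thesis
    by (simp add: total_degree_superset[of ?A] lookup_add sum.distrib)
qed

lemma monomial_value_add:
  "monomial_value v (m + m') = monomial_value v m * monomial_value v m'"
proof -
  let ?A = "keys m \<union> keys m'"
  have "keys (m + m') \<subseteq> ?A" by (rule keys_add)
  then show ?thesis
    by (simp add: monomial_value_superset[of ?A] lookup_add prod.distrib power_add)
qed

lemma poly_value_zero [simp]: "poly_value v 0 = 0"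
  by (simp add: poly_value_def)

lemma poly_value_one [simp]: "poly_value v 1 = 1"
  by (simp add: poly_value_def monomial_value_def)

lemma poly_value_add: "poly_value v (p + q) = poly_value v p + poly_value v q"
  unfolding poly_value_def by (rule setsum_keys_plus_distrib) (auto simp: algebra_simps)

lemma poly_value_sum: "poly_value v (sum f A) = (\<Sum>a\<in>A. poly_value v (f a))"
  by (induction A rule: infinite_finite_induct) (auto simp: poly_value_add)

lemma poly_value_single: "poly_value v (Poly_Mapping.single m c) = c * monomial_value v m"
  by (cases "c = 0") (auto simp: poly_value_def)

lemma mpolynomial_expand:
  "p = (\<Sum>m\<in>keys p. Poly_Mapping.single m (lookup p m))" for p :: "'i mpolynomial"
  by (rule poly_mapping_eqI)
    (auto simp: lookup_sum lookup_single when_def in_keys_iff sum.delta)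

lemma poly_value_mult: "poly_value v (p * q) = poly_value v p * poly_value v q"
proof -
  have "p * q = (\<Sum>m\<in>keys p. \<Sum>m'\<in>keys q.
      Poly_Mapping.single (m + m') (lookup p m * lookup q m'))"
    using arg_cong2[OF mpolynomial_expand[of p] mpolynomial_expand[of q], of "(*)"]
    by (simp only: sum_product mult_single)
  then show ?thesis
    by (simp add: poly_value_sum poly_value_single monomial_value_add)
      (simp add: poly_value_def sum_product mult_ac)
qed

lemma homogeneous_in_mult:
  assumes "homogeneous_in I p" "homogeneous_in I q"
  shows "homogeneous_in I (p * q)"
proof -
  obtain a b where ab: "\<forall>m\<in>keys p. total_degree m = a" "\<forall>m\<in>keys q. total_degree m = b"
    using assms by (auto simp: homogeneous_in_def)
  have "keys m \<subseteq> I \<and> total_degree m = a + b" if "m \<in> keys (p * q)" for m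
  proof -
    from that keys_mult[of p q] obtain m1 m2
      where m: "m = m1 + m2" "m1 \<in> keys p" "m2 \<in> keys q" by blast
    then have "keys m1 \<subseteq> I" "keys m2 \<subseteq> I"
      using assms by (auto simp: homogeneous_in_def)
    then show ?thesis
      using m ab keys_add[of m1 m2] by (auto simp: total_degree_add)
  qed
  then show ?thesis unfolding homogeneous_in_def by blast
qed

lemma homogeneous_scale:
  assumes "homogeneous_in I p"
  shows "\<exists>e. \<forall>c v. poly_value (\<lambda>i\<in>I. c * v i) p = c ^ e * poly_value v p"
proof -
  obtain e where e: "\<forall>m\<in>keys p. total_degree m = e" and I: "\<forall>m\<in>keys p. keys m \<subseteq> I"
    using assms by (auto simp: homogeneous_in_def)
  have "monomial_value (\<lambda>i\<in>I. c * v i) m = c ^ e * monomial_value v m"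
    if "m \<in> keys p" for c v m
  proof -
    have "monomial_value (\<lambda>i\<in>I. c * v i) m = (\<Prod>x\<in>keys m. c ^ lookup m x * v x ^ lookup m x)"
      unfolding monomial_value_def
      by (rule prod.cong) (use I that in \<open>auto simp: power_mult_distrib\<close>)
    also have "\<dots> = c ^ e * monomial_value v m"
      using e that by (auto simp: prod.distrib monomial_value_def total_degree_def
          power_sum[symmetric])
    finally show ?thesis .
  qed
  then have "poly_value (\<lambda>i\<in>I. c * v i) p = c ^ e * poly_value v p" for c v
    by (simp add: poly_value_def sum_distrib_left mult_ac)
  then show ?thesis by blast
qed

lemma proj_point_vanish:
  assumes "homogeneous_in I f"
  shows "(\<forall>w\<in>proj_point I v. poly_value w f = 0) \<longleftrightarrow> poly_value v f = 0"
proof -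
  obtain e where e: "poly_value (\<lambda>i\<in>I. c * v i) f = c ^ e * poly_value v f" for c
    using homogeneous_scale[OF assms] by blast
  show ?thesis
    using e[of 1] by (auto simp: proj_point_def e)
qed

lemma algebraic_set_Un:
  assumes "algebraic_set I A" "algebraic_set I B"
  shows "algebraic_set I (A \<union> B)"
proof -
  obtain F G where F: "\<forall>f\<in>F. homogeneous_in I f" "A = zero_locus I F"
    and G: "\<forall>g\<in>G. homogeneous_in I g" "B = zero_locus I G"
    using assms by (auto simp: algebraic_set_def)
  let ?H = "{f * g | f g. f \<in> F \<and> g \<in> G}"
  have H: "\<forall>h\<in>?H. homogeneous_in I h"
    using F G homogeneous_in_mult by blast
  have "P \<in> zero_locus I ?H \<longleftrightarrow> P \<in> A \<union> B" for P
  proof (cases "P \<in> proj_space I")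
    case True
    then obtain v where v: "P = proj_point I v" by (auto simp: proj_space_def)
    have "P \<in> zero_locus I ?H \<longleftrightarrow> (\<forall>h\<in>?H. poly_value v h = 0)"
      using True H unfolding zero_locus_def by (auto simp: v proj_point_vanish)
    moreover have "P \<in> A \<longleftrightarrow> (\<forall>f\<in>F. poly_value v f = 0)"
      using True F unfolding zero_locus_def by (auto simp: v proj_point_vanish)
    moreover have "P \<in> B \<longleftrightarrow> (\<forall>f\<in>G. poly_value v f = 0)"
      using True G unfolding zero_locus_def by (auto simp: v proj_point_vanish)
    moreover have "(\<forall>h\<in>?H. poly_value v h = 0) \<longleftrightarrow>
        (\<forall>f\<in>F. \<forall>g\<in>G. poly_value v f = 0 \<or> poly_value v g = 0)"
      by (force simp: poly_value_mult)
    ultimately show ?thesis by blast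
  next
    case False
    then show ?thesis using F G by (auto simp: zero_locus_def)
  qed
  then have "A \<union> B = zero_locus I ?H" by blast
  then show ?thesis using H unfolding algebraic_set_def by blast
qed

lemma algebraic_set_Inter:
  assumes "\<And>Z. Z \<in> \<Z> \<Longrightarrow> algebraic_set I Z"
  shows "algebraic_set I (proj_space I \<inter> \<Inter>\<Z>)"
proof -
  have "\<forall>Z\<in>\<Z>. \<exists>F. (\<forall>f\<in>F. homogeneous_in I f) \<and> Z = zero_locus I F"
    using assms by (auto simp: algebraic_set_def)
  then obtain F where F: "\<forall>Z\<in>\<Z>. (\<forall>f\<in>F Z. homogeneous_in I f) \<and> Z = zero_locus I (F Z)"
    by metis
  have "proj_space I \<inter> \<Inter>\<Z> = zero_locus I (\<Union>Z\<in>\<Z>. F Z)"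
    using F unfolding zero_locus_def by blast
  moreover have "\<forall>f\<in>(\<Union>Z\<in>\<Z>. F Z). homogeneous_in I f" using F by blast
  ultimately show ?thesis unfolding algebraic_set_def by (intro exI conjI)
qed

lemma istopology_zariski:
  "istopology (\<lambda>U. U \<subseteq> proj_space I \<and> algebraic_set I (proj_space I - U))"
proof -
  have "algebraic_set I (proj_space I - U \<inter> V)"
    if "algebraic_set I (proj_space I - U)" "algebraic_set I (proj_space I - V)" for U V
    using algebraic_set_Un[OF that] by (simp add: Diff_Int)
  moreover have "algebraic_set I (proj_space I - \<Union>\<U>)"
    if "\<And>U. U \<in> \<U> \<Longrightarrow> algebraic_set I (proj_space I - U)" for \<U>
  proof -
    have "proj_space I - \<Union>\<U> = proj_space I \<inter> \<Inter>((\<lambda>U. proj_space I - U) ` \<U>)" by blast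
    moreover have "algebraic_set I (proj_space I \<inter> \<Inter>((\<lambda>U. proj_space I - U) ` \<U>))"
      by (rule algebraic_set_Inter) (use that in blast)
    ultimately show ?thesis by (simp only:)
  qed
  ultimately show ?thesis unfolding istopology_def by blast
qed

lemma openin_zariski:
  "openin (zariski I) U \<longleftrightarrow> U \<subseteq> proj_space I \<and> algebraic_set I (proj_space I - U)"
  by (simp add: zariski_def istopology_zariski)

lemma topspace_zariski [simp]: "topspace (zariski I) = proj_space I"
proof -
  have "homogeneous_in I 1" by (simp add: homogeneous_in_def)
  moreover have "zero_locus I {1} = {}"
    by (force simp: zero_locus_def proj_space_def proj_point_def)
  ultimately have "algebraic_set I {}" 
    unfolding algebraic_set_def by (intro exI[of _ "{1}"]) simp
  then have "openin (zariski I) (proj_space I)" by (simp add: openin_zariski)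
  then have "proj_space I \<subseteq> topspace (zariski I)" by (rule openin_subset)
  moreover have "topspace (zariski I) \<subseteq> proj_space I"
    using openin_topspace[of "zariski I"] by (simp only: openin_zariski)
  ultimately show ?thesis by (rule subset_antisym[rotated])
qed

lemma closedin_zariski: "closedin (zariski I) Z \<longleftrightarrow> algebraic_set I Z"
proof -
  have "algebraic_set I Z \<Longrightarrow> Z \<subseteq> proj_space I"
    by (auto simp: algebraic_set_def zero_locus_def)
  then show ?thesis
    by (auto simp: closedin_def openin_zariski double_diff)
qed


definition irreducible_closedin :: "'a topology \<Rightarrow> 'a set \<Rightarrow> bool" where
  "irreducible_closedin X Z \<longleftrightarrow> closedin X Z \<and> Z \<noteq> {} \<and>
     (\<forall>A B. closedin X A \<and> closedin X B \<and> Z = A \<union> B \<longrightarrow> Z = A \<or> Z = B)"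

text \<open>
  Krull dimension: the supremum of the lengths \<open>r\<close> of chains
  \<open>Z 0 \<subset> Z 1 \<subset> \<dots> \<subset> Z r\<close> of irreducible closed subsets.
\<close>

definition krull_dim :: "'a topology \<Rightarrow> enat" where
  "krull_dim X = Sup {enat r | r. \<exists>Z. (\<forall>i\<le>r. irreducible_closedin X (Z i)) \<and>
     (\<forall>i<r. Z i \<subset> Z (Suc i))}"

definition dimension_in :: "'i set \<Rightarrow> ('i \<Rightarrow> complex) set set \<Rightarrow> enat" where
  "dimension_in I S = krull_dim (subtopology (zariski I) S)"

definition for_general_point :: "'a topology \<Rightarrow> 'a set \<Rightarrow> ('a \<Rightarrow> bool) \<Rightarrow> bool" where
  "for_general_point X S P \<longleftrightarrow>
     (\<exists>U. openin (subtopology X S) U \<and> S \<subseteq> X closure_of U \<and> (\<forall>x\<in>U. P x))"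


text \<open>
  Parameters of a mixture of \<open>k\<close> Gaussians on \<open>n\<close>-space; components are numbered
  \<open>1, \<dots>, k\<close> and coordinates \<open>1, \<dots>, n\<close>.  All functions are extensional, so that equality in
  \<open>mixture_params\<close> is equality of the actual parameters.
\<close>

datatype mixture = Mixture
  (weight: "nat \<Rightarrow> complex")
  (mean: "nat \<Rightarrow> nat \<Rightarrow> complex")
  (cov: "nat \<Rightarrow> nat \<Rightarrow> nat \<Rightarrow> complex")

definition mixture_params :: "nat \<Rightarrow> nat \<Rightarrow> mixture set" where
  "mixture_params n k = {\<theta>.
     weight \<theta> \<in> {1..k} \<rightarrow>\<^sub>E UNIV \<and>
     mean \<theta> \<in> {1..k} \<rightarrow>\<^sub>E ({1..n} \<rightarrow>\<^sub>E UNIV) \<and>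
     cov \<theta> \<in> {1..k} \<rightarrow>\<^sub>E ({1..n} \<rightarrow>\<^sub>E ({1..n} \<rightarrow>\<^sub>E UNIV)) \<and>
     (\<forall>l\<in>{1..k}. \<forall>i\<in>{1..n}. \<forall>j\<in>{1..n}. cov \<theta> l i j = cov \<theta> l j i) \<and>
     (\<Sum>l\<in>{1..k}. weight \<theta> l) = 1}"

text \<open>
  The generating function is computed in the polynomial ring in \<open>t\<^sub>1, \<dots>, t\<^sub>n\<close>.  Since the
  arguments of the exponentials have no constant term, the omitted terms \<open>p ^ j / j!\<close> with
  \<open>j > d\<close> of the exponential series only involve monomials of total degree greater than \<open>d\<close>.
  Hence the coefficients of \<open>mixture_gf n d k \<theta>\<close> at monomials of total degree at most \<open>d\<close>
  are those of the full power series (its higher coefficients are not used).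
\<close>

definition const_poly :: "complex \<Rightarrow> 'i mpolynomial" where
  "const_poly c = Poly_Mapping.single 0 c"

definition var :: "'i \<Rightarrow> 'i mpolynomial" where
  "var i = Poly_Mapping.single (Poly_Mapping.single i 1) 1"

definition exp_upto :: "nat \<Rightarrow> 'i mpolynomial \<Rightarrow> 'i mpolynomial" where
  "exp_upto d p = (\<Sum>j\<le>d. const_poly (1 / fact j) * p ^ j)"

definition mixture_gf :: "nat \<Rightarrow> nat \<Rightarrow> nat \<Rightarrow> mixture \<Rightarrow> nat mpolynomial" where
  "mixture_gf n d k \<theta> = (\<Sum>l\<in>{1..k}. const_poly (weight \<theta> l)
     * exp_upto d (\<Sum>i\<in>{1..n}. const_poly (mean \<theta> l i) * var i)
     * exp_upto d (const_poly (1 / 2) *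
         (\<Sum>i\<in>{1..n}. \<Sum>j\<in>{1..n}. const_poly (cov \<theta> l i j) * var i * var j)))"

definition moment_indices :: "nat \<Rightarrow> nat \<Rightarrow> nat monomial set" where
  "moment_indices n d = {\<alpha>. keys \<alpha> \<subseteq> {1..n} \<and> total_degree \<alpha> \<le> d}"

definition moment :: "nat \<Rightarrow> nat \<Rightarrow> nat \<Rightarrow> mixture \<Rightarrow> nat monomial \<Rightarrow> complex" where
  "moment n d k \<theta> \<alpha> = (\<Prod>i\<in>{1..n}. fact (lookup \<alpha> i)) * lookup (mixture_gf n d k \<theta>) \<alpha>"

text \<open>
  The moment vector as a point of projective space.  Its coordinate at \<open>\<alpha> = 0\<close> is the sum of
  the weights, i.e. \<open>1\<close>, so it lies in the affine chart \<open>m\<^sub>0 = 1\<close> and determines the moments.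
\<close>

definition moment_point :: "nat \<Rightarrow> nat \<Rightarrow> nat \<Rightarrow> mixture \<Rightarrow> (nat monomial \<Rightarrow> complex) set" where
  "moment_point n d k \<theta> = proj_point (moment_indices n d) (moment n d k \<theta>)"

abbreviation moment_space :: "nat \<Rightarrow> nat \<Rightarrow> (nat monomial \<Rightarrow> complex) set set" where
  "moment_space n d \<equiv> proj_space (moment_indices n d)"

definition Sec :: "nat \<Rightarrow> nat \<Rightarrow> nat \<Rightarrow> (nat monomial \<Rightarrow> complex) set set" where
  "Sec k n d = zariski (moment_indices n d) closure_of (moment_point n d k ` mixture_params n k)"

definition dim_Sec :: "nat \<Rightarrow> nat \<Rightarrow> nat \<Rightarrow> enat" where
  "dim_Sec k n d = dimension_in (moment_indices n d) (Sec k n d)"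

text \<open>\<open>k\<close>-defectivity of the Gaussian moment variety \<open>Sec 1 n d\<close>.\<close>

definition defective :: "nat \<Rightarrow> nat \<Rightarrow> nat \<Rightarrow> bool" where
  "defective k n d \<longleftrightarrow>
     dim_Sec k n d < enat (min (((n + d) choose d) - 1) (k * n * (n + 3) div 2 + k - 1))"

end

theory Submission
  imports Defs
begin

text \<open>
  Consider two Gaussian components with relative weights \<open>\<rho>\<close> and \<open>1 - \<rho>\<close>, let \<open>\<delta>\<close> and
  \<open>\<Delta>\<close> be the differences of their means and of their covariances, and view \<open>\<delta>\<close> as a
  linear and \<open>\<Delta>\<close> as a quadratic form. The moments of the pair up to order three amount to its
  first three cumulants. The first two are arbitrary, and the third is, up to normalisation, the
  reducible cubic form \<open>\<rho> (1 - \<rho>) \<delta> ((1 - 2 \<rho>) \<delta>\<^sup>2 + 3 \<Delta>)\<close>. Only this product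
  matters: \<open>\<delta>\<close> can be rescaled and \<open>\<rho>\<close> can be changed, since \<open>\<Delta>\<close> can compensate.
  These are two superfluous parameters, and they can be used to prescribe the first coordinates of
  the two means (\<open>renormalise_pair\<close>). The other components of a mixture stay as they are, so for
  every \<open>k \<ge> 2\<close> the secant variety is the closure of a family with two parameters fewer
  (\<open>Sec_eq_closure_normalised\<close>). This makes its dimension smaller than the number of
  parameters; it is smaller than \<open>N\<close> as soon as the variety is not the whole space.

  Both upper bounds for the dimension rest on the fact that the closure of a family with \<open>r\<close> parameters has
  Krull dimension at most \<open>r\<close> (\<open>chain_length_le_parameters\<close>). A chain of \<open>s + 1\<close>
  irreducible closed sets yields forms \<open>f\<^sub>0, \<dots>, f\<^sub>s\<close>, each vanishing on the preceding set
  but not on its own, and such forms satisfy no homogeneous relation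
  (\<open>chain_monomials_independent\<close>). If \<open>s > r\<close>, there are more monomials in them than the
  space of polynomials of the corresponding degree in \<open>r\<close> variables has room for.

  For \<open>k = 2\<close> no further parameter is lost. An explicit chain of closures of subfamilies, in
  which each new parameter is detected by a moment, has the required length
  (\<open>dimension_ge_card_parameters\<close>, \<open>dim_Sec_2\<close>).

  For \<open>n \<ge> 3\<close> a general product of a linear and a quadratic form determines the linear form up to
  a factor, and elimination expresses the linear form rationally in the coefficients of the product
  (\<open>polar_of_product\<close>). Where the denominator does not vanish, every point of the secant variety,
  and not only of the image of the parametrisation, has a third cumulant that is divisible by the
  reconstructed linear form (\<open>Sec_factor_defect\<close>). The prescribed first coordinates \<open>a\<close> and
  \<open>b\<close> of the means fix the factor, and together with the first moment they fix the weight. All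
  other parameters follow by division (\<open>two_component_exists\<close>, \<open>two_component_unique\<close>).
\<close>

section \<open>Polynomial functions\<close>

definition polyfun :: "'i set \<Rightarrow> (('i \<Rightarrow> complex) \<Rightarrow> complex) \<Rightarrow> bool" where
  "polyfun I F \<longleftrightarrow> (\<exists>p. (\<forall>m\<in>keys p. keys m \<subseteq> I) \<and> (\<forall>v. F v = poly_value v p))"

lemma polyfun_const [intro]: "polyfun I (\<lambda>v. c)"
  unfolding polyfun_def
  by (rule exI[of _ "Poly_Mapping.single 0 c"]) (auto simp: poly_value_single monomial_value_def)

lemma monomial_value_single: "monomial_value v (Poly_Mapping.single i k) = v i ^ k"
  by (cases "k = 0") (auto simp: monomial_value_def)

lemma total_degree_single: "total_degree (Poly_Mapping.single i k) = k"
  by (cases "k = 0") (auto simp: total_degree_def)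

lemma total_degree_0 [simp]: "total_degree 0 = 0"
  by (simp add: total_degree_def)

lemma lookup_le_total_degree: "lookup m i \<le> total_degree m"
proof (cases "i \<in> keys m")
  case True
  then show ?thesis unfolding total_degree_def by (intro member_le_sum) auto
next
  case False
  then show ?thesis by (simp add: in_keys_iff)
qed

lemma poly_value_power: "poly_value v (p ^ k) = poly_value v p ^ k"
  by (induction k) (auto simp: poly_value_mult)

lemma poly_value_prod: "poly_value v (prod f A) = (\<Prod>a\<in>A. poly_value v (f a))"
  by (induction A rule: infinite_finite_induct) (auto simp: poly_value_mult)

lemma poly_value_const_poly [simp]: "poly_value v (const_poly c) = c"
  by (simp add: const_poly_def poly_value_single monomial_value_def)

lemma poly_value_var [simp]: "poly_value v (var i) = v i"
  by (simp add: var_def poly_value_single monomial_value_single)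

lemma polyfun_var [intro]: "i \<in> I \<Longrightarrow> polyfun I (\<lambda>v. v i)"
  unfolding polyfun_def by (rule exI[of _ "var i"]) (simp, simp add: var_def)

lemma polyfun_add [intro]:
  assumes "polyfun I F" "polyfun I G" shows "polyfun I (\<lambda>v. F v + G v)"
proof -
  obtain p q where p: "\<forall>m\<in>keys p. keys m \<subseteq> I" "\<forall>v. F v = poly_value v p"
    and q: "\<forall>m\<in>keys q. keys m \<subseteq> I" "\<forall>v. G v = poly_value v q"
    using assms by (auto simp: polyfun_def)
  have "\<forall>m\<in>keys (p + q). keys m \<subseteq> I" using p(1) q(1) keys_add[of p q] by blast
  then show ?thesis using p q unfolding polyfun_def
    by (intro exI[of _ "p + q"]) (simp add: poly_value_add)
qed

lemma polyfun_mult [intro]: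
  assumes "polyfun I F" "polyfun I G" shows "polyfun I (\<lambda>v. F v * G v)"
proof -
  obtain p q where p: "\<forall>m\<in>keys p. keys m \<subseteq> I" "\<forall>v. F v = poly_value v p"
    and q: "\<forall>m\<in>keys q. keys m \<subseteq> I" "\<forall>v. G v = poly_value v q"
    using assms by (auto simp: polyfun_def)
  have "keys m \<subseteq> I" if "m \<in> keys (p * q)" for m
  proof -
    from that keys_mult[of p q] obtain m1 m2
      where m: "m = m1 + m2" "m1 \<in> keys p" "m2 \<in> keys q" by blast
    then show ?thesis using p(1) q(1) keys_add[of m1 m2] by blast
  qed
  then show ?thesis using p q unfolding polyfun_def
    by (intro exI[of _ "p * q"]) (auto simp: poly_value_mult)
qed

lemma polyfun_uminus [intro]: "polyfun I F \<Longrightarrow> polyfun I (\<lambda>v. - F v)"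
  using polyfun_mult[OF polyfun_const[of I "-1"], of F] by simp

lemma polyfun_diff [intro]: "polyfun I F \<Longrightarrow> polyfun I G \<Longrightarrow> polyfun I (\<lambda>v. F v - G v)"
  using polyfun_add[OF _ polyfun_uminus[of I G], of F] by simp

lemma polyfun_divide [intro]: "polyfun I F \<Longrightarrow> polyfun I (\<lambda>v. F v / c)"
  using polyfun_mult[OF _ polyfun_const[of I "inverse c"], of F] by (simp add: divide_inverse)

lemma polyfun_power [intro]: "polyfun I F \<Longrightarrow> polyfun I (\<lambda>v. F v ^ k)"
  by (induction k) auto

lemma polyfun_sum [intro]:
  "(\<And>a. a \<in> A \<Longrightarrow> polyfun I (F a)) \<Longrightarrow> polyfun I (\<lambda>v. \<Sum>a\<in>A. F a v)"
  by (induction A rule: infinite_finite_induct) auto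

lemma polyfun_prod [intro]:
  "(\<And>a. a \<in> A \<Longrightarrow> polyfun I (F a)) \<Longrightarrow> polyfun I (\<lambda>v. \<Prod>a\<in>A. F a v)"
  by (induction A rule: infinite_finite_induct) auto

lemma polyfun_poly_value:
  assumes "\<And>m i. m \<in> keys p \<Longrightarrow> i \<in> keys m \<Longrightarrow> polyfun P (\<lambda>w. \<Phi> w i)"
  shows "polyfun P (\<lambda>w. poly_value (\<Phi> w) p)"
  unfolding poly_value_def monomial_value_def
  by (intro polyfun_sum polyfun_mult polyfun_prod polyfun_power polyfun_const) (rule assms)

lemma polyfun_compose:
  assumes "polyfun I F" "\<And>i. i \<in> I \<Longrightarrow> polyfun P (\<lambda>w. \<Phi> w i)"
  shows "polyfun P (\<lambda>w. F (\<Phi> w))"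
proof -
  obtain p where "\<forall>m\<in>keys p. keys m \<subseteq> I" "\<forall>v. F v = poly_value v p"
    using assms by (auto simp: polyfun_def)
  then show ?thesis using assms(2) by (auto intro!: polyfun_poly_value)
qed

lemma polyfun_on_line:
  assumes "polyfun I F"
  shows "\<exists>q. \<forall>t. F (\<lambda>i. a i + t * b i) = poly q t"
proof -
  obtain p where p: "\<forall>v. F v = poly_value v p" using assms by (auto simp: polyfun_def)
  show ?thesis
    by (rule exI[of _ "\<Sum>m\<in>keys p. [:lookup p m:] * (\<Prod>x\<in>keys m. [:a x, b x:] ^ lookup m x)"])
      (simp add: p poly_value_def monomial_value_def poly_sum poly_prod)
qed

text \<open>Restricting to the line through two points where one of the functions does not vanish
  leaves two nonzero polynomials in one variable, which have finitely many zeros.\<close>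

lemma polyfun_common_nonzero:
  assumes "polyfun I F" "polyfun I G" "F a \<noteq> 0" "G b \<noteq> 0"
  shows "\<exists>w. F w \<noteq> 0 \<and> G w \<noteq> 0"
proof -
  let ?l = "\<lambda>t i. a i + t * (b i - a i)"
  obtain p q where pq: "\<And>t. F (?l t) = poly p t" "\<And>t. G (?l t) = poly q t"
    using polyfun_on_line[OF assms(1), of a "\<lambda>i. b i - a i"]
      polyfun_on_line[OF assms(2), of a "\<lambda>i. b i - a i"] by metis
  have "p \<noteq> 0" "q \<noteq> 0" using pq[of 0] pq[of 1] assms(3,4) by auto
  then have "p * q \<noteq> 0" by simp
  then have "finite {t. poly (p * q) t = 0}" by (rule poly_roots_finite)
  then obtain t where "poly (p * q) t \<noteq> 0"
    using infinite_UNIV_char_0[where 'a=complex] by (metis (mono_tags) ex_new_if_finite mem_Collect_eq)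
  then show ?thesis using pq by (intro exI[of _ "?l t"]) auto
qed

section \<open>Forms and Zariski closures\<close>

definition form :: "'i set \<Rightarrow> nat \<Rightarrow> 'i mpolynomial \<Rightarrow> bool" where
  "form I e p \<longleftrightarrow> (\<forall>m\<in>keys p. keys m \<subseteq> I \<and> total_degree m = e)"

lemma homogeneous_in_iff_form: "homogeneous_in I p \<longleftrightarrow> (\<exists>e. form I e p)"
  by (auto simp: homogeneous_in_def form_def)

lemma form_0: "form I e 0" by (simp add: form_def)

lemma form_1: "form I 0 1" by (simp add: form_def)

lemma form_add: "form I e p \<Longrightarrow> form I e q \<Longrightarrow> form I e (p + q)"
  using keys_add[of p q] by (auto simp: form_def)

lemma form_sum: "(\<And>a. a \<in> A \<Longrightarrow> form I e (f a)) \<Longrightarrow> form I e (sum f A)"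
  by (induction A rule: infinite_finite_induct) (auto simp: form_0 form_add)

lemma form_mult:
  assumes "form I a p" "form I b q" shows "form I (a + b) (p * q)"
  unfolding form_def
proof
  fix m assume "m \<in> keys (p * q)"
  with keys_mult[of p q] obtain m1 m2
    where m: "m = m1 + m2" "m1 \<in> keys p" "m2 \<in> keys q" by blast
  then show "keys m \<subseteq> I \<and> total_degree m = a + b"
    using assms keys_add[of m1 m2] unfolding form_def by (metis Un_subset_iff subset_trans total_degree_add)
qed

lemma form_power: "form I a p \<Longrightarrow> form I (k * a) (p ^ k)"
  by (induction k) (auto simp: form_1 form_mult)

lemma form_prod: "(\<And>a. a \<in> A \<Longrightarrow> form I (d a) (f a)) \<Longrightarrow> form I (sum d A) (prod f A)"
  by (induction A rule: infinite_finite_induct) (auto simp: form_1 form_mult)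

lemma form_const_poly: "form I 0 (const_poly c)"
  by (auto simp: form_def const_poly_def)

lemma form_var: "i \<in> I \<Longrightarrow> form I 1 (var i)"
  by (auto simp: form_def var_def total_degree_single)

lemma form_const_mult: "form I e p \<Longrightarrow> form I e (const_poly c * p)"
  using form_mult[OF form_const_poly, of I e p c] by simp

lemma polyfun_form: "form I e p \<Longrightarrow> polyfun I (\<lambda>v. poly_value v p)"
  by (auto simp: polyfun_def form_def)

text \<open>Each monomial is padded with a power of the chart coordinate \<open>z\<close>. So polynomial conditions
  on the affine chart \<open>v z = 1\<close> may be written inhomogeneously.\<close>

lemma polyfun_homogenize:
  assumes F: "polyfun I F" and z: "z \<in> I"
  shows "\<exists>e h. form I e h \<and> (\<forall>v. v z = 1 \<longrightarrow> poly_value v h = F v)"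
proof -
  obtain p where p: "\<forall>m\<in>keys p. keys m \<subseteq> I" "\<forall>v. F v = poly_value v p"
    using F by (auto simp: polyfun_def)
  define E where "E = Max (insert 0 (total_degree ` keys p))"
  have E: "total_degree m \<le> E" if "m \<in> keys p" for m
    unfolding E_def using that by (intro Max_ge) auto
  define t where "t m = m + Poly_Mapping.single z (E - total_degree m)" for m
  define h where "h = (\<Sum>m\<in>keys p. Poly_Mapping.single (t m) (lookup p m))"
  have "form I E h" unfolding h_def
  proof (rule form_sum)
    fix m assume m: "m \<in> keys p"
    have "keys (t m) \<subseteq> I"
      using keys_add[of m "Poly_Mapping.single z (E - total_degree m)"] p(1) m z
      by (auto simp: t_def split: if_splits)
    then show "form I E (Poly_Mapping.single (t m) (lookup p m))"
      using E[OF m] by (auto simp: form_def t_def total_degree_add total_degree_single)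
  qed
  moreover have "poly_value v h = F v" if "v z = 1" for v
    using that by (simp add: h_def poly_value_sum poly_value_single t_def monomial_value_add
        monomial_value_single p(2)) (simp add: poly_value_def)
  ultimately show ?thesis by blast
qed

definition vanishes_on :: "('i \<Rightarrow> complex) set set \<Rightarrow> 'i mpolynomial \<Rightarrow> bool" where
  "vanishes_on Z p \<longleftrightarrow> (\<forall>P\<in>Z. \<forall>v\<in>P. poly_value v p = 0)"

lemma vanishes_on_subset: "A \<subseteq> B \<Longrightarrow> vanishes_on B p \<Longrightarrow> vanishes_on A p"
  by (auto simp: vanishes_on_def)

lemma vanishes_on_proj_point:
  "form I e p \<Longrightarrow> vanishes_on {proj_point I v} p \<longleftrightarrow> poly_value v p = 0"
  unfolding vanishes_on_def using proj_point_vanish[of I p v] by (auto simp: homogeneous_in_iff_form)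

lemma vanishes_on_image:
  "form I e p \<Longrightarrow> vanishes_on ((\<lambda>w. proj_point I (f w)) ` A) p \<longleftrightarrow> (\<forall>w\<in>A. poly_value (f w) p = 0)"
  using vanishes_on_proj_point[of I e p] by (fastforce simp: vanishes_on_def)

lemma proj_point_in_space: "\<exists>i\<in>I. v i \<noteq> 0 \<Longrightarrow> proj_point I v \<in> proj_space I"
  by (auto simp: proj_space_def)

lemma proj_point_divide:
  assumes "c \<noteq> 0" shows "proj_point I (\<lambda>i. v i / c) = proj_point I v"
  unfolding proj_point_def
proof (intro set_eqI iffI; clarify)
  fix b :: complex assume "b \<noteq> 0"
  then show "\<exists>b'. (\<lambda>i\<in>I. b * (v i / c)) = (\<lambda>i\<in>I. b' * v i) \<and> b' \<noteq> 0"
    using assms by (intro exI[of _ "b / c"]) auto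
  show "\<exists>b'. (\<lambda>i\<in>I. b * v i) = (\<lambda>i\<in>I. b' * (v i / c)) \<and> b' \<noteq> 0"
    using assms \<open>b \<noteq> 0\<close> by (intro exI[of _ "b * c"]) auto
qed

lemma closedin_zero_locus: "form I e p \<Longrightarrow> closedin (zariski I) (zero_locus I {p})"
  unfolding closedin_zariski algebraic_set_def
  by (rule exI[of _ "{p}"]) (auto simp: homogeneous_in_iff_form)

lemma closed_separates:
  assumes "closedin (zariski I) A" "P \<in> proj_space I" "P \<notin> A"
  obtains e p where "form I e p" "vanishes_on A p" "\<not> vanishes_on {P} p"
proof -
  obtain F where "\<forall>f\<in>F. homogeneous_in I f" "A = zero_locus I F"
    using assms(1) by (auto simp: closedin_zariski algebraic_set_def)
  then show ?thesis
    using assms(2,3) that unfolding zero_locus_def vanishes_on_def homogeneous_in_iff_form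
    by (smt (verit) mem_Collect_eq singletonD singletonI)
qed

lemma vanishes_on_closure:
  assumes "T \<subseteq> proj_space I" "form I e p"
  shows "vanishes_on (zariski I closure_of T) p \<longleftrightarrow> vanishes_on T p"
proof
  assume "vanishes_on T p"
  then have "T \<subseteq> zero_locus I {p}" using assms(1) by (auto simp: vanishes_on_def zero_locus_def)
  then have "zariski I closure_of T \<subseteq> zero_locus I {p}"
    by (intro closure_of_minimal closedin_zero_locus[OF assms(2)])
  then show "vanishes_on (zariski I closure_of T) p" by (auto simp: vanishes_on_def zero_locus_def)
next
  show "vanishes_on (zariski I closure_of T) p \<Longrightarrow> vanishes_on T p"
    using closure_of_subset[of T "zariski I"] assms(1) vanishes_on_subset[of T] by simp
qed

lemma in_zariski_closure_iff:
  assumes "T \<subseteq> proj_space I"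
  shows "P \<in> zariski I closure_of T \<longleftrightarrow>
    P \<in> proj_space I \<and> (\<forall>e p. form I e p \<longrightarrow> vanishes_on T p \<longrightarrow> vanishes_on {P} p)"
proof
  assume P: "P \<in> zariski I closure_of T"
  then have "P \<in> proj_space I" using closure_of_subset_topspace[of "zariski I" T] by auto
  moreover have "vanishes_on {P} p" if "form I e p" "vanishes_on T p" for e p
    using vanishes_on_closure[OF assms that(1)] that(2) P by (auto simp: vanishes_on_def)
  ultimately show "P \<in> proj_space I \<and> (\<forall>e p. form I e p \<longrightarrow> vanishes_on T p \<longrightarrow> vanishes_on {P} p)"
    by blast
next
  assume P: "P \<in> proj_space I \<and> (\<forall>e p. form I e p \<longrightarrow> vanishes_on T p \<longrightarrow> vanishes_on {P} p)"
  show "P \<in> zariski I closure_of T"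
  proof (rule ccontr)
    assume "P \<notin> zariski I closure_of T"
    with P obtain e p where "form I e p" "vanishes_on (zariski I closure_of T) p" "\<not> vanishes_on {P} p"
      using closed_separates[OF closedin_closure_of] by blast
    then show False using P vanishes_on_closure[OF assms] by blast
  qed
qed

section \<open>Irreducible closed sets\<close>

text \<open>The zero loci of the two factors cut \<open>Z\<close> into two closed pieces that cover it.\<close>

lemma irreducible_mult:
  assumes Z: "irreducible_closedin (zariski I) Z" and "form I a p" "form I b q"
    and "vanishes_on Z (p * q)"
  shows "vanishes_on Z p \<or> vanishes_on Z q"
proof -
  have Zc: "closedin (zariski I) Z" and sub: "Z \<subseteq> proj_space I"
    using Z closedin_subset[of "zariski I" Z] by (auto simp: irreducible_closedin_def)
  let ?A = "Z \<inter> zero_locus I {p}" and ?B = "Z \<inter> zero_locus I {q}"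
  have cl: "closedin (zariski I) ?A" "closedin (zariski I) ?B"
    using Zc closedin_zero_locus assms(2,3) by (auto intro: closedin_Int)
  have "P \<in> ?A \<union> ?B" if PZ: "P \<in> Z" for P
  proof -
    obtain v where v: "P = proj_point I v" using sub PZ by (auto simp: proj_space_def)
    have "vanishes_on {P} (p * q)" using assms(4) PZ by (auto simp: vanishes_on_def)
    then have "poly_value v p = 0 \<or> poly_value v q = 0"
      using vanishes_on_proj_point[OF form_mult[OF assms(2,3)]] by (auto simp: v poly_value_mult)
    then have "vanishes_on {P} p \<or> vanishes_on {P} q"
      using vanishes_on_proj_point assms(2,3) v by blast
    then show ?thesis using PZ sub by (auto simp: vanishes_on_def zero_locus_def)
  qed
  then have "Z = ?A \<union> ?B" by blast
  then have "Z = ?A \<or> Z = ?B" using Z cl unfolding irreducible_closedin_def by blast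
  then show ?thesis by (auto simp: vanishes_on_def zero_locus_def)
qed

text \<open>A polynomially parametrised family of points of projective space: \<open>P\<close> is the set of
  parameters that actually occur, and \<open>\<Phi> w\<close> is a vector of homogeneous coordinates.\<close>

definition family :: "'p set \<Rightarrow> 'i set \<Rightarrow> (('p \<Rightarrow> complex) \<Rightarrow> 'i \<Rightarrow> complex) \<Rightarrow> bool" where
  "family P I \<Phi> \<longleftrightarrow> (\<forall>i\<in>I. polyfun P (\<lambda>w. \<Phi> w i)) \<and> (\<forall>w. \<exists>i\<in>I. \<Phi> w i \<noteq> 0)"

abbreviation "points I \<Phi> A \<equiv> (\<lambda>w. proj_point I (\<Phi> w)) ` A"

lemma points_in_space: "family P I \<Phi> \<Longrightarrow> points I \<Phi> A \<subseteq> proj_space I"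
  by (auto simp: family_def intro: proj_point_in_space)

lemma polyfun_family_form:
  assumes "family P I \<Phi>" "form I e p" shows "polyfun P (\<lambda>w. poly_value (\<Phi> w) p)"
  using assms by (intro polyfun_compose[OF polyfun_form]) (auto simp: family_def)

text \<open>If a form vanishes at all parameters with \<open>D w \<noteq> 0\<close>, then its product with \<open>D\<close>
  is a polynomial in the parameters that vanishes everywhere, hence so does the form. A closure may
  therefore be computed from parameters in general position.\<close>

lemma closure_of_generic_points:
  assumes "family P I \<Phi>" "polyfun P D" "D w0 \<noteq> 0"
  shows "zariski I closure_of points I \<Phi> {w. D w \<noteq> 0} = zariski I closure_of range (\<lambda>w. proj_point I (\<Phi> w))"
proof (rule subset_antisym)
  show "zariski I closure_of points I \<Phi> {w. D w \<noteq> 0} \<subseteq> zariski I closure_of range (\<lambda>w. proj_point I (\<Phi> w))"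
    by (intro closure_of_mono) auto
  have "vanishes_on (range (\<lambda>w. proj_point I (\<Phi> w))) p"
    if p: "form I e p" "vanishes_on (points I \<Phi> {w. D w \<noteq> 0}) p" for e p
  proof (rule ccontr)
    assume "\<not> ?thesis"
    then obtain w1 where w1: "poly_value (\<Phi> w1) p \<noteq> 0"
      using vanishes_on_image[OF p(1), of \<Phi> UNIV] by auto
    have "\<exists>w. poly_value (\<Phi> w) p \<noteq> 0 \<and> D w \<noteq> 0"
      by (rule polyfun_common_nonzero[where F = "\<lambda>w. poly_value (\<Phi> w) p" and G = D and a = w1 and b = w0 and I = P])
        (use polyfun_family_form[OF assms(1) p(1)] assms(2,3) w1 in auto)
    then show False using p(2) vanishes_on_image[OF p(1), of \<Phi> "{w. D w \<noteq> 0}"] by auto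
  qed
  then show "zariski I closure_of range (\<lambda>w. proj_point I (\<Phi> w)) \<subseteq> zariski I closure_of points I \<Phi> {w. D w \<noteq> 0}"
    unfolding in_zariski_closure_iff[OF points_in_space[OF assms(1)]] subset_iff by blast
qed

text \<open>Irreducibility is inherited from the parameter space: two forms that each fail to vanish
  somewhere on the family are both nonzero at a common parameter.\<close>

lemma irreducible_closure_of_family:
  assumes \<Phi>: "family P I \<Phi>"
  shows "irreducible_closedin (zariski I) (zariski I closure_of range (\<lambda>w. proj_point I (\<Phi> w)))"
    (is "irreducible_closedin _ ?Z")
  unfolding irreducible_closedin_def
proof (intro conjI allI impI)
  have sub: "range (\<lambda>w. proj_point I (\<Phi> w)) \<subseteq> ?Z"
    using points_in_space[OF \<Phi>] by (intro closure_of_subset) auto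
  then show "?Z \<noteq> {}" by auto
  fix A B assume AB: "closedin (zariski I) A \<and> closedin (zariski I) B \<and> ?Z = A \<union> B"
  have *: "\<exists>e p w. form I e p \<and> vanishes_on C p \<and> poly_value (\<Phi> w) p \<noteq> 0"
    if C: "closedin (zariski I) C" "C \<subseteq> ?Z" "?Z \<noteq> C" for C
  proof -
    have "\<not> range (\<lambda>w. proj_point I (\<Phi> w)) \<subseteq> C"
      using closure_of_minimal[OF _ C(1)] C(2,3) by blast
    then obtain w where "proj_point I (\<Phi> w) \<notin> C" by blast
    moreover have "proj_point I (\<Phi> w) \<in> proj_space I" using points_in_space[OF \<Phi>, of UNIV] by auto
    ultimately obtain e p where "form I e p" "vanishes_on C p" "\<not> vanishes_on {proj_point I (\<Phi> w)} p"
      using closed_separates[OF C(1)] by blast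
    then show ?thesis using vanishes_on_proj_point by blast
  qed
  show "?Z = A \<or> ?Z = B"
  proof (rule ccontr)
    assume "\<not> ?thesis"
    then obtain e p a e' q b where pq: "form I e p" "vanishes_on A p" "poly_value (\<Phi> a) p \<noteq> 0"
      "form I e' q" "vanishes_on B q" "poly_value (\<Phi> b) q \<noteq> 0"
      using *[of A] *[of B] AB by blast
    obtain w where w: "poly_value (\<Phi> w) p \<noteq> 0" "poly_value (\<Phi> w) q \<noteq> 0"
      using polyfun_common_nonzero[where F = "\<lambda>w. poly_value (\<Phi> w) p" and G = "\<lambda>w. poly_value (\<Phi> w) q",
          OF polyfun_family_form[OF \<Phi> pq(1)] polyfun_family_form[OF \<Phi> pq(4)] pq(3,6)] by (elim exE conjE)
    have "proj_point I (\<Phi> w) \<in> A \<union> B" using sub AB by auto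
    then have "poly_value (\<Phi> w) p = 0 \<or> poly_value (\<Phi> w) q = 0"
      using pq(2,5) vanishes_on_proj_point[OF pq(1)] vanishes_on_proj_point[OF pq(4)]
      by (auto simp: vanishes_on_def)
    then show False using w by blast
  qed
qed auto

section \<open>Krull dimension of polynomially parametrised families\<close>

text \<open>Gaussian elimination of one unknown \<open>j0\<close> against one equation \<open>k\<close>.\<close>

lemma homogeneous_system_nontrivial_solution:
  fixes a :: "'k \<Rightarrow> 'j \<Rightarrow> complex"
  assumes "finite K" "finite J" "card K < card J"
  shows "\<exists>x. (\<exists>j\<in>J. x j \<noteq> 0) \<and> (\<forall>k\<in>K. (\<Sum>j\<in>J. a k j * x j) = 0)"
  using assms
proof (induction K arbitrary: J a rule: finite_induct)
  case empty
  then show ?case by (intro exI[of _ "\<lambda>_. 1"]) (auto simp: card_gt_0_iff)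
next
  case (insert k K)
  show ?case
  proof (cases "\<forall>j\<in>J. a k j = 0")
    case True
    have "card K < card J" using insert by simp
    then obtain x where "\<exists>j\<in>J. x j \<noteq> 0" "\<forall>k\<in>K. (\<Sum>j\<in>J. a k j * x j) = 0"
      using insert.IH[OF insert.prems(1), of a] by blast
    then show ?thesis using True by (intro exI[of _ x]) auto
  next
    case False
    then obtain j0 where j0: "j0 \<in> J" "a k j0 \<noteq> 0" by blast
    let ?J = "J - {j0}"
    have "card K < card ?J" using insert j0 by simp
    then obtain x where x: "\<exists>j\<in>?J. x j \<noteq> 0"
      "\<forall>k'\<in>K. (\<Sum>j\<in>?J. (a k' j - a k' j0 * a k j / a k j0) * x j) = 0"
      using insert.IH[OF finite_Diff[OF insert.prems(1)], of "{j0}" "\<lambda>k' j. a k' j - a k' j0 * a k j / a k j0"]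
      by blast
    define y where "y = x(j0 := - (\<Sum>j\<in>?J. a k j * x j) / a k j0)"
    have split: "(\<Sum>j\<in>J. b j * y j) = b j0 * y j0 + (\<Sum>j\<in>?J. b j * x j)" for b
      using j0 insert.prems(1) by (subst sum.remove[of J j0]) (auto simp: y_def)
    have "(\<Sum>j\<in>J. a k' j * y j) = 0" if "k' \<in> insert k K" for k'
    proof (cases "k' = k")
      case True
      then show ?thesis unfolding split using j0 by (simp add: y_def)
    next
      case False
      then have "(\<Sum>j\<in>?J. (a k' j - a k' j0 * a k j / a k j0) * x j) = 0" using x(2) that by blast
      moreover have "(\<Sum>j\<in>?J. (a k' j - a k' j0 * a k j / a k j0) * x j) =
          (\<Sum>j\<in>?J. a k' j * x j) - a k' j0 / a k j0 * (\<Sum>j\<in>?J. a k j * x j)"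
        unfolding sum_distrib_left sum_subtractf[symmetric]
        by (rule sum.cong) (auto simp: algebra_simps)
      ultimately have "(\<Sum>j\<in>?J. a k' j * x j) = a k' j0 / a k j0 * (\<Sum>j\<in>?J. a k j * x j)"
        by simp
      then show ?thesis unfolding split using j0 by (simp add: y_def)
    qed
    moreover have "\<exists>j\<in>J. y j \<noteq> 0" using x(1) by (auto simp: y_def)
    ultimately show ?thesis by blast
  qed
qed

text \<open>Monomials in the forms \<open>f i\<close> are linearly independent on the top of the chain: the part of
  a relation with the smallest exponent of the last form survives division by a power of that
  form, which does not vanish on the irreducible set \<open>Z (Suc s)\<close>; on \<open>Z s\<close> all
  other terms drop out, and what remains is a relation among the earlier forms.\<close>

lemma chain_monomials_independent:
  assumes irr: "\<And>i. i \<le> s \<Longrightarrow> irreducible_closedin (zariski I) (Z i)"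
    and mono: "\<And>i. i < s \<Longrightarrow> Z i \<subseteq> Z (Suc i)"
    and form: "\<And>i. i \<le> s \<Longrightarrow> form I (d i) (f i)" and d0: "d 0 = 1"
    and nz: "\<And>i. i \<le> s \<Longrightarrow> \<not> vanishes_on (Z i) (f i)"
    and vz: "\<And>i. i < s \<Longrightarrow> vanishes_on (Z i) (f (Suc i))"
    and A: "finite A" "A \<noteq> {}"
    and inj: "\<And>a b. a \<in> A \<Longrightarrow> b \<in> A \<Longrightarrow> (\<forall>i\<in>{1..s}. a i = b i) \<Longrightarrow> a = b"
    and deg: "\<And>a. a \<in> A \<Longrightarrow> (\<Sum>i\<in>{1..s}. a i * d i) \<le> C"
    and c: "\<And>a. a \<in> A \<Longrightarrow> c a \<noteq> 0"
  shows "\<not> vanishes_on (Z s) (\<Sum>a\<in>A. const_poly (c a) *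
           (f 0 ^ (C - (\<Sum>i\<in>{1..s}. a i * d i)) * (\<Prod>i\<in>{1..s}. f i ^ a i)))"
  using assms
proof (induction s arbitrary: A C)
  case 0
  obtain a where a: "a \<in> A" using "0.prems"(8) by blast
  have "A = {a}"
  proof (rule set_eqI)
    show "b \<in> A \<longleftrightarrow> b \<in> {a}" for b using "0.prems"(9)[of b a] a by auto
  qed
  moreover obtain P v where "P \<in> Z 0" "v \<in> P" "poly_value v (f 0) \<noteq> 0"
    using "0.prems"(5)[OF le_refl] unfolding vanishes_on_def by blast
  moreover have "c a \<noteq> 0" using "0.prems"(11)[OF a] .
  ultimately show ?case
    by (simp add: vanishes_on_def poly_value_mult poly_value_power) blast
next
  case (Suc s)
  define D where "D a = (\<Sum>i\<in>{1..s}. a i * d i)" for a :: "nat \<Rightarrow> nat"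
  define m where "m a = (\<Prod>i\<in>{1..s}. f i ^ a i)" for a :: "nat \<Rightarrow> nat"
  define F where "F = f (Suc s)"
  define \<delta> where "\<delta> = d (Suc s)"
  have D_Suc: "(\<Sum>i\<in>{1..Suc s}. a i * d i) = D a + a (Suc s) * \<delta>" for a
    by (simp add: D_def \<delta>_def)
  have m_Suc: "(\<Prod>i\<in>{1..Suc s}. f i ^ a i) = m a * F ^ a (Suc s)" for a
    by (simp add: m_def F_def)
  have F: "form I \<delta> F" using Suc.prems(3) by (simp add: F_def \<delta>_def)
  have f0: "form I 1 (f 0)" using Suc.prems(3)[of 0] d0 by simp
  have m: "form I (D a) (m a)" for a
    unfolding m_def D_def using Suc.prems(3) by (intro form_prod form_power) auto
  define j where "j = Min ((\<lambda>a. a (Suc s)) ` A)"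
  have jmin: "j \<le> a (Suc s)" if "a \<in> A" for a
    unfolding j_def using that Suc.prems(7) by (intro Min_le) auto
  define B where "B = {a \<in> A. a (Suc s) = j}"
  have "j \<in> (\<lambda>a. a (Suc s)) ` A" unfolding j_def using Suc.prems(7,8) by (intro Min_in) auto
  then have B: "B \<subseteq> A" "finite B" "B \<noteq> {}" using Suc.prems(7) by (auto simp: B_def)
  have degA: "D a + a (Suc s) * \<delta> \<le> C" if "a \<in> A" for a
    using Suc.prems(10)[OF that] by (simp only: D_Suc)
  define C' where "C' = C - j * \<delta>"
  have degB: "D a \<le> C'" if "a \<in> B" for a
    using degA[of a] that unfolding B_def C'_def by auto
  define g where "g = (\<Sum>a\<in>B. const_poly (c a) * (f 0 ^ (C' - D a) * m a))"
  define h where "h = (\<Sum>a\<in>A - B. const_poly (c a) *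
      (f 0 ^ (C - (D a + a (Suc s) * \<delta>)) * (m a * F ^ (a (Suc s) - j - 1))))"
  have above: "j < a (Suc s)" if "a \<in> A - B" for a
    using jmin[of a] that by (auto simp: B_def)
  have G: "(\<Sum>a\<in>A. const_poly (c a) * (f 0 ^ (C - (\<Sum>i\<in>{1..Suc s}. a i * d i)) * (\<Prod>i\<in>{1..Suc s}. f i ^ a i)))
      = F ^ j * (g + F * h)"
  proof -
    have "(\<Sum>a\<in>B. const_poly (c a) * (f 0 ^ (C - (D a + a (Suc s) * \<delta>)) * (m a * F ^ a (Suc s)))) = F ^ j * g"
      unfolding g_def sum_distrib_left
      by (rule sum.cong) (auto simp: B_def C'_def diff_diff_left add.commute mult_ac)
    moreover have "(\<Sum>a\<in>A - B. const_poly (c a) * (f 0 ^ (C - (D a + a (Suc s) * \<delta>)) * (m a * F ^ a (Suc s))))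
        = F ^ j * (F * h)"
      unfolding h_def sum_distrib_left
    proof (rule sum.cong)
      fix a assume "a \<in> A - B"
      from above[OF this] have "F ^ a (Suc s) = F ^ j * (F * F ^ (a (Suc s) - j - 1))"
        by (simp flip: power_Suc power_add)
      then show "const_poly (c a) * (f 0 ^ (C - (D a + a (Suc s) * \<delta>)) * (m a * F ^ a (Suc s))) =
        F ^ j * (F * (const_poly (c a) * (f 0 ^ (C - (D a + a (Suc s) * \<delta>)) * (m a * F ^ (a (Suc s) - j - 1)))))"
        by (simp only: mult_ac)
    qed simp
    ultimately show ?thesis
      unfolding D_Suc m_Suc sum.subset_diff[OF B(1) Suc.prems(7)]
      by (simp add: distrib_left)
  qed
  have formg: "form I C' g" unfolding g_def
  proof (intro form_sum form_const_mult)
    fix a assume "a \<in> B"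
    then show "form I C' (f 0 ^ (C' - D a) * m a)"
      using form_mult[OF form_power[OF f0, of "C' - D a"] m[of a]] degB by simp
  qed
  have formh: "form I C' (F * h)"
    unfolding h_def sum_distrib_left
  proof (intro form_sum)
    fix a assume a: "a \<in> A - B"
    let ?x = "a (Suc s)"
    have "\<delta> + (C - (D a + ?x * \<delta>) + (D a + (?x - j - 1) * \<delta>)) = C'"
    proof -
      obtain y where y: "?x = j + 1 + y" using above[OF a] less_imp_Suc_add by fastforce
      show ?thesis using degA[of a] a unfolding C'_def y by (simp add: algebra_simps)
    qed
    then show "form I C' (F * (const_poly (c a) * (f 0 ^ (C - (D a + ?x * \<delta>)) * (m a * F ^ (?x - j - 1)))))"
      using form_mult[OF F form_const_mult[OF form_mult[OF form_power[OF f0, of "C - (D a + ?x * \<delta>)"]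
            form_mult[OF m[of a] form_power[OF F, of "?x - j - 1"]]]]] by simp
  qed
  show ?case unfolding G
  proof
    assume V: "vanishes_on (Z (Suc s)) (F ^ j * (g + F * h))"
    have "\<not> vanishes_on (Z (Suc s)) (F ^ j)"
      using Suc.prems(5)[of "Suc s"] by (auto simp: vanishes_on_def F_def poly_value_power)
    then have "vanishes_on (Z (Suc s)) (g + F * h)"
      using irreducible_mult[OF Suc.prems(1)[of "Suc s"] form_power[OF F] form_add[OF formg formh] V] by auto
    then have "vanishes_on (Z s) (g + F * h)"
      using Suc.prems(2)[of s] vanishes_on_subset by blast
    moreover have "vanishes_on (Z s) F" using Suc.prems(6)[of s] by (simp add: F_def)
    ultimately have "vanishes_on (Z s) g" by (auto simp: vanishes_on_def poly_value_add poly_value_mult)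
    moreover have "\<not> vanishes_on (Z s) g" unfolding g_def D_def m_def
    proof (rule Suc.IH)
      fix a b assume "a \<in> B" "b \<in> B" "\<forall>i\<in>{1..s}. a i = b i"
      moreover from this have "\<forall>i\<in>{1..Suc s}. a i = b i" by (auto simp: B_def le_Suc_eq)
      ultimately show "a = b" using Suc.prems(9)[of a b] by (auto simp: B_def)
    qed (use Suc.prems B degB in \<open>auto simp: D_def\<close>)
    ultimately show False by blast
  qed
qed

lemma card_monomials_le:
  assumes "finite P"
  shows "finite {m. keys m \<subseteq> P \<and> total_degree m \<le> b}" (is "finite ?M")
    and "card {m. keys m \<subseteq> P \<and> total_degree m \<le> b} \<le> (b + 1) ^ card P"
proof -
  let ?f = "\<lambda>m. restrict (lookup m) P"
  have inj: "inj_on ?f ?M"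
  proof (rule inj_onI, rule poly_mapping_eqI)
    fix m m' x assume m: "m \<in> ?M" "m' \<in> ?M" "?f m = ?f m'"
    show "lookup m x = lookup m' x"
    proof (cases "x \<in> P")
      case True
      then show ?thesis using fun_cong[OF m(3), of x] by simp
    next
      case False
      then have "x \<notin> keys m" "x \<notin> keys m'" using m by auto
      then show ?thesis by (simp add: in_keys_iff)
    qed
  qed
  have sub: "?f ` ?M \<subseteq> PiE P (\<lambda>_. {..b})"
    by (auto intro: le_trans[OF lookup_le_total_degree])
  have fin: "finite (PiE P (\<lambda>_. {..b}))" using assms by (intro finite_PiE) auto
  show "finite ?M" using finite_subset[OF sub fin] inj finite_imageD by blast
  show "card ?M \<le> (b + 1) ^ card P"
    using card_inj_on_le[OF inj sub fin] assms by (simp add: card_PiE)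
qed

definition bounded_poly :: "'i set \<Rightarrow> nat \<Rightarrow> 'i mpolynomial \<Rightarrow> bool" where
  "bounded_poly P b p \<longleftrightarrow> (\<forall>m\<in>keys p. keys m \<subseteq> P \<and> total_degree m \<le> b)"

lemma bounded_poly_mono: "bounded_poly P a p \<Longrightarrow> a \<le> b \<Longrightarrow> bounded_poly P b p"
  by (auto simp: bounded_poly_def)

lemma bounded_poly_mult:
  assumes "bounded_poly P a p" "bounded_poly P b q" shows "bounded_poly P (a + b) (p * q)"
  unfolding bounded_poly_def
proof
  fix m assume "m \<in> keys (p * q)"
  with keys_mult[of p q] obtain m1 m2
    where m: "m = m1 + m2" "m1 \<in> keys p" "m2 \<in> keys q" by blast
  then have "keys m1 \<subseteq> P" "keys m2 \<subseteq> P" "total_degree m1 \<le> a" "total_degree m2 \<le> b"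
    using assms by (auto simp: bounded_poly_def)
  then show "keys m \<subseteq> P \<and> total_degree m \<le> a + b"
    using keys_add[of m1 m2] unfolding m(1) total_degree_add by (meson Un_least add_mono subset_trans)
qed

lemma bounded_poly_power: "bounded_poly P a p \<Longrightarrow> bounded_poly P (k * a) (p ^ k)"
  by (induction k) (auto simp: bounded_poly_mult, simp add: bounded_poly_def)

lemma bounded_poly_prod:
  "(\<And>a. a \<in> A \<Longrightarrow> bounded_poly P (b a) (f a)) \<Longrightarrow> bounded_poly P (sum b A) (prod f A)"
  by (induction A rule: infinite_finite_induct) (auto simp: bounded_poly_mult, auto simp: bounded_poly_def)

lemma poly_value_bounded:
  assumes "finite P" "bounded_poly P b p"
  shows "poly_value v p = (\<Sum>m | keys m \<subseteq> P \<and> total_degree m \<le> b. lookup p m * monomial_value v m)"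
  unfolding poly_value_def
  by (rule sum.mono_neutral_left)
    (use assms card_monomials_le(1)[OF assms(1)] in \<open>auto simp: bounded_poly_def in_keys_iff\<close>)

text \<open>Choosing forms \<open>f i\<close> that vanish on \<open>Z (i - 1)\<close> but not on \<open>Z i\<close> makes a long
  chain produce many independent monomials. With \<open>s\<close> larger than the number \<open>r\<close> of parameters, the \<open>e ^ s\<close> monomials in the forms
  with exponents below \<open>e\<close> would pull back to polynomials in the parameters of degree \<open>O(e)\<close>,
  a space of dimension \<open>O(e ^ r)\<close>.\<close>

lemma chain_length_le_parameters:
  assumes P: "finite P" and \<Phi>: "family P I \<Phi>"
    and irr: "\<And>i. i \<le> s \<Longrightarrow> irreducible_closedin (zariski I) (Z i)"
    and chain: "\<And>i. i < s \<Longrightarrow> Z i \<subset> Z (Suc i)"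
    and top: "Z s \<subseteq> zariski I closure_of range (\<lambda>w. proj_point I (\<Phi> w))"
  shows "s \<le> card P"
proof (rule ccontr)
  assume "\<not> ?thesis"
  then have rs: "card P < s" by simp
  have sub: "Z i \<subseteq> proj_space I" if "i \<le> s" for i
    using irr[OF that] closedin_subset[of "zariski I"] by (auto simp: irreducible_closedin_def)
  have "\<exists>e p. form I e p \<and> \<not> vanishes_on (Z i) p \<and>
      (case i of 0 \<Rightarrow> e = 1 | Suc j \<Rightarrow> vanishes_on (Z j) p)" if i: "i \<le> s" for i
  proof (cases i)
    case 0
    \<comment> \<open>a coordinate has degree 1, so its powers can bring all monomials to the same degree\<close>
    obtain Q where Q: "Q \<in> Z 0" using irr[of 0] by (auto simp: irreducible_closedin_def)
    then obtain v x where v: "Q = proj_point I v" "x \<in> I" "v x \<noteq> 0"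
      using sub[of 0] by (auto simp: proj_space_def)
    have "\<not> vanishes_on {Q} (var x)"
      using vanishes_on_proj_point[OF form_var[OF v(2)], of v] v by simp
    then show ?thesis using 0 Q form_var[OF v(2)]
      by (intro exI[of _ 1] exI[of _ "var x"]) (auto simp: vanishes_on_def)
  next
    case (Suc j)
    then obtain Q where Q: "Q \<in> Z i" "Q \<notin> Z j" using chain[of j] i by auto
    then obtain e p where "form I e p" "vanishes_on (Z j) p" "\<not> vanishes_on {Q} p"
      using closed_separates[of I "Z j" Q] irr[of j] sub[OF i] Suc i
      by (auto simp: irreducible_closedin_def)
    then show ?thesis using Suc Q
      by (intro exI[of _ e] exI[of _ p]) (auto simp: vanishes_on_def)
  qed
  then obtain d f where df: "\<And>i. i \<le> s \<Longrightarrow> form I (d i) (f i) \<and> \<not> vanishes_on (Z i) (f i) \<and>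
      (case i of 0 \<Rightarrow> d i = 1 | Suc j \<Rightarrow> vanishes_on (Z j) (f i))"
    by metis
  have "\<exists>q. (\<forall>m\<in>keys q. keys m \<subseteq> P) \<and> (\<forall>w. poly_value (\<Phi> w) (f i) = poly_value w q)" if "i \<le> s" for i
    using polyfun_family_form[OF \<Phi>, of "d i" "f i"] df[OF that] unfolding polyfun_def by blast
  then obtain q where q: "\<And>i m. i \<le> s \<Longrightarrow> m \<in> keys (q i) \<Longrightarrow> keys m \<subseteq> P"
    "\<And>i w. i \<le> s \<Longrightarrow> poly_value (\<Phi> w) (f i) = poly_value w (q i)" by metis
  define E where "E = Max (insert 0 (total_degree ` (\<Union>i\<le>s. keys (q i))))"
  have bq: "bounded_poly P E (q i)" if "i \<le> s" for i
    unfolding bounded_poly_def E_def using q(1) that by (auto intro!: Max_ge)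
  define D where "D = (\<Sum>i\<in>{1..s}. d i)"
  define B where "B = E * (D + s)"
  \<comment> \<open>large enough that \<open>e ^ s \<ge> e * e ^ card P\<close> exceeds \<open>(e * (B + 1)) ^ card P\<close>\<close>
  define e where "e = (B + 1) ^ card P + 1"
  define A where "A = PiE {1..s} (\<lambda>_. {..<e})"
  define w where "w a = (\<Sum>i\<in>{1..s}. a i * d i)" for a :: "nat \<Rightarrow> nat"
  define g where "g a = f 0 ^ (e * D - w a) * (\<Prod>i\<in>{1..s}. f i ^ a i)" for a
  define p where "p a = q 0 ^ (e * D - w a) * (\<Prod>i\<in>{1..s}. q i ^ a i)" for a
  define M where "M = {m. keys m \<subseteq> P \<and> total_degree m \<le> e * B}"
  have finA: "finite A" unfolding A_def by (intro finite_PiE) auto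
  have wA: "w a \<le> e * D" if "a \<in> A" for a
  proof -
    have "w a \<le> (\<Sum>i\<in>{1..s}. e * d i)" unfolding w_def
    proof (rule sum_mono)
      fix i assume i: "i \<in> {1..s}"
      have "a \<in> PiE {1..s} (\<lambda>_. {..<e})" using that by (simp only: A_def)
      from PiE_mem[OF this i] show "a i * d i \<le> e * d i" by simp
    qed
    then show ?thesis by (simp add: D_def sum_distrib_left)
  qed
  have bp: "bounded_poly P (e * B) (p a)" if "a \<in> A" for a
  proof -
    have "bounded_poly P ((e * D - w a) * E + (\<Sum>i\<in>{1..s}. a i * E)) (p a)"
      unfolding p_def using bq by (intro bounded_poly_mult bounded_poly_power bounded_poly_prod) auto
    moreover have "(\<Sum>i\<in>{1..s}. a i * E) \<le> (\<Sum>i\<in>{1..s}. e * E)"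
    proof (rule sum_mono)
      fix i assume i: "i \<in> {1..s}"
      have "a \<in> PiE {1..s} (\<lambda>_. {..<e})" using that by (simp only: A_def)
      from PiE_mem[OF this i] show "a i * E \<le> e * E" by simp
    qed
    moreover have "(e * D - w a) * E \<le> e * D * E" by simp
    ultimately show ?thesis by (elim bounded_poly_mono) (simp add: B_def algebra_simps)
  qed
  have gp: "poly_value (\<Phi> u) (g a) = poly_value u (p a)" for u a
    unfolding g_def p_def poly_value_mult poly_value_power poly_value_prod
    using q(2) by (intro arg_cong2[where f = "(*)"] prod.cong) auto
  have "card M < card A"
  proof -
    have "card M \<le> (e * B + 1) ^ card P" unfolding M_def by (rule card_monomials_le(2)[OF P])
    also have "\<dots> \<le> (e * (B + 1)) ^ card P" by (intro power_mono) (auto simp: e_def)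
    also have "\<dots> = e ^ card P * (B + 1) ^ card P" by (simp only: power_mult_distrib)
    also have "\<dots> < e ^ card P * e" by (simp add: e_def)
    also have "\<dots> = e ^ Suc (card P)" by simp
    also have "\<dots> \<le> e ^ s" using rs by (intro power_increasing) (auto simp: e_def)
    also have "\<dots> = card A" unfolding A_def by (simp add: card_PiE)
    finally show ?thesis .
  qed
  then obtain x where x: "\<exists>a\<in>A. x a \<noteq> 0" "\<forall>m\<in>M. (\<Sum>a\<in>A. lookup (p a) m * x a) = 0"
    using homogeneous_system_nontrivial_solution[OF card_monomials_le(1)[OF P, of "e * B"] finA,
        of "\<lambda>m a. lookup (p a) m"] unfolding M_def by blast
  define A' where "A' = {a \<in> A. x a \<noteq> 0}"
  define G where "G = (\<Sum>a\<in>A'. const_poly (x a) * g a)"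
  have formg: "form I (e * D) (g a)" if a: "a \<in> A" for a
  proof -
    have "form I ((e * D - w a) * d 0 + (\<Sum>i\<in>{1..s}. a i * d i)) (g a)"
      unfolding g_def using df by (intro form_mult form_power form_prod) auto
    then show ?thesis using wA[OF a] df[of 0] by (simp add: w_def)
  qed
  have "form I (e * D) G" unfolding G_def A'_def using formg by (intro form_sum form_const_mult) auto
  moreover have "poly_value (\<Phi> u) G = 0" for u
  proof -
    have "poly_value (\<Phi> u) G = (\<Sum>a\<in>A. x a * poly_value u (p a))"
      unfolding G_def poly_value_sum poly_value_mult poly_value_const_poly gp A'_def
      using finA by (intro sum.mono_neutral_left) auto
    also have "\<dots> = (\<Sum>a\<in>A. \<Sum>m\<in>M. x a * (lookup (p a) m * monomial_value u m))"
      unfolding M_def sum_distrib_left[symmetric]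
      by (rule sum.cong[OF refl]) (simp add: poly_value_bounded[OF P bp])
    also have "\<dots> = (\<Sum>m\<in>M. (\<Sum>a\<in>A. lookup (p a) m * x a) * monomial_value u m)"
      by (subst sum.swap) (simp add: sum_distrib_left sum_distrib_right mult_ac)
    also have "\<dots> = 0" using x(2) by simp
    finally show ?thesis .
  qed
  ultimately have "vanishes_on (range (\<lambda>w. proj_point I (\<Phi> w))) G"
    using vanishes_on_image[of I "e * D" G \<Phi> UNIV] by simp
  then have "vanishes_on (zariski I closure_of range (\<lambda>w. proj_point I (\<Phi> w))) G"
    using vanishes_on_closure[OF points_in_space[OF \<Phi>] \<open>form I (e * D) G\<close>] by blast
  then have "vanishes_on (Z s) G" using top vanishes_on_subset by blast
  moreover have "\<not> vanishes_on (Z s) G" unfolding G_def g_def w_def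
  proof (rule chain_monomials_independent)
    show "irreducible_closedin (zariski I) (Z i)" if "i \<le> s" for i using irr[OF that] .
    show "Z i \<subseteq> Z (Suc i)" if "i < s" for i using chain[OF that] by blast
    show "form I (d i) (f i)" if "i \<le> s" for i using df[OF that] by blast
    show "d 0 = 1" using df[of 0] by simp
    show "\<not> vanishes_on (Z i) (f i)" if "i \<le> s" for i using df[OF that] by blast
    show "vanishes_on (Z i) (f (Suc i))" if "i < s" for i using df[of "Suc i"] that by simp
    show "finite A'" "A' \<noteq> {}" using finA x(1) by (auto simp: A'_def)
    show "a = b" if "a \<in> A'" "b \<in> A'" "\<forall>i\<in>{1..s}. a i = b i" for a b
    proof (rule PiE_ext)
      show "a \<in> PiE {1..s} (\<lambda>_. {..<e})" "b \<in> PiE {1..s} (\<lambda>_. {..<e})"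
        using that by (auto simp: A'_def A_def)
    qed (use that in auto)
    show "(\<Sum>i\<in>{1..s}. a i * d i) \<le> e * D" if "a \<in> A'" for a
      using wA[of a] that by (simp add: A'_def w_def)
    show "x a \<noteq> 0" if "a \<in> A'" for a using that by (simp add: A'_def)
  qed
  ultimately show False by blast
qed

lemma irreducible_closedin_subtopology:
  assumes "closedin X S"
  shows "irreducible_closedin (subtopology X S) Z \<longleftrightarrow> irreducible_closedin X Z \<and> Z \<subseteq> S"
  unfolding irreducible_closedin_def closedin_closed_subtopology[OF assms] by blast

lemma dimension_in_le:
  assumes "closedin (zariski I) S"
    and "\<And>s Z. (\<And>i. i \<le> s \<Longrightarrow> irreducible_closedin (zariski I) (Z i)) \<Longrightarrow>
      (\<And>i. i < s \<Longrightarrow> Z i \<subset> Z (Suc i)) \<Longrightarrow> Z s \<subseteq> S \<Longrightarrow> s \<le> r"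
  shows "dimension_in I S \<le> enat r"
  unfolding dimension_in_def krull_dim_def
proof (rule Sup_least, clarify)
  fix s Z assume "\<forall>i\<le>s. irreducible_closedin (subtopology (zariski I) S) (Z i)" "\<forall>i<s. Z i \<subset> Z (Suc i)"
  then show "enat s \<le> enat r"
    using assms(2)[of s Z] by (simp add: irreducible_closedin_subtopology[OF assms(1)])
qed

lemma dimension_in_ge:
  assumes "closedin (zariski I) S"
    and "\<And>i. i \<le> s \<Longrightarrow> irreducible_closedin (zariski I) (Z i)" "\<And>i. i \<le> s \<Longrightarrow> Z i \<subseteq> S"
    and "\<And>i. i < s \<Longrightarrow> Z i \<subset> Z (Suc i)"
  shows "enat s \<le> dimension_in I S"
  unfolding dimension_in_def krull_dim_def
  using assms by (intro Sup_upper) (auto simp: irreducible_closedin_subtopology[OF assms(1)])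

section \<open>Moments up to order three\<close>

definition partial_deriv :: "'i \<Rightarrow> 'i mpolynomial \<Rightarrow> 'i mpolynomial" where
  "partial_deriv i p = (\<Sum>m\<in>keys p. Poly_Mapping.single (m - Poly_Mapping.single i 1) (of_nat (lookup m i) * lookup p m))"

lemma partial_deriv_0 [simp]: "partial_deriv i 0 = 0"
  by (simp add: partial_deriv_def)

lemma partial_deriv_add: "partial_deriv i (p + q) = partial_deriv i p + partial_deriv i q"
  unfolding partial_deriv_def
  by (rule setsum_keys_plus_distrib) (auto simp: single_add[symmetric] algebra_simps)

lemma partial_deriv_sum: "partial_deriv i (sum f A) = (\<Sum>a\<in>A. partial_deriv i (f a))"
  by (induction A rule: infinite_finite_induct) (auto simp: partial_deriv_add)

lemma partial_deriv_single:
  "partial_deriv i (Poly_Mapping.single m c) = Poly_Mapping.single (m - Poly_Mapping.single i 1) (of_nat (lookup m i) * c)"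
  by (cases "c = 0") (auto simp: partial_deriv_def)

lemma partial_deriv_mult_single:
  "partial_deriv i (Poly_Mapping.single m c * Poly_Mapping.single m' c') =
    partial_deriv i (Poly_Mapping.single m c) * Poly_Mapping.single m' c' +
    Poly_Mapping.single m c * partial_deriv i (Poly_Mapping.single m' c')"
proof -
  let ?e = "Poly_Mapping.single i (1::nat)"
  have l: "Poly_Mapping.single (m - ?e + m') (of_nat (lookup m i) * c * c') =
      Poly_Mapping.single (m + m' - ?e) (of_nat (lookup m i) * c * c')"
  proof (cases "lookup m i = 0")
    case False
    then have "m - ?e + m' = m + m' - ?e"
      by (intro poly_mapping_eqI) (auto simp: lookup_add lookup_minus lookup_single when_def)
    then show ?thesis by simp
  qed simp
  have r: "Poly_Mapping.single (m + (m' - ?e)) (c * (of_nat (lookup m' i) * c')) =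
      Poly_Mapping.single (m + m' - ?e) (c * (of_nat (lookup m' i) * c'))"
  proof (cases "lookup m' i = 0")
    case False
    then have "m + (m' - ?e) = m + m' - ?e"
      by (intro poly_mapping_eqI) (auto simp: lookup_add lookup_minus lookup_single when_def)
    then show ?thesis by simp
  qed simp
  show ?thesis
    unfolding partial_deriv_single mult_single l r single_add[symmetric] lookup_add
    by (simp add: algebra_simps)
qed

lemma partial_deriv_mult: "partial_deriv i (p * q) = partial_deriv i p * q + p * partial_deriv i q"
proof -
  let ?s = "\<lambda>p m. Poly_Mapping.single m (lookup p m) :: 'a mpolynomial"
  have "partial_deriv i (sum (?s p) (keys p) * sum (?s q) (keys q)) =
      partial_deriv i (sum (?s p) (keys p)) * sum (?s q) (keys q) + sum (?s p) (keys p) * partial_deriv i (sum (?s q) (keys q))"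
    by (simp add: sum_product partial_deriv_sum partial_deriv_mult_single sum.distrib)
  then show ?thesis by (simp flip: mpolynomial_expand)
qed

lemma partial_deriv_const_poly [simp]: "partial_deriv i (const_poly c) = 0"
  by (simp add: const_poly_def partial_deriv_single)

lemma partial_deriv_1 [simp]: "partial_deriv i 1 = 0"
  using partial_deriv_const_poly[of i 1] by (simp add: const_poly_def)

lemma const_poly_0 [simp]: "const_poly 0 = 0" and const_poly_1 [simp]: "const_poly 1 = 1"
  by (simp_all add: const_poly_def)

lemma poly_value_numeral [simp]: "poly_value v (numeral k) = numeral k"
  using poly_value_single[of v 0 "numeral k"] by (simp add: monomial_value_def)

lemma partial_deriv_numeral [simp]: "partial_deriv i (numeral k) = 0"
  using partial_deriv_const_poly[of i "numeral k"] by (simp add: const_poly_def)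

lemma partial_deriv_var: "partial_deriv i (var j) = const_poly (if i = j then 1 else 0)"
  by (auto simp: var_def const_poly_def partial_deriv_single lookup_single)

lemma lookup_partial_deriv: "lookup (partial_deriv i p) m = of_nat (Suc (lookup m i)) * lookup p (m + Poly_Mapping.single i 1)"
proof -
  let ?e = "Poly_Mapping.single i (1::nat)"
  have single: "lookup (partial_deriv i (Poly_Mapping.single m' c)) m = of_nat (Suc (lookup m i)) * lookup (Poly_Mapping.single m' c) (m + ?e)"
    for m' and c :: complex
  proof (cases "m' = m + ?e")
    case True
    then show ?thesis by (simp add: partial_deriv_single lookup_single lookup_add)
  next
    case False
    have "lookup m' i = 0" if eq: "m' - ?e = m"
    proof (rule ccontr)
      assume nz: "lookup m' i \<noteq> 0"
      have "m' = m + ?e" unfolding eq[symmetric]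
        using nz by (intro poly_mapping_eqI) (auto simp: lookup_add lookup_minus lookup_single when_def)
      then show False using False by simp
    qed
    then show ?thesis using False by (auto simp: partial_deriv_single lookup_single when_def)
  qed
  show ?thesis
    by (subst (1 2) mpolynomial_expand[of p]) (simp only: partial_deriv_sum lookup_sum single sum_distrib_left)
qed

lemma poly_value_at_0: "poly_value (\<lambda>_. 0) p = lookup p 0"
proof -
  have "monomial_value (\<lambda>_. 0) m = (if m = 0 then 1 else 0)" for m :: "'a monomial"
  proof (cases "m = 0")
    case False
    then obtain x where x: "x \<in> keys m" by fastforce
    then have "(0::complex) ^ lookup m x = 0" by (simp add: in_keys_iff)
    then show ?thesis using False x unfolding monomial_value_def
      by (auto intro!: prod_zero)
  qed (simp add: monomial_value_def)
  then have "poly_value (\<lambda>_. 0) p = (\<Sum>m\<in>keys p. if m = 0 then lookup p m else 0)"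
    unfolding poly_value_def by (intro sum.cong) auto
  then show ?thesis by (simp add: in_keys_iff)
qed

abbreviation ei :: "nat \<Rightarrow> nat monomial" where "ei i \<equiv> Poly_Mapping.single i 1"

text \<open>Multiplying by the factorials turns coefficients into iterated derivatives at the origin.
  Unlike coefficients, derivatives of a product of exponentials are easy to compute, by the
  Leibniz rule.\<close>

lemma moment_coefficient_step:
  assumes "i \<in> {1..n}"
  shows "(\<Prod>x\<in>{1..n}. fact (lookup (\<alpha> + ei i) x)) * lookup p (\<alpha> + ei i) =
    (\<Prod>x\<in>{1..n}. fact (lookup \<alpha> x)) * lookup (partial_deriv i p) \<alpha>"
proof -
  have "(\<Prod>x\<in>{1..n}. fact (lookup (\<alpha> + ei i) x)) =
      fact (Suc (lookup \<alpha> i)) * (\<Prod>x\<in>{1..n} - {i}. fact (lookup \<alpha> x) :: complex)"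
    using assms by (subst prod.remove[of _ i]) (auto simp: lookup_add lookup_single intro!: prod.cong)
  moreover have "(\<Prod>x\<in>{1..n}. fact (lookup \<alpha> x)) =
      fact (lookup \<alpha> i) * (\<Prod>x\<in>{1..n} - {i}. fact (lookup \<alpha> x) :: complex)"
    using assms by (subst prod.remove[of _ i]) auto
  ultimately show ?thesis by (simp add: lookup_partial_deriv mult_ac)
qed

lemma moment_as_derivative:
  fixes p :: "nat mpolynomial"
  shows "(\<Prod>x\<in>{1..n}. fact (lookup 0 x)) * lookup p 0 = poly_value (\<lambda>_. 0) p"
    "i \<in> {1..n} \<Longrightarrow> (\<Prod>x\<in>{1..n}. fact (lookup (ei i) x)) * lookup p (ei i) = poly_value (\<lambda>_. 0) (partial_deriv i p)"
    "i \<in> {1..n} \<Longrightarrow> j \<in> {1..n} \<Longrightarrow> (\<Prod>x\<in>{1..n}. fact (lookup (ei i + ei j) x)) * lookup p (ei i + ei j) =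
      poly_value (\<lambda>_. 0) (partial_deriv i (partial_deriv j p))"
    "i \<in> {1..n} \<Longrightarrow> j \<in> {1..n} \<Longrightarrow> l \<in> {1..n} \<Longrightarrow>
      (\<Prod>x\<in>{1..n}. fact (lookup (ei i + ei j + ei l) x)) * lookup p (ei i + ei j + ei l) =
      poly_value (\<lambda>_. 0) (partial_deriv i (partial_deriv j (partial_deriv l p)))"
proof -
  show 0: "(\<Prod>x\<in>{1..n}. fact (lookup 0 x)) * lookup p 0 = poly_value (\<lambda>_. 0) p" for p
    by (simp add: poly_value_at_0)
  show 1: "(\<Prod>x\<in>{1..n}. fact (lookup (ei i) x)) * lookup p (ei i) = poly_value (\<lambda>_. 0) (partial_deriv i p)"
    if "i \<in> {1..n}" for i p
    using moment_coefficient_step[OF that, of 0 p] 0[of "partial_deriv i p"] by simp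
  show 2: "(\<Prod>x\<in>{1..n}. fact (lookup (ei i + ei j) x)) * lookup p (ei i + ei j) =
      poly_value (\<lambda>_. 0) (partial_deriv i (partial_deriv j p))" if "i \<in> {1..n}" "j \<in> {1..n}" for i j p
    using moment_coefficient_step[OF that(2), of "ei i" p] 1[OF that(1), of "partial_deriv j p"] by simp
  show "(\<Prod>x\<in>{1..n}. fact (lookup (ei i + ei j + ei l) x)) * lookup p (ei i + ei j + ei l) =
      poly_value (\<lambda>_. 0) (partial_deriv i (partial_deriv j (partial_deriv l p)))" if "i \<in> {1..n}" "j \<in> {1..n}" "l \<in> {1..n}"
    using moment_coefficient_step[OF that(3), of "ei i + ei j" p] 2[OF that(1,2), of "partial_deriv l p"] by simp
qed

lemma exp_upto_3: "exp_upto 3 p = 1 + p + const_poly (1/2) * (p * p) + const_poly (1/6) * (p * p * p)"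
  by (simp add: exp_upto_def numeral_3_eq_3 numeral_2_eq_2 atMost_Suc const_poly_def fact_numeral add_ac mult_ac)

lemma partial_deriv_linear:
  fixes i n :: nat
  assumes "i \<in> {1..n}"
  shows "partial_deriv i (\<Sum>j\<in>{1..n}. const_poly (u j) * var j) = const_poly (u i)"
proof -
  have "partial_deriv i (\<Sum>j\<in>{1..n}. const_poly (u j) * var j) = (\<Sum>j\<in>{1..n}. if i = j then const_poly (u i) else 0)"
    unfolding partial_deriv_sum by (rule sum.cong) (auto simp: partial_deriv_mult partial_deriv_var)
  then show ?thesis using assms by simp
qed

lemma partial_deriv_quadratic:
  fixes i n :: nat
  assumes i: "i \<in> {1..n}" and sym: "\<And>j l. j \<in> {1..n} \<Longrightarrow> l \<in> {1..n} \<Longrightarrow> S j l = S l j"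
  shows "partial_deriv i (const_poly (1/2) * (\<Sum>j\<in>{1..n}. \<Sum>l\<in>{1..n}. const_poly (S j l) * var j * var l)) =
    (\<Sum>j\<in>{1..n}. const_poly (S i j) * var j)"
proof -
  have "(\<Sum>j\<in>{1..n}. \<Sum>l\<in>{1..n}. partial_deriv i (const_poly (S j l) * var j * var l)) =
      (\<Sum>j\<in>{1..n}. \<Sum>l\<in>{1..n}. (if i = j then const_poly (S j l) * var l else 0))
      + (\<Sum>j\<in>{1..n}. \<Sum>l\<in>{1..n}. (if i = l then const_poly (S j l) * var j else 0))"
    unfolding sum.distrib[symmetric] by (intro sum.cong refl) (auto simp: partial_deriv_mult partial_deriv_var)
  also have "(\<Sum>j\<in>{1..n}. \<Sum>l\<in>{1..n}. (if i = j then const_poly (S j l) * var l else 0)) =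
      (\<Sum>l\<in>{1..n}. const_poly (S i l) * var l)"
    using i by (subst sum.swap) simp
  also have "(\<Sum>j\<in>{1..n}. \<Sum>l\<in>{1..n}. (if i = l then const_poly (S j l) * var j else 0)) =
      (\<Sum>j\<in>{1..n}. const_poly (S i j) * var j)"
    using i by (simp add: sym[of _ i])
  finally have "partial_deriv i (const_poly (1/2) * (\<Sum>j\<in>{1..n}. \<Sum>l\<in>{1..n}. const_poly (S j l) * var j * var l)) =
      (const_poly (1/2) + const_poly (1/2)) * (\<Sum>j\<in>{1..n}. const_poly (S i j) * var j)"
    by (simp add: partial_deriv_mult partial_deriv_sum distrib_left distrib_right)
  also have "const_poly (1/2) + const_poly (1/2) = (1 :: nat mpolynomial)"
    by (simp add: const_poly_def single_add[symmetric])
  finally show ?thesis by simp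
qed

text \<open>Isserlis' formulas. The truncation of the exponential series is harmless because the
  arguments of both exponentials vanish at the origin.\<close>

lemma gaussian_derivatives_at_0:
  fixes u :: "nat \<Rightarrow> complex" and S :: "nat \<Rightarrow> nat \<Rightarrow> complex"
  assumes sym: "\<And>j l. j \<in> {1..n} \<Longrightarrow> l \<in> {1..n} \<Longrightarrow> S j l = S l j"
  defines "G \<equiv> exp_upto 3 (\<Sum>i\<in>{1..n}. const_poly (u i) * var i) *
    exp_upto 3 (const_poly (1/2) * (\<Sum>i\<in>{1..n}. \<Sum>j\<in>{1..n}. const_poly (S i j) * var i * var j))"
  shows "poly_value (\<lambda>_. 0) G = 1"
    "i \<in> {1..n} \<Longrightarrow> poly_value (\<lambda>_. 0) (partial_deriv i G) = u i"
    "i \<in> {1..n} \<Longrightarrow> j \<in> {1..n} \<Longrightarrow> poly_value (\<lambda>_. 0) (partial_deriv i (partial_deriv j G)) = u i * u j + S i j"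
    "i \<in> {1..n} \<Longrightarrow> j \<in> {1..n} \<Longrightarrow> l \<in> {1..n} \<Longrightarrow> poly_value (\<lambda>_. 0) (partial_deriv i (partial_deriv j (partial_deriv l G))) =
      u i * u j * u l + u i * S j l + u j * S i l + u l * S i j"
proof -
  define lin where "lin = (\<Sum>i\<in>{1..n}. const_poly (u i) * var i)"
  define quad where "quad = const_poly (1/2) * (\<Sum>i\<in>{1..n}. \<Sum>j\<in>{1..n}. const_poly (S i j) * var i * var j)"
  define q where "q i = (\<Sum>j\<in>{1..n}. const_poly (S i j) * var j)" for i
  have G: "G = exp_upto 3 lin * exp_upto 3 quad" by (simp add: G_def lin_def quad_def)
  have pl: "partial_deriv i lin = const_poly (u i)" if "i \<in> {1..n}" for i
    unfolding lin_def using that by (rule partial_deriv_linear)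
  have pq: "partial_deriv i quad = q i" if "i \<in> {1..n}" for i
    unfolding quad_def q_def using that sym by (rule partial_deriv_quadratic)
  have pq2: "partial_deriv j (q i) = const_poly (S i j)" if "j \<in> {1..n}" for i j
    unfolding q_def using that by (rule partial_deriv_linear)
  note pv = poly_value_add poly_value_mult poly_value_sum
  have v: "poly_value (\<lambda>_. 0) lin = 0" "poly_value (\<lambda>_. 0) quad = 0" "poly_value (\<lambda>_. 0) (q i) = 0" for i
    by (auto simp: lin_def quad_def q_def pv)
  have L: "poly_value (\<lambda>_. 0) (exp_upto 3 lin) = 1" "poly_value (\<lambda>_. 0) (exp_upto 3 quad) = 1"
    by (auto simp: exp_upto_3 pv v)
  have L1: "poly_value (\<lambda>_. 0) (partial_deriv i (exp_upto 3 lin)) = u i" "poly_value (\<lambda>_. 0) (partial_deriv i (exp_upto 3 quad)) = 0"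
    if "i \<in> {1..n}" for i
    using that by (auto simp: exp_upto_3 partial_deriv_add partial_deriv_mult pl pq pv v)
  have L2: "poly_value (\<lambda>_. 0) (partial_deriv i (partial_deriv j (exp_upto 3 lin))) = u i * u j"
    "poly_value (\<lambda>_. 0) (partial_deriv i (partial_deriv j (exp_upto 3 quad))) = S j i"
    if "i \<in> {1..n}" "j \<in> {1..n}" for i j
    using that by (auto simp: exp_upto_3 partial_deriv_add partial_deriv_mult pl pq pq2 pv v)
  have L3: "poly_value (\<lambda>_. 0) (partial_deriv i (partial_deriv j (partial_deriv l (exp_upto 3 lin)))) = u i * u j * u l"
    "poly_value (\<lambda>_. 0) (partial_deriv i (partial_deriv j (partial_deriv l (exp_upto 3 quad)))) = 0"
    if "i \<in> {1..n}" "j \<in> {1..n}" "l \<in> {1..n}" for i j l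
    using that by (auto simp: exp_upto_3 partial_deriv_add partial_deriv_mult pl pq pq2 pv v)
  show "poly_value (\<lambda>_. 0) G = 1" by (simp add: G pv L)
  show "poly_value (\<lambda>_. 0) (partial_deriv i G) = u i" if "i \<in> {1..n}"
    using that by (simp add: G partial_deriv_mult pv L L1)
  show "poly_value (\<lambda>_. 0) (partial_deriv i (partial_deriv j G)) = u i * u j + S i j" if "i \<in> {1..n}" "j \<in> {1..n}"
    using that sym[OF that] by (simp add: G partial_deriv_add partial_deriv_mult pv L L1 L2)
  show "poly_value (\<lambda>_. 0) (partial_deriv i (partial_deriv j (partial_deriv l G))) =
      u i * u j * u l + u i * S j l + u j * S i l + u l * S i j"
    if "i \<in> {1..n}" "j \<in> {1..n}" "l \<in> {1..n}"
    using that sym[OF that(1,2)] sym[OF that(1,3)] sym[OF that(2,3)]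
    by (simp add: G partial_deriv_add partial_deriv_mult pv L L1 L2 L3 algebra_simps)
qed

lemma mixture_paramsD:
  assumes "\<theta> \<in> mixture_params n k"
  shows "h \<in> {1..k} \<Longrightarrow> i \<in> {1..n} \<Longrightarrow> j \<in> {1..n} \<Longrightarrow> cov \<theta> h i j = cov \<theta> h j i"
    "(\<Sum>h\<in>{1..k}. weight \<theta> h) = 1"
  using assms by (auto simp: mixture_params_def)

lemma moment_formulas:
  assumes \<theta>: "\<theta> \<in> mixture_params n k"
  shows "moment n 3 k \<theta> 0 = 1"
    "i \<in> {1..n} \<Longrightarrow> moment n 3 k \<theta> (ei i) = (\<Sum>h\<in>{1..k}. weight \<theta> h * mean \<theta> h i)"
    "i \<in> {1..n} \<Longrightarrow> j \<in> {1..n} \<Longrightarrow> moment n 3 k \<theta> (ei i + ei j) =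
      (\<Sum>h\<in>{1..k}. weight \<theta> h * (mean \<theta> h i * mean \<theta> h j + cov \<theta> h i j))"
    "i \<in> {1..n} \<Longrightarrow> j \<in> {1..n} \<Longrightarrow> l \<in> {1..n} \<Longrightarrow> moment n 3 k \<theta> (ei i + ei j + ei l) =
      (\<Sum>h\<in>{1..k}. weight \<theta> h * (mean \<theta> h i * mean \<theta> h j * mean \<theta> h l + mean \<theta> h i * cov \<theta> h j l
        + mean \<theta> h j * cov \<theta> h i l + mean \<theta> h l * cov \<theta> h i j))"
proof -
  note sym = mixture_paramsD(1)[OF \<theta>]
  define G where "G h = exp_upto 3 (\<Sum>i\<in>{1..n}. const_poly (mean \<theta> h i) * var i) *
    exp_upto 3 (const_poly (1/2) * (\<Sum>i\<in>{1..n}. \<Sum>j\<in>{1..n}. const_poly (cov \<theta> h i j) * var i * var j))" for h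
  have gf: "mixture_gf n 3 k \<theta> = (\<Sum>h\<in>{1..k}. const_poly (weight \<theta> h) * G h)"
    by (simp add: mixture_gf_def G_def mult.assoc)
  note g = gaussian_derivatives_at_0[where n = n and S = "cov \<theta> h" and u = "mean \<theta> h" for h, OF sym, folded G_def]
  show "moment n 3 k \<theta> 0 = 1"
    unfolding moment_def moment_as_derivative gf poly_value_sum mixture_paramsD(2)[OF \<theta>, symmetric]
  proof (rule sum.cong)
    show "poly_value (\<lambda>_. 0) (const_poly (weight \<theta> h) * G h) = weight \<theta> h" if "h \<in> {1..k}" for h
      using g(1)[of h] that by (simp add: poly_value_mult)
  qed simp
  show "moment n 3 k \<theta> (ei i) = (\<Sum>h\<in>{1..k}. weight \<theta> h * mean \<theta> h i)" if i: "i \<in> {1..n}"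
    unfolding moment_def moment_as_derivative(2)[OF i] gf poly_value_sum partial_deriv_sum
  proof (rule sum.cong)
    fix h assume "h \<in> {1..k}"
    then show "poly_value (\<lambda>_. 0) (partial_deriv i (const_poly (weight \<theta> h) * G h)) = weight \<theta> h * mean \<theta> h i"
      using g(2)[of h i] i by (simp add: poly_value_mult partial_deriv_mult poly_value_add)
  qed simp
  show "moment n 3 k \<theta> (ei i + ei j) = (\<Sum>h\<in>{1..k}. weight \<theta> h * (mean \<theta> h i * mean \<theta> h j + cov \<theta> h i j))"
    if i: "i \<in> {1..n}" "j \<in> {1..n}"
    unfolding moment_def moment_as_derivative(3)[OF i] gf poly_value_sum partial_deriv_sum
  proof (rule sum.cong)
    fix h assume "h \<in> {1..k}"
    then show "poly_value (\<lambda>_. 0) (partial_deriv i (partial_deriv j (const_poly (weight \<theta> h) * G h))) = weight \<theta> h * (mean \<theta> h i * mean \<theta> h j + cov \<theta> h i j)"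
      using g(3)[of h i j] i by (simp add: poly_value_mult partial_deriv_mult poly_value_add)
  qed simp
  show "moment n 3 k \<theta> (ei i + ei j + ei l) =
      (\<Sum>h\<in>{1..k}. weight \<theta> h * (mean \<theta> h i * mean \<theta> h j * mean \<theta> h l + mean \<theta> h i * cov \<theta> h j l
        + mean \<theta> h j * cov \<theta> h i l + mean \<theta> h l * cov \<theta> h i j))"
    if i: "i \<in> {1..n}" "j \<in> {1..n}" "l \<in> {1..n}"
    unfolding moment_def moment_as_derivative(4)[OF i] gf poly_value_sum partial_deriv_sum
  proof (rule sum.cong)
    fix h assume "h \<in> {1..k}"
    then show "poly_value (\<lambda>_. 0) (partial_deriv i (partial_deriv j (partial_deriv l (const_poly (weight \<theta> h) * G h)))) = weight \<theta> h * (mean \<theta> h i * mean \<theta> h j * mean \<theta> h l + mean \<theta> h i * cov \<theta> h j l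
        + mean \<theta> h j * cov \<theta> h i l + mean \<theta> h l * cov \<theta> h i j)"
      using g(4)[of h i j l] i by (simp add: poly_value_mult partial_deriv_mult poly_value_add)
  qed simp
qed

lemma moment_index_split:
  assumes "\<alpha> \<in> moment_indices n (Suc d)" "\<alpha> \<noteq> 0"
  obtains \<beta> i where "\<alpha> = \<beta> + ei i" "i \<in> {1..n}" "\<beta> \<in> moment_indices n d"
proof -
  obtain i where i: "i \<in> keys \<alpha>" using assms(2) by fastforce
  let ?\<beta> = "\<alpha> - ei i"
  have eq: "\<alpha> = ?\<beta> + ei i"
    using i by (intro poly_mapping_eqI) (auto simp: lookup_add lookup_minus lookup_single when_def in_keys_iff)
  have "keys ?\<beta> \<subseteq> keys \<alpha>" by (auto simp: in_keys_iff lookup_minus)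
  moreover have "total_degree \<alpha> = total_degree ?\<beta> + 1"
    by (subst eq) (simp add: total_degree_add total_degree_single)
  ultimately have "?\<beta> \<in> moment_indices n d" using assms(1) by (auto simp: moment_indices_def)
  moreover have "i \<in> {1..n}" using i assms(1) by (auto simp: moment_indices_def)
  ultimately show ?thesis using that eq by blast
qed

lemma moment_indices_0: "moment_indices n 0 = {0}"
proof -
  have "\<alpha> = 0" if "total_degree \<alpha> = 0" for \<alpha> :: "nat monomial"
    using that lookup_le_total_degree[of \<alpha>] by (intro poly_mapping_eqI) auto
  then show ?thesis by (auto simp: moment_indices_def)
qed

lemma moment_indices_cases:
  assumes "\<alpha> \<in> moment_indices n 3"
  obtains "\<alpha> = 0" | i where "i \<in> {1..n}" "\<alpha> = ei i"
    | i j where "i \<in> {1..n}" "j \<in> {1..n}" "\<alpha> = ei i + ei j"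
    | i j l where "i \<in> {1..n}" "j \<in> {1..n}" "l \<in> {1..n}" "\<alpha> = ei i + ei j + ei l"
proof (cases "\<alpha> = 0")
  case False
  then obtain \<beta> l where 1: "\<alpha> = \<beta> + ei l" "l \<in> {1..n}" "\<beta> \<in> moment_indices n 2"
    using moment_index_split[of \<alpha> n 2] assms by (auto simp: numeral_3_eq_3 numeral_2_eq_2)
  show ?thesis
  proof (cases "\<beta> = 0")
    case True then show ?thesis using 1 that(2) by simp
  next
    case False
    then obtain \<gamma> j where 2: "\<beta> = \<gamma> + ei j" "j \<in> {1..n}" "\<gamma> \<in> moment_indices n 1"
      using moment_index_split[of \<beta> n 1] 1 by (auto simp: numeral_2_eq_2)
    show ?thesis
    proof (cases "\<gamma> = 0")
      case True then show ?thesis using 1 2 that(3)[of j l] by simp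
    next
      case False
      then obtain i where "\<gamma> = ei i" "i \<in> {1..n}"
        using moment_index_split[of \<gamma> n 0] 2 by (auto simp: moment_indices_0)
      then show ?thesis using 1 2 that(4)[of i j l] by simp
    qed
  qed
qed (rule that(1))

lemma ei_in_moment_indices:
  "0 \<in> moment_indices n 3" "i \<in> {1..n} \<Longrightarrow> ei i \<in> moment_indices n 3"
  "i \<in> {1..n} \<Longrightarrow> j \<in> {1..n} \<Longrightarrow> ei i + ei j \<in> moment_indices n 3"
  "i \<in> {1..n} \<Longrightarrow> j \<in> {1..n} \<Longrightarrow> l \<in> {1..n} \<Longrightarrow> ei i + ei j + ei l \<in> moment_indices n 3"
proof -
  have k: "keys (\<alpha> + \<beta>) \<subseteq> {1..n}" if "keys \<alpha> \<subseteq> {1..n}" "keys \<beta> \<subseteq> {1..n}" for \<alpha> \<beta> :: "nat monomial"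
    using keys_add[of \<alpha> \<beta>] that by blast
  have e: "keys (ei i) \<subseteq> {1..n}" if "i \<in> {1..n}" for i using that by simp
  show "0 \<in> moment_indices n 3" by (simp add: moment_indices_def)
  show "ei i \<in> moment_indices n 3" if "i \<in> {1..n}"
    using e[OF that] by (simp add: moment_indices_def total_degree_single)
  show "ei i + ei j \<in> moment_indices n 3" if "i \<in> {1..n}" "j \<in> {1..n}"
    using k[OF e e, OF that] by (simp add: moment_indices_def total_degree_single total_degree_add)
  show "ei i + ei j + ei l \<in> moment_indices n 3" if "i \<in> {1..n}" "j \<in> {1..n}" "l \<in> {1..n}"
    using k[OF k[OF e e] e, OF that] by (simp add: moment_indices_def total_degree_single total_degree_add)
qed

text \<open>A monomial of degree at most \<open>d\<close> is a list of its \<open>n\<close> exponents followed by the slack.\<close>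

lemma card_moment_indices:
  "finite (moment_indices n d)" "card (moment_indices n d) \<le> (n + d) choose d"
proof -
  let ?L = "{l::nat list. length l = n + 1 \<and> sum_list l = d}"
  let ?f = "\<lambda>\<alpha>. map (lookup \<alpha>) [1..<Suc n] @ [d - total_degree \<alpha>]"
  have inj: "inj_on ?f (moment_indices n d)"
  proof (rule inj_onI, rule poly_mapping_eqI)
    fix \<alpha> \<beta> x assume a: "\<alpha> \<in> moment_indices n d" "\<beta> \<in> moment_indices n d" "?f \<alpha> = ?f \<beta>"
    then have *: "\<forall>x\<in>{1..n}. lookup \<alpha> x = lookup \<beta> x" by auto
    show "lookup \<alpha> x = lookup \<beta> x"
    proof (cases "x \<in> {1..n}")
      case False
      then have "x \<notin> keys \<alpha>" "x \<notin> keys \<beta>" using a by (auto simp: moment_indices_def)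
      then show ?thesis by (simp add: in_keys_iff)
    qed (use * in blast)
  qed
  have sub: "?f ` moment_indices n d \<subseteq> ?L"
  proof clarify
    fix \<alpha> assume a: "\<alpha> \<in> moment_indices n d"
    then have "total_degree \<alpha> = (\<Sum>x\<in>{1..n}. lookup \<alpha> x)"
      by (intro total_degree_superset) (auto simp: moment_indices_def)
    also have "\<dots> = sum_list (map (lookup \<alpha>) [1..<Suc n])"
      using sum.distinct_set_conv_list[of "[1..<Suc n]" "lookup \<alpha>"]
      by (simp add: atLeastLessThanSuc_atLeastAtMost del: upt_Suc)
    finally show "length (?f \<alpha>) = n + 1 \<and> sum_list (?f \<alpha>) = d"
      using a by (simp add: moment_indices_def del: upt_Suc)
  qed
  have "?L \<subseteq> {l. set l \<subseteq> {..d} \<and> length l = n + 1}"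
    using member_le_sum_list by fastforce
  then have fin: "finite ?L" using finite_lists_length_eq[of "{..d}" "n + 1"] finite_subset by blast
  show "finite (moment_indices n d)" using finite_subset[OF sub fin] inj finite_imageD by blast
  have "card (moment_indices n d) \<le> card ?L" by (rule card_inj_on_le[OF inj sub fin])
  also have "\<dots> = (n + d) choose d" unfolding card_length_sum_list by (simp add: add.commute)
  finally show "card (moment_indices n d) \<le> (n + d) choose d" .
qed

section \<open>Mixtures with a distinguished pair of components\<close>

text \<open>Parameters are extensional functions, so they are determined by their values on the index ranges.\<close>

lemma mixture_eqI:
  assumes "\<theta> \<in> mixture_params n k" "\<theta>' \<in> mixture_params n k"
    and "\<And>h. h \<in> {1..k} \<Longrightarrow> weight \<theta> h = weight \<theta>' h"
    and "\<And>h i. h \<in> {1..k} \<Longrightarrow> i \<in> {1..n} \<Longrightarrow> mean \<theta> h i = mean \<theta>' h i"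
    and "\<And>h i j. h \<in> {1..k} \<Longrightarrow> i \<in> {1..n} \<Longrightarrow> j \<in> {1..n} \<Longrightarrow> cov \<theta> h i j = cov \<theta>' h i j"
  shows "\<theta> = \<theta>'"
proof (rule mixture.expand, intro conjI)
  have m: "weight \<theta> \<in> {1..k} \<rightarrow>\<^sub>E UNIV" "weight \<theta>' \<in> {1..k} \<rightarrow>\<^sub>E UNIV"
    "mean \<theta> \<in> {1..k} \<rightarrow>\<^sub>E ({1..n} \<rightarrow>\<^sub>E UNIV)" "mean \<theta>' \<in> {1..k} \<rightarrow>\<^sub>E ({1..n} \<rightarrow>\<^sub>E UNIV)"
    "cov \<theta> \<in> {1..k} \<rightarrow>\<^sub>E ({1..n} \<rightarrow>\<^sub>E ({1..n} \<rightarrow>\<^sub>E UNIV))"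
    "cov \<theta>' \<in> {1..k} \<rightarrow>\<^sub>E ({1..n} \<rightarrow>\<^sub>E ({1..n} \<rightarrow>\<^sub>E UNIV))"
    using assms(1,2) by (simp_all add: mixture_params_def)
  show "weight \<theta> = weight \<theta>'" by (rule PiE_ext[OF m(1,2)]) (rule assms(3))
  show "mean \<theta> = mean \<theta>'"
  proof (rule PiE_ext[OF m(3,4)])
    fix h assume h: "h \<in> {1..k}"
    show "mean \<theta> h = mean \<theta>' h"
      by (rule PiE_ext[OF PiE_mem[OF m(3) h] PiE_mem[OF m(4) h]]) (rule assms(4)[OF h])
  qed
  show "cov \<theta> = cov \<theta>'"
  proof (rule PiE_ext[OF m(5,6)])
    fix h assume h: "h \<in> {1..k}"
    show "cov \<theta> h = cov \<theta>' h"
    proof (rule PiE_ext[OF PiE_mem[OF m(5) h] PiE_mem[OF m(6) h]])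
      fix i assume i: "i \<in> {1..n}"
      show "cov \<theta> h i = cov \<theta>' h i"
        by (rule PiE_ext[OF PiE_mem[OF PiE_mem[OF m(5) h] i] PiE_mem[OF PiE_mem[OF m(6) h] i]])
          (rule assms(5)[OF h i])
    qed
  qed
qed

text \<open>Components \<open>1\<close> and \<open>2\<close> of total weight \<open>s\<close> are described by the normalised weight
  \<open>\<rho>\<close> of the first one, their common centre \<open>M\<close>, the difference \<open>\<delta>\<close> of their means,
  the covariance \<open>K\<close> of the pair as a whole and the difference \<open>\<Delta>\<close> of their covariances. The
  other components are those of \<open>\<theta>\<close>. In these coordinates the cumulants of the pair of
  orders 1 and 2 are free parameters.\<close>

definition with_pair :: "nat \<Rightarrow> nat \<Rightarrow> mixture \<Rightarrow> complex \<Rightarrow> complex \<Rightarrow> (nat \<Rightarrow> complex) \<Rightarrow>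
    (nat \<Rightarrow> complex) \<Rightarrow> (nat \<Rightarrow> nat \<Rightarrow> complex) \<Rightarrow> (nat \<Rightarrow> nat \<Rightarrow> complex) \<Rightarrow> mixture" where
  "with_pair n k \<theta> s \<rho> M \<delta> K \<Delta> = Mixture
    (\<lambda>h\<in>{1..k}. if h = 1 then s * \<rho> else if h = 2 then s * (1 - \<rho>) else weight \<theta> h)
    (\<lambda>h\<in>{1..k}. \<lambda>i\<in>{1..n}. if h = 1 then M i + (1 - \<rho>) * \<delta> i
       else if h = 2 then M i - \<rho> * \<delta> i else mean \<theta> h i)
    (\<lambda>h\<in>{1..k}. \<lambda>i\<in>{1..n}. \<lambda>j\<in>{1..n}.
       if h = 1 then K i j - \<rho> * (1 - \<rho>) * \<delta> i * \<delta> j + (1 - \<rho>) * \<Delta> i j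
       else if h = 2 then K i j - \<rho> * (1 - \<rho>) * \<delta> i * \<delta> j - \<rho> * \<Delta> i j
       else cov \<theta> h i j)"

text \<open>The polarisation of the cubic form
  \<open>\<rho> (1 - \<rho>) \<delta> ((1 - 2 \<rho>) \<delta>\<^sup>2 + 3 \<Delta>)\<close>: the third cumulant of a pair of
  Gaussians is reducible, with \<open>\<delta>\<close> as a linear factor.\<close>

definition third_cumulant :: "complex \<Rightarrow> (nat \<Rightarrow> complex) \<Rightarrow> (nat \<Rightarrow> nat \<Rightarrow> complex) \<Rightarrow> nat \<Rightarrow> nat \<Rightarrow> nat \<Rightarrow> complex" where
  "third_cumulant \<rho> \<delta> \<Delta> i j l = \<rho> * (1 - \<rho>) * ((1 - 2 * \<rho>) * \<delta> i * \<delta> j * \<delta> l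
    + \<delta> i * \<Delta> j l + \<delta> j * \<Delta> i l + \<delta> l * \<Delta> i j)"

lemma sum_split_pair:
  fixes f :: "nat \<Rightarrow> complex"
  assumes "k \<ge> 2"
  shows "(\<Sum>h\<in>{1..k}. f h) = f 1 + f 2 + (\<Sum>h\<in>{3..k}. f h)"
proof -
  have "{1..k} = insert 1 (insert 2 {3..k})" using assms by auto
  then show ?thesis by simp
qed

lemma with_pair_in_mixture_params:
  assumes k: "k \<ge> 2"
    and K: "\<And>i j. i \<in> {1..n} \<Longrightarrow> j \<in> {1..n} \<Longrightarrow> K i j = K j i"
    and \<Delta>: "\<And>i j. i \<in> {1..n} \<Longrightarrow> j \<in> {1..n} \<Longrightarrow> \<Delta> i j = \<Delta> j i"
    and \<theta>: "\<And>h i j. h \<in> {3..k} \<Longrightarrow> i \<in> {1..n} \<Longrightarrow> j \<in> {1..n} \<Longrightarrow> cov \<theta> h i j = cov \<theta> h j i"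
    and s: "s + (\<Sum>h\<in>{3..k}. weight \<theta> h) = 1"
  shows "with_pair n k \<theta> s \<rho> M \<delta> K \<Delta> \<in> mixture_params n k"
proof -
  have "(\<Sum>h\<in>{1..k}. weight (with_pair n k \<theta> s \<rho> M \<delta> K \<Delta>) h) = s * \<rho> + s * (1 - \<rho>) + (\<Sum>h\<in>{3..k}. weight \<theta> h)"
    unfolding sum_split_pair[OF k]
    by (intro arg_cong2[where f = "(+)"] sum.cong) (use k in \<open>auto simp: with_pair_def\<close>)
  also have "\<dots> = 1" using s by (simp add: algebra_simps)
  finally have "(\<Sum>h\<in>{1..k}. weight (with_pair n k \<theta> s \<rho> M \<delta> K \<Delta>) h) = 1" .
  moreover have "cov (with_pair n k \<theta> s \<rho> M \<delta> K \<Delta>) h i j = cov (with_pair n k \<theta> s \<rho> M \<delta> K \<Delta>) h j i"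
    if "h \<in> {1..k}" "i \<in> {1..n}" "j \<in> {1..n}" for h i j
    using that K[of i j] \<Delta>[of i j] \<theta>[of h i j] by (simp add: with_pair_def mult_ac)
  ultimately show ?thesis unfolding mixture_params_def
    by (auto simp: with_pair_def)
qed

text \<open>Up to order three the pair contributes to the moments only through \<open>s\<close> and its cumulants
  \<open>M\<close>, \<open>K\<close> and the third one.\<close>

lemma moments_with_pair:
  fixes \<theta> :: mixture and s \<rho> :: complex and M \<delta> :: "nat \<Rightarrow> complex" and K \<Delta> :: "nat \<Rightarrow> nat \<Rightarrow> complex"
  assumes k: "k \<ge> 2"
    and m: "with_pair n k \<theta> s \<rho> M \<delta> K \<Delta> \<in> mixture_params n k"
  defines "v \<equiv> moment n 3 k (with_pair n k \<theta> s \<rho> M \<delta> K \<Delta>)"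
  shows "v 0 = 1"
    "i \<in> {1..n} \<Longrightarrow> v (ei i) = s * M i + (\<Sum>h\<in>{3..k}. weight \<theta> h * mean \<theta> h i)"
    "i \<in> {1..n} \<Longrightarrow> j \<in> {1..n} \<Longrightarrow> v (ei i + ei j) = s * (M i * M j + K i j) +
      (\<Sum>h\<in>{3..k}. weight \<theta> h * (mean \<theta> h i * mean \<theta> h j + cov \<theta> h i j))"
    "i \<in> {1..n} \<Longrightarrow> j \<in> {1..n} \<Longrightarrow> l \<in> {1..n} \<Longrightarrow> v (ei i + ei j + ei l) =
      s * (M i * M j * M l + M i * K j l + M j * K i l + M l * K i j + third_cumulant \<rho> \<delta> \<Delta> i j l) +
      (\<Sum>h\<in>{3..k}. weight \<theta> h * (mean \<theta> h i * mean \<theta> h j * mean \<theta> h l + mean \<theta> h i * cov \<theta> h j l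
        + mean \<theta> h j * cov \<theta> h i l + mean \<theta> h l * cov \<theta> h i j))"
proof -
  note f = moment_formulas[OF m, folded v_def] sum_split_pair[OF k]
  let ?\<theta> = "with_pair n k \<theta> s \<rho> M \<delta> K \<Delta>"
  have w: "weight ?\<theta> 1 = s * \<rho>" "weight ?\<theta> 2 = s * (1 - \<rho>)"
    using k by (auto simp: with_pair_def)
  have u: "mean ?\<theta> 1 i = M i + (1 - \<rho>) * \<delta> i" "mean ?\<theta> 2 i = M i - \<rho> * \<delta> i" if "i \<in> {1..n}" for i
    using k that by (auto simp: with_pair_def)
  have c: "cov ?\<theta> 1 i j = K i j - \<rho> * (1 - \<rho>) * \<delta> i * \<delta> j + (1 - \<rho>) * \<Delta> i j"
    "cov ?\<theta> 2 i j = K i j - \<rho> * (1 - \<rho>) * \<delta> i * \<delta> j - \<rho> * \<Delta> i j"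
    if "i \<in> {1..n}" "j \<in> {1..n}" for i j
    using k that by (auto simp: with_pair_def)
  have rest: "weight ?\<theta> h = weight \<theta> h" "i \<in> {1..n} \<Longrightarrow> mean ?\<theta> h i = mean \<theta> h i"
    "i \<in> {1..n} \<Longrightarrow> j \<in> {1..n} \<Longrightarrow> cov ?\<theta> h i j = cov \<theta> h i j" if "h \<in> {3..k}" for h i j
    using that by (auto simp: with_pair_def)
  show "v 0 = 1" by (rule f(1))
  show "v (ei i) = s * M i + (\<Sum>h\<in>{3..k}. weight \<theta> h * mean \<theta> h i)" if i: "i \<in> {1..n}"
    unfolding f(2)[OF i] f(5) w u[OF i]
    by (intro arg_cong2[where f = "(+)"] sum.cong) (use rest i in \<open>simp_all add: algebra_simps\<close>)
  show "v (ei i + ei j) = s * (M i * M j + K i j) +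
      (\<Sum>h\<in>{3..k}. weight \<theta> h * (mean \<theta> h i * mean \<theta> h j + cov \<theta> h i j))"
    if i: "i \<in> {1..n}" "j \<in> {1..n}"
    unfolding f(3)[OF i] f(5) w u[OF i(1)] u[OF i(2)] c[OF i]
  proof (intro arg_cong2[where f = "(+)"] sum.cong)
    show "s * \<rho> * ((M i + (1 - \<rho>) * \<delta> i) * (M j + (1 - \<rho>) * \<delta> j) + (K i j - \<rho> * (1 - \<rho>) * \<delta> i * \<delta> j + (1 - \<rho>) * \<Delta> i j)) +
      s * (1 - \<rho>) * ((M i - \<rho> * \<delta> i) * (M j - \<rho> * \<delta> j) + (K i j - \<rho> * (1 - \<rho>) * \<delta> i * \<delta> j - \<rho> * \<Delta> i j)) =
      s * (M i * M j + K i j)" by algebra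
  qed (use rest i in simp_all)
  show "v (ei i + ei j + ei l) =
      s * (M i * M j * M l + M i * K j l + M j * K i l + M l * K i j + third_cumulant \<rho> \<delta> \<Delta> i j l) +
      (\<Sum>h\<in>{3..k}. weight \<theta> h * (mean \<theta> h i * mean \<theta> h j * mean \<theta> h l + mean \<theta> h i * cov \<theta> h j l
        + mean \<theta> h j * cov \<theta> h i l + mean \<theta> h l * cov \<theta> h i j))"
    if i: "i \<in> {1..n}" "j \<in> {1..n}" "l \<in> {1..n}"
    unfolding f(4)[OF i] f(5) w u[OF i(1)] u[OF i(2)] u[OF i(3)] c[OF i(1,2)] c[OF i(1,3)] c[OF i(2,3)]
      third_cumulant_def
    by (intro arg_cong2[where f = "(+)"] sum.cong, algebra, use rest i in simp_all)
qed

lemma as_with_pair: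
  assumes \<theta>: "\<theta> \<in> mixture_params n k" and k: "k \<ge> 2" and s: "weight \<theta> 1 + weight \<theta> 2 = s" "s \<noteq> 0"
  defines "\<rho> \<equiv> weight \<theta> 1 / s"
  defines "\<delta> \<equiv> \<lambda>i. mean \<theta> 1 i - mean \<theta> 2 i"
  shows "\<theta> = with_pair n k \<theta> s \<rho> (\<lambda>i. \<rho> * mean \<theta> 1 i + (1 - \<rho>) * mean \<theta> 2 i) \<delta>
    (\<lambda>i j. \<rho> * cov \<theta> 1 i j + (1 - \<rho>) * cov \<theta> 2 i j + \<rho> * (1 - \<rho>) * \<delta> i * \<delta> j)
    (\<lambda>i j. cov \<theta> 1 i j - cov \<theta> 2 i j)" (is "\<theta> = with_pair n k \<theta> s \<rho> ?M \<delta> ?K ?\<Delta>")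
proof (rule mixture_eqI[OF \<theta>])
  have c: "cov \<theta> h i j = cov \<theta> h j i" if "h \<in> {1..k}" "i \<in> {1..n}" "j \<in> {1..n}" for h i j
    using mixture_paramsD(1)[OF \<theta> that] .
  have w: "s + (\<Sum>h\<in>{3..k}. weight \<theta> h) = 1"
    using mixture_paramsD(2)[OF \<theta>] sum_split_pair[OF k, of "weight \<theta>"] s by simp
  show "with_pair n k \<theta> s \<rho> ?M \<delta> ?K ?\<Delta> \<in> mixture_params n k"
    by (rule with_pair_in_mixture_params[OF k _ _ _ w]) (use c k in auto)
  show "weight \<theta> h = weight (with_pair n k \<theta> s \<rho> ?M \<delta> ?K ?\<Delta>) h" if "h \<in> {1..k}" for h
    using that s by (auto simp: with_pair_def \<rho>_def right_diff_distrib)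
  show "mean \<theta> h i = mean (with_pair n k \<theta> s \<rho> ?M \<delta> ?K ?\<Delta>) h i" if "h \<in> {1..k}" "i \<in> {1..n}" for h i
    using that by (auto simp: with_pair_def \<delta>_def algebra_simps)
  show "cov \<theta> h i j = cov (with_pair n k \<theta> s \<rho> ?M \<delta> ?K ?\<Delta>) h i j"
    if "h \<in> {1..k}" "i \<in> {1..n}" "j \<in> {1..n}" for h i j
    using that by (auto simp: with_pair_def algebra_simps)
qed

lemma moment_point_cong:
  assumes "\<And>\<alpha>. \<alpha> \<in> moment_indices n 3 \<Longrightarrow> moment n 3 k \<theta> \<alpha> = moment n 3 k \<theta>' \<alpha>"
  shows "moment_point n 3 k \<theta> = moment_point n 3 k \<theta>'"
proof -
  have "(\<lambda>\<alpha>\<in>moment_indices n 3. c * moment n 3 k \<theta> \<alpha>) = (\<lambda>\<alpha>\<in>moment_indices n 3. c * moment n 3 k \<theta>' \<alpha>)" for c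
    by (rule restrict_ext) (simp add: assms)
  then show ?thesis by (simp add: moment_point_def proj_point_def)
qed

text \<open>The source of the defect. If \<open>\<delta>\<close> is rescaled and \<open>\<rho>\<close> is changed, a suitable
  change of \<open>\<Delta>\<close> leaves the product of \<open>\<delta>\<close> with the quadratic form unchanged, and with it
  all moments of order at most three. These two degrees of freedom suffice to move the first
  coordinates of the two means to prescribed values \<open>a\<close> and \<open>b\<close>.\<close>

lemma renormalise_pair:
  assumes \<theta>: "\<theta> \<in> mixture_params n k" and k: "k \<ge> 2" and n: "n \<ge> 1" and ab: "a \<noteq> b"
    and s0: "weight \<theta> 1 + weight \<theta> 2 \<noteq> 0"
    and d0: "mean \<theta> 1 1 \<noteq> mean \<theta> 2 1"
    and a: "weight \<theta> 1 * mean \<theta> 1 1 + weight \<theta> 2 * mean \<theta> 2 1 \<noteq> (weight \<theta> 1 + weight \<theta> 2) * a"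
    and b: "weight \<theta> 1 * mean \<theta> 1 1 + weight \<theta> 2 * mean \<theta> 2 1 \<noteq> (weight \<theta> 1 + weight \<theta> 2) * b"
  shows "\<exists>\<theta>'\<in>mixture_params n k. mean \<theta>' 1 1 = a \<and> mean \<theta>' 2 1 = b \<and>
    moment_point n 3 k \<theta>' = moment_point n 3 k \<theta>"
proof -
  define s where "s = weight \<theta> 1 + weight \<theta> 2"
  define \<rho> where "\<rho> = weight \<theta> 1 / s"
  define \<delta> where "\<delta> = (\<lambda>i. mean \<theta> 1 i - mean \<theta> 2 i)"
  define M where "M = (\<lambda>i. \<rho> * mean \<theta> 1 i + (1 - \<rho>) * mean \<theta> 2 i)"
  define K where "K = (\<lambda>i j. \<rho> * cov \<theta> 1 i j + (1 - \<rho>) * cov \<theta> 2 i j + \<rho> * (1 - \<rho>) * \<delta> i * \<delta> j)"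
  define \<Delta> where "\<Delta> = (\<lambda>i j. cov \<theta> 1 i j - cov \<theta> 2 i j)"
  have s: "s \<noteq> 0" using s0 by (simp add: s_def)
  have eq: "\<theta> = with_pair n k \<theta> s \<rho> M \<delta> K \<Delta>"
    unfolding \<rho>_def \<delta>_def M_def K_def \<Delta>_def by (rule as_with_pair[OF \<theta> k _ s]) (simp add: s_def)
  have M1: "s * M 1 = weight \<theta> 1 * mean \<theta> 1 1 + weight \<theta> 2 * mean \<theta> 2 1"
  proof -
    have "s * \<rho> = weight \<theta> 1" "s * (1 - \<rho>) = weight \<theta> 2" using s by (auto simp: \<rho>_def right_diff_distrib s_def)
    then show ?thesis unfolding M_def distrib_left mult.assoc[symmetric] by simp
  qed
  have Ma: "M 1 \<noteq> a" and Mb: "M 1 \<noteq> b" using a b s M1 unfolding s_def[symmetric] by auto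
  have d1: "\<delta> 1 \<noteq> 0" using d0 by (simp add: \<delta>_def)
  \<comment> \<open>\<open>c\<close> scales the first coordinates of the means to distance \<open>a - b\<close>, and
    \<open>\<rho>'\<close> then puts their centre in the right place\<close>
  define c where "c = (a - b) / \<delta> 1"
  define \<rho>' where "\<rho>' = (M 1 - b) / (a - b)"
  have c: "c \<noteq> 0" "c * \<delta> 1 = a - b" using ab d1 by (auto simp: c_def)
  have \<rho>': "\<rho>' \<noteq> 0" "1 - \<rho>' \<noteq> 0" "M 1 = b + \<rho>' * (a - b)"
    using ab Ma Mb by (auto simp: \<rho>'_def field_simps)
  \<comment> \<open>\<open>\<tau>\<close> and \<open>\<kappa>\<close> compare the coefficients of the products \<open>\<delta> \<Delta>\<close> and of
    the cube of \<open>\<delta>\<close> in the third cumulant\<close>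
  define \<tau> where "\<tau> = \<rho> * (1 - \<rho>) / (c * (\<rho>' * (1 - \<rho>')))"
  define \<kappa> where "\<kappa> = (\<tau> * (1 - 2 * \<rho>) - (1 - 2 * \<rho>') * c ^ 2) / 3"
  have \<tau>: "\<rho> * (1 - \<rho>) = \<tau> * (c * (\<rho>' * (1 - \<rho>')))" using c(1) \<rho>'(1,2) by (simp add: \<tau>_def)
  have \<kappa>: "\<tau> * (1 - 2 * \<rho>) = 3 * \<kappa> + (1 - 2 * \<rho>') * c ^ 2"
    by (auto simp: \<kappa>_def field_simps)
  define \<delta>' where "\<delta>' = (\<lambda>i. c * \<delta> i)"
  define \<Delta>' where "\<Delta>' = (\<lambda>i j. \<tau> * \<Delta> i j + \<kappa> * (\<delta> i * \<delta> j))"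
  define \<theta>' where "\<theta>' = with_pair n k \<theta> s \<rho>' M \<delta>' K \<Delta>'"
  have T: "third_cumulant \<rho>' \<delta>' \<Delta>' i j l = third_cumulant \<rho> \<delta> \<Delta> i j l" for i j l
  proof -
    have "third_cumulant \<rho>' \<delta>' \<Delta>' i j l = c * (\<rho>' * (1 - \<rho>')) *
      (((1 - 2 * \<rho>') * c ^ 2 + 3 * \<kappa>) * (\<delta> i * \<delta> j * \<delta> l) + \<tau> * (\<delta> i * \<Delta> j l + \<delta> j * \<Delta> i l + \<delta> l * \<Delta> i j))"
      by (simp add: third_cumulant_def \<delta>'_def \<Delta>'_def algebra_simps power2_eq_square)
    also have "(1 - 2 * \<rho>') * c ^ 2 + 3 * \<kappa> = \<tau> * (1 - 2 * \<rho>)" using \<kappa> by simp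
    also have "c * (\<rho>' * (1 - \<rho>')) * (\<tau> * (1 - 2 * \<rho>) * (\<delta> i * \<delta> j * \<delta> l) + \<tau> * (\<delta> i * \<Delta> j l + \<delta> j * \<Delta> i l + \<delta> l * \<Delta> i j))
      = \<tau> * (c * (\<rho>' * (1 - \<rho>'))) * ((1 - 2 * \<rho>) * \<delta> i * \<delta> j * \<delta> l + \<delta> i * \<Delta> j l + \<delta> j * \<Delta> i l + \<delta> l * \<Delta> i j)"
      by (simp add: algebra_simps)
    also have "\<dots> = third_cumulant \<rho> \<delta> \<Delta> i j l" unfolding \<tau>[symmetric] third_cumulant_def by simp
    finally show ?thesis .
  qed
  note sym = mixture_paramsD(1)[OF \<theta>]
  have K: "K i j = K j i" and \<Delta>: "\<Delta> i j = \<Delta> j i" if "i \<in> {1..n}" "j \<in> {1..n}" for i j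
  proof -
    have "cov \<theta> 1 i j = cov \<theta> 1 j i" "cov \<theta> 2 i j = cov \<theta> 2 j i"
      using sym[of 1 i j] sym[of 2 i j] that k by auto
    then show "K i j = K j i" "\<Delta> i j = \<Delta> j i" by (simp_all add: K_def \<Delta>_def)
  qed
  have \<theta>': "\<theta>' \<in> mixture_params n k" unfolding \<theta>'_def
  proof (rule with_pair_in_mixture_params[OF k K])
    show "\<Delta>' i j = \<Delta>' j i" if "i \<in> {1..n}" "j \<in> {1..n}" for i j
      using \<Delta>[OF that] by (simp add: \<Delta>'_def mult_ac)
    show "cov \<theta> h i j = cov \<theta> h j i" if "h \<in> {3..k}" "i \<in> {1..n}" "j \<in> {1..n}" for h i j
      using sym[of h i j] that by auto
    show "s + (\<Sum>h\<in>{3..k}. weight \<theta> h) = 1"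
      using mixture_paramsD(2)[OF \<theta>] sum_split_pair[OF k, of "weight \<theta>"] by (simp add: s_def)
  qed
  have m: "with_pair n k \<theta> s \<rho> M \<delta> K \<Delta> \<in> mixture_params n k" using \<theta> eq by simp
  have "moment n 3 k \<theta>' \<alpha> = moment n 3 k (with_pair n k \<theta> s \<rho> M \<delta> K \<Delta>) \<alpha>" if "\<alpha> \<in> moment_indices n 3" for \<alpha>
    using that
  proof (cases rule: moment_indices_cases)
  qed (simp_all only: \<theta>'_def moments_with_pair[OF k m] moments_with_pair[OF k \<theta>'[unfolded \<theta>'_def]] T)
  then have "moment_point n 3 k \<theta>' = moment_point n 3 k \<theta>"
    using eq by (intro moment_point_cong) simp
  moreover have "mean \<theta>' 1 1 = a" "mean \<theta>' 2 1 = b"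
    using k n c(2) \<rho>'(3) by (auto simp: \<theta>'_def with_pair_def \<delta>'_def algebra_simps)
  ultimately show ?thesis using \<theta>' by blast
qed

section \<open>The secant variety as the closure of a family\<close>

lemma family_moment:
  assumes \<theta>: "\<And>w. \<theta> w \<in> mixture_params n k"
    and "\<And>h. h \<in> {1..k} \<Longrightarrow> polyfun P (\<lambda>w. weight (\<theta> w) h)"
    and "\<And>h i. h \<in> {1..k} \<Longrightarrow> i \<in> {1..n} \<Longrightarrow> polyfun P (\<lambda>w. mean (\<theta> w) h i)"
    and "\<And>h i j. h \<in> {1..k} \<Longrightarrow> i \<in> {1..n} \<Longrightarrow> j \<in> {1..n} \<Longrightarrow> polyfun P (\<lambda>w. cov (\<theta> w) h i j)"
  shows "family P (moment_indices n 3) (\<lambda>w. moment n 3 k (\<theta> w))"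
  unfolding family_def
proof (intro conjI ballI allI)
  note f = moment_formulas[OF \<theta>]
  fix \<alpha> assume "\<alpha> \<in> moment_indices n 3"
  then show "polyfun P (\<lambda>w. moment n 3 k (\<theta> w) \<alpha>)"
    by (cases rule: moment_indices_cases)
      (auto simp only: f intro!: polyfun_sum polyfun_mult polyfun_add assms(2-4))
next
  fix w
  have "moment n 3 k (\<theta> w) 0 \<noteq> 0"
    by (simp add: moment_formulas(1)[OF \<theta>])
  then show "\<exists>\<alpha>\<in>moment_indices n 3. moment n 3 k (\<theta> w) \<alpha> \<noteq> 0" using ei_in_moment_indices(1) by blast
qed

text \<open>The parameters of a mixture are indexed by triples \<open>(h, i, j)\<close> with
  \<open>i \<le> j\<close>: \<open>(h, 0, 0)\<close> is a weight, \<open>(h, 0, j)\<close> a coordinate of a mean and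
  \<open>(h, i, j)\<close> an entry of a covariance matrix. The first weight is determined by the others.\<close>

definition mixture_of :: "nat \<Rightarrow> nat \<Rightarrow> (nat \<times> nat \<times> nat \<Rightarrow> complex) \<Rightarrow> mixture" where
  "mixture_of n k w = Mixture
    (\<lambda>h\<in>{1..k}. if h = 1 then 1 - (\<Sum>h\<in>{2..k}. w (h, 0, 0)) else w (h, 0, 0))
    (\<lambda>h\<in>{1..k}. \<lambda>i\<in>{1..n}. w (h, 0, i))
    (\<lambda>h\<in>{1..k}. \<lambda>i\<in>{1..n}. \<lambda>j\<in>{1..n}. w (h, min i j, max i j))"

definition param_idx :: "nat \<Rightarrow> nat \<Rightarrow> (nat \<times> nat \<times> nat) set" where
  "param_idx n k = {1..k} \<times> (SIGMA i:{..n}. {i..n}) - {(1, 0, 0)}"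

lemma mixture_of_in_mixture_params:
  assumes "k \<ge> 1" shows "mixture_of n k w \<in> mixture_params n k"
proof -
  have e: "{1..k} = insert 1 {2..k}" using assms by auto
  have "(\<Sum>h\<in>{1..k}. weight (mixture_of n k w) h) =
      1 - (\<Sum>h\<in>{2..k}. w (h, 0, 0)) + (\<Sum>h\<in>{2..k}. weight (mixture_of n k w) h)"
    unfolding e using assms by (simp add: mixture_of_def)
  also have "(\<Sum>h\<in>{2..k}. weight (mixture_of n k w) h) = (\<Sum>h\<in>{2..k}. w (h, 0, 0))"
    by (rule sum.cong) (auto simp: mixture_of_def)
  finally show ?thesis
    unfolding mixture_params_def by (auto simp: mixture_of_def min.commute max.commute)
qed

lemma mixture_of_surj:
  assumes \<theta>: "\<theta> \<in> mixture_params n k" and k: "k \<ge> 1"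
  shows "mixture_of n k (\<lambda>(h, i, j). if i = 0 then if j = 0 then weight \<theta> h else mean \<theta> h j else cov \<theta> h i j) = \<theta>"
    (is "mixture_of n k ?w = \<theta>")
proof (rule mixture_eqI[OF mixture_of_in_mixture_params[OF k] \<theta>])
  have "{1..k} = insert 1 {2..k}" using k by auto
  then have "weight \<theta> 1 = 1 - (\<Sum>h\<in>{2..k}. weight \<theta> h)" using mixture_paramsD(2)[OF \<theta>] by (simp add: eq_diff_eq)
  then show "weight (mixture_of n k ?w) h = weight \<theta> h" if "h \<in> {1..k}" for h
    using that by (auto simp: mixture_of_def)
  show "mean (mixture_of n k ?w) h i = mean \<theta> h i" if "h \<in> {1..k}" "i \<in> {1..n}" for h i
    using that by (auto simp: mixture_of_def)
  show "cov (mixture_of n k ?w) h i j = cov \<theta> h i j" if "h \<in> {1..k}" "i \<in> {1..n}" "j \<in> {1..n}" for h i j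
    using that mixture_paramsD(1)[OF \<theta> that] by (auto simp: mixture_of_def min_def max_def)
qed

lemma polyfun_mixture_of:
  "h \<in> {1..k} \<Longrightarrow> polyfun (param_idx n k) (\<lambda>w. weight (mixture_of n k w) h)"
  "h \<in> {1..k} \<Longrightarrow> i \<in> {1..n} \<Longrightarrow> polyfun (param_idx n k) (\<lambda>w. mean (mixture_of n k w) h i)"
  "h \<in> {1..k} \<Longrightarrow> i \<in> {1..n} \<Longrightarrow> j \<in> {1..n} \<Longrightarrow> polyfun (param_idx n k) (\<lambda>w. cov (mixture_of n k w) h i j)"
proof -
  show "polyfun (param_idx n k) (\<lambda>w. weight (mixture_of n k w) h)" if h: "h \<in> {1..k}"
  proof (cases "h = 1")
    case True
    then show ?thesis using h
      by (simp add: mixture_of_def) (intro polyfun_diff polyfun_const polyfun_sum polyfun_var, auto simp: param_idx_def)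
  next
    case False
    then show ?thesis using h
      by (simp add: mixture_of_def) (intro polyfun_var, auto simp: param_idx_def)
  qed
  show "polyfun (param_idx n k) (\<lambda>w. mean (mixture_of n k w) h i)" if "h \<in> {1..k}" "i \<in> {1..n}"
    using that by (simp add: mixture_of_def) (intro polyfun_var, auto simp: param_idx_def)
  show "polyfun (param_idx n k) (\<lambda>w. cov (mixture_of n k w) h i j)" if "h \<in> {1..k}" "i \<in> {1..n}" "j \<in> {1..n}"
    using that by (simp add: mixture_of_def) (intro polyfun_var, auto simp: param_idx_def min_def max_def)
qed

lemma family_mixture_of:
  assumes "k \<ge> 1"
  shows "family (param_idx n k) (moment_indices n 3) (\<lambda>w. moment n 3 k (mixture_of n k w))"
  using mixture_of_in_mixture_params[OF assms] polyfun_mixture_of by (rule family_moment)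

lemma Sec_eq_closure_family:
  assumes "k \<ge> 1"
  shows "Sec k n 3 = zariski (moment_indices n 3) closure_of range (\<lambda>w. moment_point n 3 k (mixture_of n k w))"
proof -
  have "moment_point n 3 k ` mixture_params n k = range (\<lambda>w. moment_point n 3 k (mixture_of n k w))"
  proof (rule subset_antisym; rule image_subsetI)
    show "moment_point n 3 k \<theta> \<in> range (\<lambda>w. moment_point n 3 k (mixture_of n k w))"
      if \<theta>: "\<theta> \<in> mixture_params n k" for \<theta>
    proof -
      obtain w where "\<theta> = mixture_of n k w" using mixture_of_surj[OF \<theta> assms, symmetric] by blast
      then show ?thesis by simp
    qed
    show "moment_point n 3 k (mixture_of n k w) \<in> moment_point n 3 k ` mixture_params n k" for w
      using mixture_of_in_mixture_params[OF assms] by blast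
  qed
  then show ?thesis by (simp add: Sec_def)
qed

definition normalise :: "(nat \<times> nat \<times> nat \<Rightarrow> complex) \<Rightarrow> (nat \<times> nat \<times> nat \<Rightarrow> complex)" where
  "normalise w = w((1, 0, 1) := 0, (2, 0, 1) := 1)"

lemma family_reparametrise:
  assumes "family P I \<Phi>" "\<And>x. x \<in> P \<Longrightarrow> polyfun P' (\<lambda>w. f w x)"
  shows "family P' I (\<lambda>w. \<Phi> (f w))"
  unfolding family_def
proof (intro conjI ballI allI)
  fix i assume "i \<in> I"
  then have "polyfun P (\<lambda>w. \<Phi> w i)" using assms(1) by (auto simp: family_def)
  then show "polyfun P' (\<lambda>w. \<Phi> (f w) i)" by (rule polyfun_compose) (rule assms(2))
next
  show "\<exists>i\<in>I. \<Phi> (f w) i \<noteq> 0" for w using assms(1) by (auto simp: family_def)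
qed

lemma family_normalised:
  assumes "k \<ge> 1"
  shows "family (param_idx n k - {(1, 0, 1), (2, 0, 1)}) (moment_indices n 3)
    (\<lambda>w. moment n 3 k (mixture_of n k (normalise w)))"
proof -
  have "polyfun (param_idx n k - {(1, 0, 1), (2, 0, 1)}) (\<lambda>w. normalise w x)" if "x \<in> param_idx n k" for x
    using that by (cases "x = (2, 0, 1)"; cases "x = (1, 0, 1)") (auto simp: normalise_def)
  then show ?thesis by (rule family_reparametrise[OF family_mixture_of[OF assms]])
qed

text \<open>By \<open>renormalise_pair\<close> a mixture in general position has the same moments as a normalised one,
  so two parameters can be dropped without changing the closure.\<close>

lemma Sec_eq_closure_normalised:
  assumes k: "k \<ge> 2" and n: "n \<ge> 1"
  shows "Sec k n 3 = zariski (moment_indices n 3) closure_of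
    range (\<lambda>w. moment_point n 3 k (mixture_of n k (normalise w)))" (is "_ = ?C")
proof (rule subset_antisym)
  have k1: "k \<ge> 1" using k by simp
  let ?\<theta> = "mixture_of n k"
  define D where "D w = (weight (?\<theta> w) 1 + weight (?\<theta> w) 2) * (mean (?\<theta> w) 1 1 - mean (?\<theta> w) 2 1) *
    (weight (?\<theta> w) 1 * mean (?\<theta> w) 1 1 + weight (?\<theta> w) 2 * mean (?\<theta> w) 2 1) *
    (weight (?\<theta> w) 1 * mean (?\<theta> w) 1 1 + weight (?\<theta> w) 2 * mean (?\<theta> w) 2 1
      - (weight (?\<theta> w) 1 + weight (?\<theta> w) 2))" for w
  have "polyfun (param_idx n k) D" unfolding D_def using k n
    by (intro polyfun_mult polyfun_add polyfun_diff polyfun_mixture_of) auto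
  \<comment> \<open>a single component of weight 1 whose mean has first coordinate 2; the other ones have weight 0\<close>
  moreover have "D (\<lambda>x. if x = (1, 0, 1) then 2 else 0) \<noteq> 0"
    using k n by (simp add: D_def mixture_of_def)
  ultimately have "Sec k n 3 = zariski (moment_indices n 3) closure_of
      points (moment_indices n 3) (\<lambda>w. moment n 3 k (?\<theta> w)) {w. D w \<noteq> 0}"
    using closure_of_generic_points[OF family_mixture_of[OF k1], where D = D]
    unfolding Sec_eq_closure_family[OF k1] moment_point_def by simp
  also have "\<dots> \<subseteq> ?C"
  proof (rule closure_of_mono, rule image_subsetI)
    fix w assume "w \<in> {w. D w \<noteq> 0}"
    then have "D w \<noteq> 0" by simp
    then have "\<exists>\<theta>'\<in>mixture_params n k. mean \<theta>' 1 1 = 0 \<and> mean \<theta>' 2 1 = 1 \<and>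
        moment_point n 3 k \<theta>' = moment_point n 3 k (?\<theta> w)"
      by (intro renormalise_pair[OF mixture_of_in_mixture_params[OF k1] k n]) (auto simp: D_def)
    then obtain \<theta>' where \<theta>': "\<theta>' \<in> mixture_params n k" "mean \<theta>' 1 1 = 0" "mean \<theta>' 2 1 = 1"
      "moment_point n 3 k \<theta>' = moment_point n 3 k (?\<theta> w)"
      by blast
    let ?w = "\<lambda>(h, i, j). if i = 0 then if j = 0 then weight \<theta>' h else mean \<theta>' h j else cov \<theta>' h i j"
    have "normalise ?w = ?w" using \<theta>'(2,3) by (auto simp: normalise_def)
    then have "mixture_of n k (normalise ?w) = \<theta>'" using mixture_of_surj[OF \<theta>'(1) k1] by simp
    then have "moment_point n 3 k (mixture_of n k (normalise ?w)) = moment_point n 3 k (?\<theta> w)"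
      using \<theta>'(4) by simp
    then show "proj_point (moment_indices n 3) (moment n 3 k (?\<theta> w)) \<in>
        range (\<lambda>w. moment_point n 3 k (mixture_of n k (normalise w)))"
      by (intro range_eqI[of _ _ ?w]) (simp add: moment_point_def)
  qed
  finally show "Sec k n 3 \<subseteq> ?C" .
  show "?C \<subseteq> Sec k n 3"
    unfolding Sec_eq_closure_family[OF k1] by (intro closure_of_mono) auto
qed

lemma card_param_idx:
  assumes "k \<ge> 1"
  shows "finite (param_idx n k)" "card (param_idx n k) = k * (n * (n + 3)) div 2 + k - 1"
proof -
  let ?T = "SIGMA i:{..n}. {i..n}"
  show fin: "finite (param_idx n k)" by (simp add: param_idx_def)
  have "card ?T = (\<Sum>i\<le>n. Suc n - i)" by simp
  also have "\<dots> = (\<Sum>i\<le>n. Suc i)"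
    by (rule sum.reindex_bij_witness[of _ "\<lambda>i. n - i" "\<lambda>i. n - i"]) auto
  finally have "card ?T = (\<Sum>i\<le>n. Suc i)" .
  moreover have "2 * (\<Sum>i\<le>n. Suc i) = (n + 1) * (n + 2)"
    by (induction n) (auto simp: algebra_simps)
  ultimately have T: "2 * card ?T = (n + 1) * (n + 2)" by simp
  have "card (param_idx n k) = k * card ?T - 1"
    unfolding param_idx_def using assms by (subst card_Diff_singleton) (auto simp: card_cartesian_product)
  moreover have "even (n * (n + 3))" by simp
  then obtain c where c: "n * (n + 3) = 2 * c" by (rule evenE)
  moreover have "card ?T = c + 1" using T c by (simp add: algebra_simps)
  ultimately show "card (param_idx n k) = k * (n * (n + 3)) div 2 + k - 1"
    by (simp add: mult.left_commute)
qed

lemma dim_Sec_le: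
  assumes k: "k \<ge> 2" and n: "n \<ge> 1"
  shows "dim_Sec k n 3 \<le> enat (k * (n * (n + 3)) div 2 + k - 3)"
  unfolding dim_Sec_def
proof (rule dimension_in_le)
  show "closedin (zariski (moment_indices n 3)) (Sec k n 3)" by (simp add: Sec_def)
  fix s Z assume "\<And>i. i \<le> s \<Longrightarrow> irreducible_closedin (zariski (moment_indices n 3)) (Z i)"
    "\<And>i. i < s \<Longrightarrow> Z i \<subset> Z (Suc i)" "Z s \<subseteq> Sec k n 3"
  then have "s \<le> card (param_idx n k - {(1, 0, 1), (2, 0, 1)})"
    using k card_param_idx(1)[of k n]
    by (intro chain_length_le_parameters[OF _ family_normalised])
      (auto simp: Sec_eq_closure_normalised[OF k n] moment_point_def)
  also have "\<dots> = card (param_idx n k) - 2"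
    using card_param_idx(1)[of k n] k n by (subst card_Diff_subset) (auto simp: param_idx_def)
  also have "\<dots> = k * (n * (n + 3)) div 2 + k - 3"
    using k by (simp add: card_param_idx(2))
  finally show "s \<le> k * (n * (n + 3)) div 2 + k - 3" .
qed

section \<open>Proper closed subsets of projective space\<close>

text \<open>A nonzero form and the coordinate \<open>z\<close> are both nonzero at a common point, so the affine chart
  is dense. This exhibits projective space as a family with one parameter less than it has
  homogeneous coordinates.\<close>

lemma proj_space_eq_closure_chart:
  assumes z: "z \<in> I"
  shows "family (I - {z}) I (\<lambda>w. w(z := 1))"
    "zariski I closure_of range (\<lambda>w. proj_point I (w(z := 1))) = proj_space I"
proof -
  have "polyfun (I - {z}) (\<lambda>w. (w(z := 1)) i)" if "i \<in> I" for i
    using that by (cases "i = z") auto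
  moreover have "\<exists>i\<in>I. (w(z := 1)) i \<noteq> 0" for w :: "'a \<Rightarrow> complex" using z by (intro bexI[of _ z]) auto
  ultimately show fam: "family (I - {z}) I (\<lambda>w. w(z := 1))" unfolding family_def by blast
  have "vanishes_on {proj_point I v} p" if p: "form I e p" "vanishes_on (range (\<lambda>w. proj_point I (w(z := 1)))) p" for v e p
  proof (rule ccontr)
    assume "\<not> ?thesis"
    then have v: "poly_value v p \<noteq> 0" using vanishes_on_proj_point[OF p(1)] by blast
    have "\<exists>w. poly_value w p \<noteq> 0 \<and> w z \<noteq> 0"
      by (rule polyfun_common_nonzero[where F = "\<lambda>w. poly_value w p" and G = "\<lambda>w. w z" and a = v and b = "\<lambda>_. 1" and I = I])
        (use polyfun_form[OF p(1)] z v in auto)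
    then obtain w where w: "poly_value w p \<noteq> 0" "w z \<noteq> 0" by blast
    let ?u = "\<lambda>i. w i / w z"
    have "?u = ?u(z := 1)" using w(2) by auto
    then have "poly_value ?u p = 0"
      using p(2) vanishes_on_image[OF p(1), of "\<lambda>w. w(z := 1)" UNIV] by (metis UNIV_I)
    moreover have "proj_point I ?u = proj_point I w" by (rule proj_point_divide[OF w(2)])
    ultimately show False using w(1) vanishes_on_proj_point[OF p(1)] by metis
  qed
  then have "proj_space I \<subseteq> zariski I closure_of range (\<lambda>w. proj_point I (w(z := 1)))"
    unfolding subset_iff in_zariski_closure_iff[OF points_in_space[OF fam]] by (auto simp: proj_space_def)
  then show "zariski I closure_of range (\<lambda>w. proj_point I (w(z := 1))) = proj_space I"
    using closure_of_subset_topspace[of "zariski I"] by (intro subset_antisym) simp_all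
qed

text \<open>A chain in \<open>S\<close> becomes longer by appending the whole space, which is irreducible.\<close>

lemma dimension_in_proper_closed_le:
  assumes I: "finite I" "card I \<ge> 2" and S: "closedin (zariski I) S" "S \<noteq> proj_space I"
  shows "dimension_in I S \<le> enat (card I - 2)"
proof (rule dimension_in_le[OF S(1)])
  fix s Z assume irr: "\<And>i. i \<le> s \<Longrightarrow> irreducible_closedin (zariski I) (Z i)"
    and chain: "\<And>i. i < s \<Longrightarrow> Z i \<subset> Z (Suc i)" and top: "Z s \<subseteq> S"
  obtain z where z: "z \<in> I" using I by fastforce
  note ch = proj_space_eq_closure_chart[OF z]
  define Z' where "Z' i = (if i \<le> s then Z i else proj_space I)" for i
  have "Suc s \<le> card (I - {z})"
  proof (rule chain_length_le_parameters[OF _ ch(1)])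
    show "finite (I - {z})" using I by simp
    show "irreducible_closedin (zariski I) (Z' i)" for i
      using irr[of i] irreducible_closure_of_family[OF ch(1)] unfolding Z'_def ch(2) by simp
    have "S \<subset> proj_space I" using S closedin_subset[OF S(1)] by auto
    then show "Z' i \<subset> Z' (Suc i)" if "i < Suc s" for i
      using that chain[of i] top by (cases "i = s") (auto simp: Z'_def)
    show "Z' (Suc s) \<subseteq> zariski I closure_of range (\<lambda>w. proj_point I (w(z := 1)))"
      by (simp add: Z'_def ch(2))
  qed
  then show "s \<le> card I - 2" using z I by simp
qed

lemma Sec_defective:
  assumes n: "n \<ge> 1" and k: "k \<ge> 2" and proper: "Sec k n 3 \<noteq> moment_space n 3"
  shows "defective k n 3"
proof -
  let ?N = "(n + 3) choose 3"
  have "1 \<le> n" "n * (n + 3) \<ge> 1" using n by auto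
  then have k3: "k * n * (n + 3) div 2 + k - 1 > k * (n * (n + 3)) div 2 + k - 3"
    using k by (simp add: mult.assoc)
  have card: "finite (moment_indices n 3)" "card (moment_indices n 3) \<le> ?N"
    using card_moment_indices[of n 3] by auto
  have "ei 1 \<noteq> 0" using lookup_single_eq[of "1::nat" "1::nat"] lookup_zero[of "1::nat"] zero_neq_one by metis
  then have c2: "card (moment_indices n 3) \<ge> 2"
    using card_mono[OF card(1), of "{0, ei 1}"] ei_in_moment_indices(1)[of n] ei_in_moment_indices(2)[of 1 n] n by simp
  have "dim_Sec k n 3 \<le> enat (card (moment_indices n 3) - 2)"
    unfolding dim_Sec_def by (rule dimension_in_proper_closed_le[OF card(1) c2 _ proper]) (simp add: Sec_def)
  moreover have "card (moment_indices n 3) - 2 < ?N - 1" using card c2 by simp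
  ultimately show ?thesis unfolding defective_def
    using dim_Sec_le[OF k n] k3 by (auto simp: min_def) (meson enat_ord_simps(2) le_less_trans)+
qed

section \<open>Chains of subfamilies\<close>

text \<open>A lower bound for the dimension. Switch the parameters on one after the other, in
  the order of their blocks. The coordinate \<open>a x\<close> shows that the closure grows when \<open>x\<close> is switched on.\<close>

lemma dimension_ge_card_parameters:
  fixes \<Phi> :: "('p \<Rightarrow> complex) \<Rightarrow> 'i \<Rightarrow> complex" and blk :: "'p \<Rightarrow> nat"
  assumes P: "finite P" and \<Phi>: "family P I \<Phi>"
    and S: "closedin (zariski I) S" "\<And>w. proj_point I (\<Phi> w) \<in> S"
    and a: "\<And>x. x \<in> P \<Longrightarrow> a x \<in> I"
    and before: "\<And>x w. x \<in> P \<Longrightarrow> w x = 0 \<Longrightarrow> (\<And>y. y \<in> P \<Longrightarrow> blk x < blk y \<Longrightarrow> w y = 0) \<Longrightarrow> \<Phi> w (a x) = 0"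
    and after: "\<And>x. x \<in> P \<Longrightarrow> \<exists>w. (\<forall>y. w y \<noteq> 0 \<longrightarrow> y \<in> P \<and> (y = x \<or> blk y < blk x)) \<and> \<Phi> w (a x) \<noteq> 0"
  shows "enat (card P) \<le> dimension_in I S"
proof -
  obtain ys where ys: "set ys = P" "distinct ys" using finite_distinct_list[OF P] by blast
  define xs where "xs = sort_key blk ys"
  have xs: "set xs = P" "distinct xs" "length xs = card P" and sorted: "sorted (map blk xs)"
    using ys distinct_card[OF ys(2)] by (auto simp: xs_def)
  define f where "f i w = (\<lambda>x. if x \<in> set (take i xs) then w x else 0)" for i and w :: "'p \<Rightarrow> complex"
  have taken: "x \<in> set (take i xs) \<longleftrightarrow> (\<exists>j<i. j < length xs \<and> x = xs ! j)" for i x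
    by (auto simp: in_set_conv_nth)
  have fam: "family P I (\<lambda>w. \<Phi> (f i w))" for i
  proof (rule family_reparametrise[OF \<Phi>])
    show "polyfun P (\<lambda>w. f i w x)" if "x \<in> P" for x
      using that by (cases "x \<in> set (take i xs)") (auto simp: f_def)
  qed
  let ?R = "\<lambda>i. range (\<lambda>w. proj_point I (\<Phi> (f i w)))"
  define Z where "Z i = zariski I closure_of ?R i" for i
  show ?thesis
  proof (rule dimension_in_ge[OF S(1)])
    show "irreducible_closedin (zariski I) (Z i)" for i
      unfolding Z_def by (rule irreducible_closure_of_family[OF fam])
    show "Z i \<subseteq> S" for i unfolding Z_def
      by (rule closure_of_minimal[OF _ S(1)]) (use S(2) in auto)
    fix i assume i: "i < card P"
    define x where "x = xs ! i"
    have x: "x \<in> P" using i xs by (auto simp: x_def)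
    have x_new: "x \<notin> set (take i xs)"
      using i xs(2,3) by (auto simp: x_def taken nth_eq_iff_index_eq)
    have later: "y \<notin> set (take i xs)" if "blk x < blk y" for y
    proof
      assume "y \<in> set (take i xs)"
      then obtain j where "j < i" "y = xs ! j" by (auto simp: taken)
      then have "blk y \<le> blk x"
        using sorted_nth_mono[OF sorted, of j i] i xs(3) by (simp add: x_def)
      then show False using that by simp
    qed
    have earlier: "y \<in> set (take (Suc i) xs)" if y: "y \<in> P" "y = x \<or> blk y < blk x" for y
    proof -
      obtain j where j: "j < length xs" "y = xs ! j" using y(1) xs(1) by (metis in_set_conv_nth)
      have "j \<le> i"
      proof (rule ccontr)
        assume "\<not> j \<le> i"
        then have "i < j" by simp
        then have "blk x \<le> blk y" using sorted_nth_mono[OF sorted, of i j] j by (simp add: x_def)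
        then show False using y(2) \<open>i < j\<close> j xs(2) by (auto simp: x_def nth_eq_iff_index_eq)
      qed
      then show ?thesis using j unfolding taken by (intro exI[of _ j]) simp
    qed
    have form: "form I 1 (var (a x))" by (rule form_var[OF a[OF x]])
    have "\<Phi> (f i w) (a x) = 0" for w
      by (rule before[OF x]) (auto simp: f_def x_new later)
    then have van: "vanishes_on (Z i) (var (a x))"
      unfolding Z_def vanishes_on_closure[OF points_in_space[OF fam] form]
      by (simp add: vanishes_on_image[OF form, of "\<lambda>w. \<Phi> (f i w)" UNIV])
    obtain w where w: "\<forall>y. w y \<noteq> 0 \<longrightarrow> y \<in> P \<and> (y = x \<or> blk y < blk x)" "\<Phi> w (a x) \<noteq> 0"
      using after[OF x] by blast
    have "f (Suc i) w = w"
    proof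
      show "f (Suc i) w y = w y" for y using w(1) earlier[of y] by (auto simp: f_def)
    qed
    then have "\<Phi> (f (Suc i) w) (a x) \<noteq> 0" using w(2) by simp
    then have "\<not> vanishes_on (Z (Suc i)) (var (a x))"
      unfolding Z_def vanishes_on_closure[OF points_in_space[OF fam] form]
      using vanishes_on_image[OF form, of "\<lambda>w. \<Phi> (f (Suc i) w)" UNIV] by auto
    moreover have "f i w = f (Suc i) (f i w)" for w
      using i xs(3) by (auto simp: f_def take_Suc_conv_app_nth)
    then have "?R i \<subseteq> ?R (Suc i)" by (intro image_subsetI) (metis rangeI)
    then have "Z i \<subseteq> Z (Suc i)" unfolding Z_def by (rule closure_of_mono)
    ultimately show "Z i \<subset> Z (Suc i)" using van by auto
  qed
qed

section \<open>The dimension of the secant variety\<close>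

definition chain_idx :: "nat \<Rightarrow> (nat \<times> nat \<times> nat) set" where
  "chain_idx n = {0, 1} \<times> (SIGMA i:{1..n}. {i..n}) \<union> {2} \<times> {0} \<times> {2..n} \<union> {3} \<times> {0} \<times> {1..n}"

text \<open>With equal weights and first coordinate of \<open>\<delta>\<close> equal to \<open>1\<close>, everything else is free:
  the parameters \<open>(0, i, j)\<close> are \<open>K\<close>, \<open>(1, i, j)\<close> are \<open>\<Delta>\<close>, \<open>(2, 0, i)\<close> are the
  remaining coordinates of \<open>\<delta>\<close>, and \<open>(3, 0, i)\<close> are \<open>M\<close>. The blocks are switched on in
  this order. The centre comes last since moments and cumulants of orders 2 and 3 agree while it
  vanishes, and \<open>\<delta>\<close> comes after \<open>\<Delta>\<close> since it is visible only through its product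
  with \<open>\<Delta>\<close>.\<close>

definition chain_mixture :: "nat \<Rightarrow> (nat \<times> nat \<times> nat \<Rightarrow> complex) \<Rightarrow> mixture" where
  "chain_mixture n w = with_pair n 2 undefined 1 (1/2) (\<lambda>i. w (3, 0, i))
    (\<lambda>i. if i = 1 then 1 else w (2, 0, i))
    (\<lambda>i j. w (0, min i j, max i j)) (\<lambda>i j. w (1, min i j, max i j))"

text \<open>The moment that detects a parameter while all later blocks are zero. As long as \<open>\<delta>\<close> is the
  first unit vector, \<open>\<Delta>\<close> is read off from the moments that involve the first coordinate; a
  coordinate of \<open>\<delta>\<close> appears in the pure third moment, multiplied by a diagonal entry of
  \<open>\<Delta>\<close>.\<close>

definition chain_coordinate :: "nat \<times> nat \<times> nat \<Rightarrow> nat monomial" where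
  "chain_coordinate = (\<lambda>(c, i, j). if c = 0 then ei i + ei j else if c = 1 then ei 1 + ei i + ei j
    else if c = 2 then ei j + ei j + ei j else ei j)"

lemma chain_mixture_in_mixture_params: "chain_mixture n w \<in> mixture_params n 2"
  unfolding chain_mixture_def
  by (rule with_pair_in_mixture_params) (auto simp: min.commute max.commute)

lemma family_chain: "family (chain_idx n) (moment_indices n 3) (\<lambda>w. moment n 3 2 (chain_mixture n w))"
proof (rule family_moment[OF chain_mixture_in_mixture_params])
  let ?P = "chain_idx n"
  have K: "polyfun ?P (\<lambda>w. w (0, min i j, max i j))" "polyfun ?P (\<lambda>w. w (1, min i j, max i j))"
    if "i \<in> {1..n}" "j \<in> {1..n}" for i j
    using that by (auto intro!: polyfun_var simp: chain_idx_def min_def max_def)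
  have M: "polyfun ?P (\<lambda>w. w (3, 0, i))" if "i \<in> {1..n}" for i
    using that by (auto intro!: polyfun_var simp: chain_idx_def)
  have d: "polyfun ?P (\<lambda>w. if i = 1 then 1 else w (2, 0, i))" if "i \<in> {1..n}" for i
    using that by (cases "i = 1") (auto intro!: polyfun_var simp: chain_idx_def)
  show "polyfun ?P (\<lambda>w. weight (chain_mixture n w) h)" if "h \<in> {1..2}" for h
    using that by (simp add: chain_mixture_def with_pair_def polyfun_const)
  show "polyfun ?P (\<lambda>w. mean (chain_mixture n w) h i)" if "h \<in> {1..2}" "i \<in> {1..n}" for h i
  proof (cases "h = 1")
    case True
    have "polyfun ?P (\<lambda>w. w (3, 0, i) + (1 - 1/2) * (if i = 1 then 1 else w (2, 0, i)))"
      by (intro polyfun_add polyfun_mult polyfun_const M d that)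
    then show ?thesis using True that by (simp add: chain_mixture_def with_pair_def)
  next
    case False
    have "polyfun ?P (\<lambda>w. w (3, 0, i) - 1/2 * (if i = 1 then 1 else w (2, 0, i)))"
      by (intro polyfun_diff polyfun_mult polyfun_const M d that)
    then show ?thesis using False that by (auto simp: chain_mixture_def with_pair_def)
  qed
  show "polyfun ?P (\<lambda>w. cov (chain_mixture n w) h i j)" if "h \<in> {1..2}" "i \<in> {1..n}" "j \<in> {1..n}" for h i j
  proof (cases "h = 1")
    case True
    have "polyfun ?P (\<lambda>w. w (0, min i j, max i j) - 1/2 * (1 - 1/2) * (if i = 1 then 1 else w (2, 0, i)) *
        (if j = 1 then 1 else w (2, 0, j)) + (1 - 1/2) * w (1, min i j, max i j))"
      by (intro polyfun_add polyfun_diff polyfun_mult polyfun_const K d that)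
    then show ?thesis using True that by (simp add: chain_mixture_def with_pair_def)
  next
    case False
    have "polyfun ?P (\<lambda>w. w (0, min i j, max i j) - 1/2 * (1 - 1/2) * (if i = 1 then 1 else w (2, 0, i)) *
        (if j = 1 then 1 else w (2, 0, j)) - 1/2 * w (1, min i j, max i j))"
      by (intro polyfun_add polyfun_diff polyfun_mult polyfun_const K d that)
    then show ?thesis using False that by (auto simp: chain_mixture_def with_pair_def)
  qed
qed

lemma moments_chain_mixture:
  fixes w :: "nat \<times> nat \<times> nat \<Rightarrow> complex"
  defines "\<delta> \<equiv> \<lambda>i. if i = 1 then 1 else w (2, 0, i)"
    and "\<Delta> \<equiv> \<lambda>i j. w (1, min i j, max i j)"
  shows "i \<in> {1..n} \<Longrightarrow> moment n 3 2 (chain_mixture n w) (ei i) = w (3, 0, i)"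
    "i \<in> {1..n} \<Longrightarrow> j \<in> {1..n} \<Longrightarrow> w (3, 0, i) = 0 \<Longrightarrow>
      moment n 3 2 (chain_mixture n w) (ei i + ei j) = w (0, min i j, max i j)"
    "i \<in> {1..n} \<Longrightarrow> j \<in> {1..n} \<Longrightarrow> l \<in> {1..n} \<Longrightarrow> w (3, 0, i) = 0 \<Longrightarrow> w (3, 0, j) = 0 \<Longrightarrow> w (3, 0, l) = 0 \<Longrightarrow>
      moment n 3 2 (chain_mixture n w) (ei i + ei j + ei l) = (\<delta> i * \<Delta> j l + \<delta> j * \<Delta> i l + \<delta> l * \<Delta> i j) / 4"
  using moments_with_pair(2-4)[OF order_refl chain_mixture_in_mixture_params[of n w, unfolded chain_mixture_def],
      folded chain_mixture_def]
  by (simp_all add: third_cumulant_def \<delta>_def \<Delta>_def)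

lemma card_chain_idx:
  assumes "n \<ge> 1"
  shows "finite (chain_idx n)" "card (chain_idx n) = n * (n + 3) - 1"
proof -
  let ?T = "SIGMA i:{1..n}. {i..n}"
  show "finite (chain_idx n)" by (simp add: chain_idx_def)
  have "card ?T = (\<Sum>i\<in>{1..n}. Suc n - i)" by simp
  also have "\<dots> = (\<Sum>i\<in>{1..n}. i)"
    by (rule sum.reindex_bij_witness[of _ "\<lambda>i. Suc n - i" "\<lambda>i. Suc n - i"]) auto
  finally have "card ?T = (\<Sum>i\<in>{1..n}. i)" .
  moreover have "2 * (\<Sum>i\<in>{1..n}. i) = n * (n + 1)"
    by (induction n) (auto simp: algebra_simps)
  ultimately have T: "2 * card ?T = n * (n + 1)" by simp
  have "card (chain_idx n) = card ({0, 1::nat} \<times> ?T) + card ({2::nat} \<times> {0::nat} \<times> {2..n}) + card ({3::nat} \<times> {0::nat} \<times> {1..n})"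
    unfolding chain_idx_def by (subst card_Un_disjoint; (subst card_Un_disjoint)?) auto
  also have "\<dots> = 2 * card ?T + (n - 1) + n" by (simp add: card_cartesian_product)
  also have "\<dots> = n * (n + 3) - 1" unfolding T using assms by (simp add: algebra_simps)
  finally show "card (chain_idx n) = n * (n + 3) - 1" .
qed

lemma dim_Sec_2:
  assumes n: "n \<ge> 1"
  shows "dim_Sec 2 n 3 = enat (n * (n + 3) - 1)"
proof (rule antisym)
  show "dim_Sec 2 n 3 \<le> enat (n * (n + 3) - 1)" using dim_Sec_le[OF order_refl n] by simp
  have "enat (card (chain_idx n)) \<le> dimension_in (moment_indices n 3) (Sec 2 n 3)"
  proof (rule dimension_ge_card_parameters[where blk = fst and a = chain_coordinate, OF card_chain_idx(1)[OF n] family_chain])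
    let ?I = "moment_indices n 3"
    show "closedin (zariski ?I) (Sec 2 n 3)" by (simp add: Sec_def)
    show "proj_point ?I (moment n 3 2 (chain_mixture n w)) \<in> Sec 2 n 3" for w
    proof -
      have "moment_point n 3 2 ` mixture_params n 2 \<subseteq> Sec 2 n 3" unfolding Sec_def
      proof (rule closure_of_subset)
        show "moment_point n 3 2 ` mixture_params n 2 \<subseteq> topspace (zariski ?I)"
          using ei_in_moment_indices(1)[of n] moment_formulas(1)[of _ n 2]
          by (auto simp: moment_point_def intro!: proj_point_in_space bexI[of _ 0])
      qed
      then show ?thesis using chain_mixture_in_mixture_params[of n w] by (auto simp: moment_point_def)
    qed
    fix x assume x: "x \<in> chain_idx n"
    then obtain c i j where xc: "x = (c, i, j)"
      "(c = 0 \<or> c = 1) \<and> 1 \<le> i \<and> i \<le> j \<and> j \<le> n \<or> c = 2 \<and> i = 0 \<and> 2 \<le> j \<and> j \<le> n \<or> c = 3 \<and> i = 0 \<and> 1 \<le> j \<and> j \<le> n"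
      unfolding chain_idx_def by auto
    have n1: "1 \<in> {1..n}" using n by simp
    show "chain_coordinate x \<in> ?I"
      using xc ei_in_moment_indices(2)[of j n] ei_in_moment_indices(3)[of i n j]
        ei_in_moment_indices(4)[OF n1, of i j] ei_in_moment_indices(4)[of j n j j]
      by (auto simp: chain_coordinate_def)
    show "moment n 3 2 (chain_mixture n w) (chain_coordinate x) = 0"
      if w0: "w x = 0" and w: "\<And>y. y \<in> chain_idx n \<Longrightarrow> fst x < fst y \<Longrightarrow> w y = 0" for w
    proof -
      have w3: "w (3, 0, i) = 0" if "i \<in> {1..n}" "c < 3" for i
        using w[of "(3, 0, i)"] that xc(1) by (auto simp: chain_idx_def)
      have w2: "w (2, 0, i) = 0" if "i \<in> {1..n}" "i \<noteq> 1" "c < 2" for i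
        using w[of "(2, 0, i)"] that xc(1) by (auto simp: chain_idx_def)
      note m = moments_chain_mixture[of _ n]
      consider "c = 0" "i \<in> {1..n}" "j \<in> {1..n}" "i \<le> j" | "c = 1" "i \<in> {1..n}" "j \<in> {1..n}" "i \<le> j"
        | "c = 2" "j \<in> {1..n}" "j \<noteq> 1" "i = 0" | "c = 3" "j \<in> {1..n}" "i = 0"
        using xc(2) by auto
      then show ?thesis
      proof cases
        case 1
        then show ?thesis using m(2)[of i j w] w3[of i] w0 xc(1) by (simp add: chain_coordinate_def)
      next
        case 2
        then show ?thesis using m(3)[of 1 i j w] w3[of i] w3[of j] w3[of 1] w2[of i] w2[of j] w0 xc(1) n1
          by (cases "i = 1"; cases "j = 1") (auto simp: chain_coordinate_def min_def max_def)
      next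
        case 3
        then show ?thesis using m(3)[of j j j w] w3[of j] w0 xc(1) by (simp add: chain_coordinate_def)
      next
        case 4
        then show ?thesis using m(1)[of j w] w0 xc(1) by (simp add: chain_coordinate_def)
      qed
    qed
    show "\<exists>w. (\<forall>y. w y \<noteq> 0 \<longrightarrow> y \<in> chain_idx n \<and> (y = x \<or> fst y < fst x)) \<and>
        moment n 3 2 (chain_mixture n w) (chain_coordinate x) \<noteq> 0"
    proof -
      \<comment> \<open>for a coordinate of \<open>\<delta>\<close> the diagonal entry of \<open>\<Delta>\<close> that multiplies it is needed too\<close>
      define w :: "nat \<times> nat \<times> nat \<Rightarrow> complex" where "w y = (if y = x \<or> c = 2 \<and> y = (1, j, j) then 1 else 0)" for y
      have supp: "\<forall>y. w y \<noteq> 0 \<longrightarrow> y \<in> chain_idx n \<and> (y = x \<or> fst y < fst x)"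
        using x xc by (auto simp: w_def chain_idx_def)
      note m = moments_chain_mixture[of _ n]
      consider "c = 0" "i \<in> {1..n}" "j \<in> {1..n}" "i \<le> j" | "c = 1" "i \<in> {1..n}" "j \<in> {1..n}" "i \<le> j"
        | "c = 2" "j \<in> {1..n}" "j \<noteq> 1" "i = 0" | "c = 3" "j \<in> {1..n}" "i = 0"
        using xc(2) by auto
      then have "moment n 3 2 (chain_mixture n w) (chain_coordinate x) \<noteq> 0"
      proof cases
        case 1
        then show ?thesis using m(2)[of i j w] xc(1) by (simp add: chain_coordinate_def w_def)
      next
        case 2
        then show ?thesis using m(3)[of 1 i j w] xc(1) n1
          by (cases "i = 1"; cases "j = 1") (auto simp: chain_coordinate_def w_def min_def max_def)
      next
        case 3
        then show ?thesis using m(3)[of j j j w] xc(1) by (auto simp: chain_coordinate_def w_def)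
      next
        case 4
        then show ?thesis using m(1)[of j w] xc(1) by (simp add: chain_coordinate_def w_def)
      qed
      then show ?thesis using supp by blast
    qed
  qed
  then show "enat (n * (n + 3) - 1) \<le> dim_Sec 2 n 3"
    unfolding dim_Sec_def card_chain_idx(2)[OF n] .
qed

section \<open>Recovering a linear factor of a cubic form\<close>

text \<open>Pseudo-division: the cubic equation reduces the quintic one to a quadratic equation with
  coefficients \<open>\<alpha>\<close>, \<open>\<beta>\<close>, \<open>\<gamma>\<close>, and this reduces the cubic one to a linear
  equation. A common root is thus a rational function of the coefficients.\<close>

lemma quintic_cubic_elimination:
  fixes p :: complex
  assumes cubic: "A * p ^ 3 = B * p ^ 2 + C * p + D"
    and quintic: "c0 + c1 * p + c2 * p ^ 2 + c3 * p ^ 3 + c4 * p ^ 4 + c5 * p ^ 5 = 0"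
  defines "\<alpha> \<equiv> c5 * (B * (B ^ 2 + A * C) + A * (B * C + A * D)) + A * c4 * (B ^ 2 + A * C) + A ^ 2 * c3 * B + A ^ 3 * c2"
    and "\<beta> \<equiv> c5 * (C * (B ^ 2 + A * C) + A * B * D) + A * c4 * (B * C + A * D) + A ^ 2 * c3 * C + A ^ 3 * c1"
    and "\<gamma> \<equiv> c5 * D * (B ^ 2 + A * C) + A * c4 * B * D + A ^ 2 * c3 * D + A ^ 3 * c0"
  shows "(A * (\<beta> ^ 2 - \<alpha> * \<gamma>) + \<alpha> * \<beta> * B - \<alpha> ^ 2 * C) * p + (A * \<beta> * \<gamma> + \<alpha> * \<gamma> * B - \<alpha> ^ 2 * D) = 0"
proof -
  have p4: "A ^ 2 * p ^ 4 = (B ^ 2 + A * C) * p ^ 2 + (B * C + A * D) * p + B * D"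
    using cubic by algebra
  have p5: "A ^ 3 * p ^ 5 = (B * (B ^ 2 + A * C) + A * (B * C + A * D)) * p ^ 2
      + (C * (B ^ 2 + A * C) + A * B * D) * p + D * (B ^ 2 + A * C)"
    using cubic p4 by algebra
  have "A ^ 3 * (c0 + c1 * p + c2 * p ^ 2 + c3 * p ^ 3 + c4 * p ^ 4 + c5 * p ^ 5) =
      c5 * (A ^ 3 * p ^ 5) + A * c4 * (A ^ 2 * p ^ 4) + A ^ 2 * c3 * (A * p ^ 3) + A ^ 3 * c2 * p ^ 2 + A ^ 3 * c1 * p + A ^ 3 * c0"
    by algebra
  also have "\<dots> = \<alpha> * p ^ 2 + \<beta> * p + \<gamma>"
    unfolding p5 p4 cubic \<alpha>_def \<beta>_def \<gamma>_def by algebra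
  finally have quadratic: "\<alpha> * p ^ 2 + \<beta> * p + \<gamma> = 0" using quintic by simp
  show ?thesis using cubic quadratic unfolding \<alpha>_def[symmetric] \<beta>_def[symmetric] \<gamma>_def[symmetric] by algebra
qed

text \<open>Suppose that the cubic form \<open>T\<close> is divisible by a linear form \<open>L\<close> with \<open>L 1 = 1\<close>, and
  let \<open>e1\<close>, \<open>e2\<close>, \<open>e3\<close> be the first three unit vectors. The vectors
  \<open>x = e2 - p e1\<close> and \<open>y = e3 - q e1\<close>, where \<open>p = L 2\<close> and \<open>q = L 3\<close>, are in the
  kernel of \<open>L\<close>, so \<open>T\<close> vanishes on the plane that they span. The equation \<open>T x x x = 0\<close> is cubic in \<open>p\<close>, the equation \<open>T x x y = 0\<close> reads
  \<open>q * G p = N p\<close> with quadratic polynomials \<open>G\<close> and \<open>N\<close>, and substituting this in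
  \<open>T x y y = 0\<close> gives, up to sign, the polynomial below in \<open>p\<close> alone. In general the cubic
  equation has three roots, but only one of them is a root of this polynomial as well.\<close>

definition elim_poly :: "(nat \<Rightarrow> nat \<Rightarrow> nat \<Rightarrow> complex) \<Rightarrow> complex poly" where
  "elim_poly T = [:- T 1 1 2, T 1 1 1:] * [:T 2 2 3, - 2 * T 1 2 3, T 1 1 3:] ^ 2
    + [:2 * T 1 2 3, - 2 * T 1 1 3:] * ([:T 2 2 3, - 2 * T 1 2 3, T 1 1 3:] * [:T 1 2 2, - 2 * T 1 1 2, T 1 1 1:])
    + [:- T 2 3 3, T 1 3 3:] * [:T 1 2 2, - 2 * T 1 1 2, T 1 1 1:] ^ 2"

text \<open>\<open>rem2\<close>, \<open>rem1\<close> and \<open>rem0\<close> are the coefficients of the remainder of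
  \<open>elim_poly\<close> modulo the cubic equation for \<open>p\<close>, and \<open>kernel2\<close> and \<open>kernel1\<close> those of
  the linear equation that results for \<open>p\<close>. Thus \<open>kernel2 e2 + kernel1 e1\<close> is a multiple of
  \<open>x\<close> that depends polynomially on \<open>T\<close>.\<close>

definition rem2 :: "(nat \<Rightarrow> nat \<Rightarrow> nat \<Rightarrow> complex) \<Rightarrow> complex" where
  "rem2 T = (let A = T 1 1 1; B = 3 * T 1 1 2; C = - 3 * T 1 2 2; D = T 2 2 2; c = coeff (elim_poly T) in
    c 5 * (B * (B ^ 2 + A * C) + A * (B * C + A * D)) + A * c 4 * (B ^ 2 + A * C) + A ^ 2 * c 3 * B + A ^ 3 * c 2)"

definition rem1 :: "(nat \<Rightarrow> nat \<Rightarrow> nat \<Rightarrow> complex) \<Rightarrow> complex" where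
  "rem1 T = (let A = T 1 1 1; B = 3 * T 1 1 2; C = - 3 * T 1 2 2; D = T 2 2 2; c = coeff (elim_poly T) in
    c 5 * (C * (B ^ 2 + A * C) + A * B * D) + A * c 4 * (B * C + A * D) + A ^ 2 * c 3 * C + A ^ 3 * c 1)"

definition rem0 :: "(nat \<Rightarrow> nat \<Rightarrow> nat \<Rightarrow> complex) \<Rightarrow> complex" where
  "rem0 T = (let A = T 1 1 1; B = 3 * T 1 1 2; C = - 3 * T 1 2 2; D = T 2 2 2; c = coeff (elim_poly T) in
    c 5 * D * (B ^ 2 + A * C) + A * c 4 * B * D + A ^ 2 * c 3 * D + A ^ 3 * c 0)"

definition kernel2 :: "(nat \<Rightarrow> nat \<Rightarrow> nat \<Rightarrow> complex) \<Rightarrow> complex" where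
  "kernel2 T = T 1 1 1 * (rem1 T ^ 2 - rem2 T * rem0 T) + rem2 T * rem1 T * (3 * T 1 1 2) - rem2 T ^ 2 * (- 3 * T 1 2 2)"

definition kernel1 :: "(nat \<Rightarrow> nat \<Rightarrow> nat \<Rightarrow> complex) \<Rightarrow> complex" where
  "kernel1 T = T 1 1 1 * rem1 T * rem0 T + rem2 T * rem0 T * (3 * T 1 1 2) - rem2 T ^ 2 * T 2 2 2"

text \<open>The trilinear form \<open>T\<close> with the vector \<open>kernel2 e2 + kernel1 e1\<close> in two arguments
  and the \<open>i\<close>-th unit vector in the third one. If \<open>T\<close> is the product of \<open>L\<close> and a
  quadratic form, the former vector is in the kernel of \<open>L\<close>, and what remains is
  \<open>L i\<close> times the value of the quadratic form at that vector.\<close>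

definition polar :: "(nat \<Rightarrow> nat \<Rightarrow> nat \<Rightarrow> complex) \<Rightarrow> nat \<Rightarrow> complex" where
  "polar T i = kernel2 T ^ 2 * T 2 2 i + 2 * kernel1 T * kernel2 T * T 1 2 i + kernel1 T ^ 2 * T 1 1 i"

text \<open>Dividing \<open>T\<close> by its linear factor \<open>L\<close>, normalised to \<open>L 1 = 1\<close>, determines first the
  entry \<open>(1, 1)\<close> of the quotient, then its first row, then the rest. Here \<open>L\<close> is
  \<open>polar T / polar T 1\<close>, and the denominator \<open>polar T 1\<^sup>2\<close> has been cleared.\<close>

definition cofactor :: "(nat \<Rightarrow> nat \<Rightarrow> nat \<Rightarrow> complex) \<Rightarrow> nat \<Rightarrow> nat \<Rightarrow> complex" where
  "cofactor T j l = polar T 1 ^ 2 * T 1 j l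
    - polar T j * (polar T 1 * T 1 1 l - polar T l * T 1 1 1 / 3) / 2
    - polar T l * (polar T 1 * T 1 1 j - polar T j * T 1 1 1 / 3) / 2"

text \<open>Measures the failure of \<open>polar T\<close> to be a linear factor of \<open>T\<close>, with denominators
  cleared.\<close>

definition factor_defect :: "(nat \<Rightarrow> nat \<Rightarrow> nat \<Rightarrow> complex) \<Rightarrow> nat \<Rightarrow> nat \<Rightarrow> nat \<Rightarrow> complex" where
  "factor_defect T i j l = polar T 1 ^ 3 * T i j l
    - (polar T i * cofactor T j l + polar T j * cofactor T i l + polar T l * cofactor T i j)"

lemma poly_eq_sum:
  fixes f :: "complex poly"
  assumes "degree f \<le> d"
  shows "poly f x = (\<Sum>i\<le>d. coeff f i * x ^ i)"
  unfolding poly_altdef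
  by (rule sum.mono_neutral_left) (use assms in \<open>auto simp: coeff_eq_0\<close>)

lemma degree_elim_poly: "degree (elim_poly T) \<le> 5"
proof -
  have lin: "degree [:a, b:] \<le> 1" and quad: "degree [:a, b, c:] \<le> 2" for a b c :: complex
    by auto
  have m: "degree (f * g) \<le> a + b" if "degree f \<le> a" "degree g \<le> b" for f g :: "complex poly" and a b
    using degree_mult_le[of f g] that by linarith
  show ?thesis unfolding elim_poly_def power2_eq_square
    by (intro degree_add_le; rule order_trans[OF m[OF lin m[OF quad quad]]]) simp_all
qed

text \<open>The value \<open>p = L 2\<close> is a common root of the cubic equation and of \<open>elim_poly\<close>, so the
  elimination finds the vector \<open>e2 - p e1\<close> of the kernel of \<open>L\<close>. The identity remains
  true, with both sides zero, where the elimination degenerates.\<close>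

lemma polar_of_product:
  assumes n: "n \<ge> 3"
    and Q: "\<And>i j. i \<in> {1..n} \<Longrightarrow> j \<in> {1..n} \<Longrightarrow> Q i j = Q j i"
    and L1: "L 1 = 1"
    and T: "\<And>i j l. i \<in> {1..n} \<Longrightarrow> j \<in> {1..n} \<Longrightarrow> l \<in> {1..n} \<Longrightarrow> T i j l = L i * Q j l + L j * Q i l + L l * Q i j"
    and i: "i \<in> {1..n}"
  shows "polar T i = polar T 1 * L i"
proof -
  define p where "p = L 2"
  define q where "q = L 3"
  define \<kappa> where "\<kappa> = Q 2 2 - 2 * p * Q 1 2 + p ^ 2 * Q 1 1"
  have in_n: "1 \<in> {1..n}" "2 \<in> {1..n}" "3 \<in> {1..n}" using n by auto
  have Qs: "Q 2 1 = Q 1 2" "Q 3 1 = Q 1 3" "Q 3 2 = Q 2 3" using Q in_n by blast+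
  have T': "T 1 1 1 = 3 * Q 1 1" "T 1 1 2 = 2 * Q 1 2 + p * Q 1 1" "T 1 1 3 = 2 * Q 1 3 + q * Q 1 1"
    "T 1 2 2 = Q 2 2 + 2 * p * Q 1 2" "T 1 2 3 = Q 2 3 + p * Q 1 3 + q * Q 1 2" "T 1 3 3 = Q 3 3 + 2 * q * Q 1 3"
    "T 2 2 2 = 3 * p * Q 2 2" "T 2 2 3 = 2 * p * Q 2 3 + q * Q 2 2" "T 2 3 3 = p * Q 3 3 + 2 * q * Q 2 3"
    unfolding T[OF in_n(1) in_n(1) in_n(1)] T[OF in_n(1) in_n(1) in_n(2)] T[OF in_n(1) in_n(1) in_n(3)]
      T[OF in_n(1) in_n(2) in_n(2)] T[OF in_n(1) in_n(2) in_n(3)] T[OF in_n(1) in_n(3) in_n(3)]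
      T[OF in_n(2) in_n(2) in_n(2)] T[OF in_n(2) in_n(2) in_n(3)] T[OF in_n(2) in_n(3) in_n(3)]
    by (simp_all add: L1[unfolded One_nat_def] Qs[unfolded One_nat_def] p_def[symmetric] q_def[symmetric])
  have polar_kernel: "T 2 2 i - 2 * p * T 1 2 i + p ^ 2 * T 1 1 i = \<kappa> * L i" if "i \<in> {1..n}" for i
    unfolding T[OF in_n(2) in_n(2) that] T[OF in_n(1) in_n(2) that] T[OF in_n(1) in_n(1) that] \<kappa>_def L1 p_def
    by algebra
  have cubic: "T 1 1 1 * p ^ 3 = 3 * T 1 1 2 * p ^ 2 + (- 3 * T 1 2 2) * p + T 2 2 2"
    unfolding T' by algebra
  have NG: "T 2 2 3 + p * (- 2 * T 1 2 3 + p * T 1 1 3) = \<kappa> * q" "T 1 2 2 + p * (- 2 * T 1 1 2 + p * T 1 1 1) = \<kappa>"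
    unfolding T' \<kappa>_def by algebra+
  have "poly (elim_poly T) p = (- T 1 1 2 + p * T 1 1 1) * (\<kappa> * q) ^ 2 + (2 * T 1 2 3 + p * (- 2 * T 1 1 3)) * (\<kappa> * q * \<kappa>)
      + (- T 2 3 3 + p * T 1 3 3) * \<kappa> ^ 2"
    by (simp only: elim_poly_def poly_add poly_mult poly_power poly_pCons poly_0 mult_zero_right add_0_right NG)
  also have "\<dots> = 0" unfolding T' by algebra
  finally have "(\<Sum>i\<le>5. coeff (elim_poly T) i * p ^ i) = 0"
    unfolding poly_eq_sum[OF degree_elim_poly] .
  then have quintic: "coeff (elim_poly T) 0 + coeff (elim_poly T) 1 * p + coeff (elim_poly T) 2 * p ^ 2 +
      coeff (elim_poly T) 3 * p ^ 3 + coeff (elim_poly T) 4 * p ^ 4 + coeff (elim_poly T) 5 * p ^ 5 = 0"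
    by (simp add: eval_nat_numeral)
  have "kernel2 T * p + kernel1 T = 0"
    unfolding kernel2_def kernel1_def rem2_def rem1_def rem0_def Let_def
    by (rule quintic_cubic_elimination[OF cubic quintic])
  then have k: "kernel1 T = - (kernel2 T * p)" by (simp add: eq_neg_iff_add_eq_0 add.commute)
  have "polar T i = kernel2 T ^ 2 * (T 2 2 i - 2 * p * T 1 2 i + p ^ 2 * T 1 1 i)" for i
    unfolding polar_def k by algebra
  then have "polar T i = kernel2 T ^ 2 * \<kappa> * L i" if "i \<in> {1..n}" for i
    using polar_kernel[OF that] by simp
  from this[OF i] this[OF in_n(1), unfolded L1] show ?thesis by simp
qed

lemma factor_defect_of_product:
  assumes n: "n \<ge> 3"
    and Q: "\<And>i j. i \<in> {1..n} \<Longrightarrow> j \<in> {1..n} \<Longrightarrow> Q i j = Q j i"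
    and L1: "L 1 = 1"
    and T: "\<And>i j l. i \<in> {1..n} \<Longrightarrow> j \<in> {1..n} \<Longrightarrow> l \<in> {1..n} \<Longrightarrow> T i j l = L i * Q j l + L j * Q i l + L l * Q i j"
    and i: "i \<in> {1..n}" "j \<in> {1..n}" "l \<in> {1..n}"
  shows "factor_defect T i j l = 0"
proof -
  have P: "polar T i = polar T 1 * L i" if "i \<in> {1..n}" for i
    using polar_of_product[of n Q L T i] n Q L1 T that by blast
  have one: "1 \<in> {1..n}" using n by simp
  have c: "cofactor T j l = polar T 1 ^ 2 * Q j l" if "j \<in> {1..n}" "l \<in> {1..n}" for j l
    unfolding cofactor_def P[OF that(1)] P[OF that(2)] T[OF one that] T[OF one one that(1)] T[OF one one that(2)]
      T[OF one one one] L1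
    by (simp add: field_simps power2_eq_square)
  show ?thesis
    unfolding factor_defect_def c[OF i(2,3)] c[OF i(1,3)] c[OF i(1,2)] P[OF i(1)] P[OF i(2)] P[OF i(3)] T[OF i]
    by algebra
qed

text \<open>The cubic form \<open>t\<^sub>1\<^sup>3 + 3 t\<^sub>1 t\<^sub>2\<^sup>2 + 3 t\<^sub>1 t\<^sub>3\<^sup>2\<close> in the first three variables shows that
  the reconstruction of the linear factor does not degenerate identically.\<close>

lemma polar_diagonal_example:
  assumes "T 1 1 1 = 1" "T 1 1 2 = 0" "T 1 1 3 = 0" "T 1 2 2 = 1" "T 1 2 3 = 0" "T 1 3 3 = 1"
    "T 2 2 2 = 0" "T 2 2 3 = 0" "T 2 3 3 = 0" "T 2 2 1 = 1" "T 1 2 1 = 0"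
  shows "polar T 1 \<noteq> 0"
proof -
  have "elim_poly T = [:0, 1, 0, 2, 0, 1:]"
    by (simp add: elim_poly_def assms[unfolded One_nat_def] power2_eq_square)
  then have "coeff (elim_poly T) 0 = 0" "coeff (elim_poly T) 1 = 1" "coeff (elim_poly T) 2 = 0"
    "coeff (elim_poly T) 3 = 2" "coeff (elim_poly T) 4 = 0" "coeff (elim_poly T) 5 = 1"
    by (simp_all add: numeral_eq_Suc)
  then have "rem2 T = 0" "rem1 T = 4" "rem0 T = 0"
    unfolding rem2_def rem1_def rem0_def Let_def assms by simp_all
  then show ?thesis unfolding polar_def kernel2_def kernel1_def assms by simp
qed

lemma polyfun_coeff_pCons:
  assumes "polyfun I a" "\<And>k. polyfun I (\<lambda>v. coeff (f v) k)"
  shows "polyfun I (\<lambda>v. coeff (pCons (a v) (f v)) k)"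
  using assms by (cases k) (auto simp: coeff_pCons)

lemma polyfun_coeff_mult:
  assumes "\<And>k. polyfun I (\<lambda>v. coeff (f v) k)" "\<And>k. polyfun I (\<lambda>v. coeff (g v) k)"
  shows "polyfun I (\<lambda>v. coeff (f v * g v) k)"
  unfolding coeff_mult using assms by (intro polyfun_sum polyfun_mult) auto

lemma polyfun_factor_defect:
  assumes n: "n \<ge> 3"
    and T: "\<And>i j l. i \<in> {1..n} \<Longrightarrow> j \<in> {1..n} \<Longrightarrow> l \<in> {1..n} \<Longrightarrow> polyfun I (\<lambda>v. T v i j l)"
  shows "i \<in> {1..n} \<Longrightarrow> polyfun I (\<lambda>v. polar (T v) i)"
    "i \<in> {1..n} \<Longrightarrow> j \<in> {1..n} \<Longrightarrow> l \<in> {1..n} \<Longrightarrow> polyfun I (\<lambda>v. factor_defect (T v) i j l)"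
proof -
  have one: "1 \<in> {1..n}" "2 \<in> {1..n}" "3 \<in> {1..n}" using n by auto
  have nil: "polyfun I (\<lambda>v. coeff 0 k)" for k by (rule polyfun_const)
  have c: "polyfun I (\<lambda>v. coeff (elim_poly (T v)) k)" for k
    unfolding elim_poly_def coeff_add power2_eq_square
    by (intro polyfun_add polyfun_coeff_mult polyfun_coeff_pCons nil polyfun_uminus polyfun_mult polyfun_const T one)
  have r: "polyfun I (\<lambda>v. rem2 (T v))" "polyfun I (\<lambda>v. rem1 (T v))" "polyfun I (\<lambda>v. rem0 (T v))"
    unfolding rem2_def rem1_def rem0_def Let_def
    by (intro polyfun_add polyfun_mult polyfun_power polyfun_const c T one)+
  have k: "polyfun I (\<lambda>v. kernel2 (T v))" "polyfun I (\<lambda>v. kernel1 (T v))"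
    unfolding kernel2_def kernel1_def
    by (intro polyfun_add polyfun_diff polyfun_mult polyfun_power polyfun_const r T one)+
  show p: "polyfun I (\<lambda>v. polar (T v) i)" if "i \<in> {1..n}" for i
    unfolding polar_def
    by (intro polyfun_add polyfun_mult polyfun_power polyfun_const k T one that)
  have co: "polyfun I (\<lambda>v. cofactor (T v) j l)" if "j \<in> {1..n}" "l \<in> {1..n}" for j l
    unfolding cofactor_def
    by (intro polyfun_diff polyfun_divide polyfun_mult polyfun_power p T one that)
  show "polyfun I (\<lambda>v. factor_defect (T v) i j l)" if "i \<in> {1..n}" "j \<in> {1..n}" "l \<in> {1..n}"
    unfolding factor_defect_def
    by (intro polyfun_add polyfun_diff polyfun_mult polyfun_power p co T one that)
qed

section \<open>Third cumulants of mixtures with two components\<close>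

text \<open>The third cumulants as polynomials in the moments.\<close>

definition cumulant3 :: "(nat monomial \<Rightarrow> complex) \<Rightarrow> nat \<Rightarrow> nat \<Rightarrow> nat \<Rightarrow> complex" where
  "cumulant3 v i j l = v (ei i + ei j + ei l) - v (ei i) * v (ei j + ei l) - v (ei j) * v (ei i + ei l)
    - v (ei l) * v (ei i + ei j) + 2 * v (ei i) * v (ei j) * v (ei l)"

lemma polyfun_cumulant3:
  assumes "i \<in> {1..n}" "j \<in> {1..n}" "l \<in> {1..n}"
  shows "polyfun (moment_indices n 3) (\<lambda>v. cumulant3 v i j l)"
  unfolding cumulant3_def
  by (intro polyfun_add polyfun_diff polyfun_mult polyfun_const polyfun_var ei_in_moment_indices assms)

lemma two_component_moments:
  assumes m: "with_pair n 2 \<theta> 1 \<rho> M \<delta> K \<Delta> \<in> mixture_params n 2"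
  defines "v \<equiv> moment n 3 2 (with_pair n 2 \<theta> 1 \<rho> M \<delta> K \<Delta>)"
  shows "i \<in> {1..n} \<Longrightarrow> v (ei i) = M i"
    "i \<in> {1..n} \<Longrightarrow> j \<in> {1..n} \<Longrightarrow> v (ei i + ei j) = M i * M j + K i j"
    "i \<in> {1..n} \<Longrightarrow> j \<in> {1..n} \<Longrightarrow> l \<in> {1..n} \<Longrightarrow> cumulant3 v i j l = third_cumulant \<rho> \<delta> \<Delta> i j l"
proof -
  note f = moments_with_pair[OF order_refl m, folded v_def, simplified]
  show 1: "v (ei i) = M i" if "i \<in> {1..n}" for i using f(2)[of i] that by simp
  show 2: "v (ei i + ei j) = M i * M j + K i j" if "i \<in> {1..n}" "j \<in> {1..n}" for i j
    using f(3)[of i j] that by simp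
  show "cumulant3 v i j l = third_cumulant \<rho> \<delta> \<Delta> i j l" if "i \<in> {1..n}" "j \<in> {1..n}" "l \<in> {1..n}"
  proof -
    have "v (ei i + ei j + ei l) = M i * M j * M l + M i * K j l + M j * K i l + M l * K i j + third_cumulant \<rho> \<delta> \<Delta> i j l"
      using f(4)[of i j l] that by simp
    then show ?thesis
      unfolding cumulant3_def 1[OF that(1)] 1[OF that(2)] 1[OF that(3)]
        2[OF that(1,2)] 2[OF that(1,3)] 2[OF that(2,3)]
      by (simp add: algebra_simps)
  qed
qed

lemma two_component_with_pair:
  assumes \<theta>: "\<theta> \<in> mixture_params n 2"
  defines "\<rho> \<equiv> weight \<theta> 1" and "\<delta> \<equiv> \<lambda>i. mean \<theta> 1 i - mean \<theta> 2 i"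
  shows "\<theta> = with_pair n 2 \<theta> 1 \<rho> (\<lambda>i. \<rho> * mean \<theta> 1 i + (1 - \<rho>) * mean \<theta> 2 i) \<delta>
    (\<lambda>i j. \<rho> * cov \<theta> 1 i j + (1 - \<rho>) * cov \<theta> 2 i j + \<rho> * (1 - \<rho>) * \<delta> i * \<delta> j)
    (\<lambda>i j. cov \<theta> 1 i j - cov \<theta> 2 i j)"
proof -
  have "weight \<theta> 1 + weight \<theta> 2 = 1"
    using mixture_paramsD(2)[OF \<theta>] sum_split_pair[of 2 "weight \<theta>"] by simp
  from as_with_pair[OF \<theta> order_refl this one_neq_zero] show ?thesis
    unfolding \<rho>_def \<delta>_def div_by_1 .
qed

lemma third_cumulant_factors:
  assumes "\<delta> 1 \<noteq> 0"
  shows "third_cumulant \<rho> \<delta> \<Delta> i j l =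
    (\<delta> i / \<delta> 1) * (\<delta> 1 * (\<rho> * (1 - \<rho>)) * ((1 - 2 * \<rho>) / 3 * \<delta> j * \<delta> l + \<Delta> j l))
    + (\<delta> j / \<delta> 1) * (\<delta> 1 * (\<rho> * (1 - \<rho>)) * ((1 - 2 * \<rho>) / 3 * \<delta> i * \<delta> l + \<Delta> i l))
    + (\<delta> l / \<delta> 1) * (\<delta> 1 * (\<rho> * (1 - \<rho>)) * ((1 - 2 * \<rho>) / 3 * \<delta> i * \<delta> j + \<Delta> i j))"
proof -
  have d: "x / \<delta> 1 * (\<delta> 1 * y * z) = x * y * z" for x y z using assms by simp
  show ?thesis unfolding d third_cumulant_def by (simp add: field_simps)
qed

lemma two_component_polar:
  assumes n: "n \<ge> 3" and \<theta>: "\<theta> \<in> mixture_params n 2" and d: "mean \<theta> 1 1 \<noteq> mean \<theta> 2 1"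
    and v: "\<And>\<alpha>. \<alpha> \<in> moment_indices n 3 \<Longrightarrow> moment n 3 2 \<theta> \<alpha> = v \<alpha>"
  defines "T \<equiv> cumulant3 v"
  shows "i \<in> {1..n} \<Longrightarrow> polar T i = polar T 1 * ((mean \<theta> 1 i - mean \<theta> 2 i) / (mean \<theta> 1 1 - mean \<theta> 2 1))"
    "i \<in> {1..n} \<Longrightarrow> j \<in> {1..n} \<Longrightarrow> l \<in> {1..n} \<Longrightarrow> factor_defect T i j l = 0"
proof -
  define \<rho> where "\<rho> = weight \<theta> 1"
  define \<delta> where "\<delta> = (\<lambda>i. mean \<theta> 1 i - mean \<theta> 2 i)"
  define \<Delta> where "\<Delta> = (\<lambda>i j. cov \<theta> 1 i j - cov \<theta> 2 i j)"
  define L where "L i = \<delta> i / \<delta> 1" for i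
  define Q where "Q i j = \<delta> 1 * (\<rho> * (1 - \<rho>)) * ((1 - 2 * \<rho>) / 3 * \<delta> i * \<delta> j + \<Delta> i j)" for i j
  define M where "M = (\<lambda>i. \<rho> * mean \<theta> 1 i + (1 - \<rho>) * mean \<theta> 2 i)"
  define K where "K = (\<lambda>i j. \<rho> * cov \<theta> 1 i j + (1 - \<rho>) * cov \<theta> 2 i j + \<rho> * (1 - \<rho>) * \<delta> i * \<delta> j)"
  have eq: "with_pair n 2 \<theta> 1 \<rho> M \<delta> K \<Delta> = \<theta>"
    using two_component_with_pair[OF \<theta>] unfolding \<rho>_def \<delta>_def \<Delta>_def M_def K_def by simp
  have d1: "\<delta> 1 \<noteq> 0" using d by (simp add: \<delta>_def)
  have L1: "L 1 = 1" using d1 by (simp add: L_def)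
  have Q: "Q i j = Q j i" if "i \<in> {1..n}" "j \<in> {1..n}" for i j
    using mixture_paramsD(1)[OF \<theta> _ that, of 1] mixture_paramsD(1)[OF \<theta> _ that, of 2]
    by (simp add: Q_def \<Delta>_def)
  have T: "T i j l = L i * Q j l + L j * Q i l + L l * Q i j"
    if "i \<in> {1..n}" "j \<in> {1..n}" "l \<in> {1..n}" for i j l
  proof -
    have "T i j l = cumulant3 (moment n 3 2 \<theta>) i j l"
      unfolding T_def cumulant3_def using that by (simp only: v ei_in_moment_indices)
    then have "T i j l = third_cumulant \<rho> \<delta> \<Delta> i j l"
      using two_component_moments(3)[of n \<theta> \<rho> M \<delta> K \<Delta> i j l] \<theta> that unfolding eq by simp
    also have "\<dots> = L i * Q j l + L j * Q i l + L l * Q i j"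
      unfolding L_def Q_def by (rule third_cumulant_factors[where \<delta> = \<delta>, OF d1])
    finally show ?thesis .
  qed
  show "polar T i = polar T 1 * ((mean \<theta> 1 i - mean \<theta> 2 i) / (mean \<theta> 1 1 - mean \<theta> 2 1))" if "i \<in> {1..n}"
    using polar_of_product[of n Q L T i] n Q L1 T that by (simp add: L_def \<delta>_def)
  show "factor_defect T i j l = 0" if "i \<in> {1..n}" "j \<in> {1..n}" "l \<in> {1..n}"
    using factor_defect_of_product[of n Q L T i j l] n Q L1 T that by blast
qed

text \<open>The defect is a polynomial in the moments. It vanishes for mixtures whose means have distinct
  first coordinates, hence on the closure of all mixtures.\<close>

lemma Sec_factor_defect:
  assumes n: "n \<ge> 3" and v: "proj_point (moment_indices n 3) v \<in> Sec 2 n 3" "v 0 = 1"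
    and i: "i \<in> {1..n}" "j \<in> {1..n}" "l \<in> {1..n}"
  shows "factor_defect (cumulant3 v) i j l = 0"
proof -
  let ?I = "moment_indices n 3"
  let ?F = "\<lambda>v. factor_defect (cumulant3 v) i j l"
  let ?\<Phi> = "\<lambda>w. moment n 3 2 (mixture_of n 2 w)"
  have two: "(1::nat) \<le> 2" by simp
  note fam = family_mixture_of[OF two, of n]
  have F: "polyfun ?I ?F" 
    using polyfun_factor_defect(2)[of n ?I cumulant3 i j l] polyfun_cumulant3 n i by simp
  from polyfun_homogenize[OF F ei_in_moment_indices(1)]
  obtain e h where h: "form ?I e h" "\<forall>v. v 0 = 1 \<longrightarrow> poly_value v h = ?F v"
    by (elim exE conjE) (rule that)
  have \<theta>: "mixture_of n 2 w \<in> mixture_params n 2" for w by (rule mixture_of_in_mixture_params[OF two])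
  have hF: "poly_value (?\<Phi> w) h = ?F (?\<Phi> w)" for w
    using h(2)[rule_format, of "?\<Phi> w"] moment_formulas(1)[OF \<theta>] by simp
  define D where "D w = w (1::nat, 0::nat, 1::nat) - w (2::nat, 0::nat, 1::nat)" for w :: "nat \<times> nat \<times> nat \<Rightarrow> complex"
  have D: "polyfun (param_idx n 2) D"
    unfolding D_def by (intro polyfun_diff polyfun_var) (use n in \<open>auto simp: param_idx_def\<close>)
  have D1: "D (\<lambda>x. if x = (1, 0, 1) then 1 else 0) \<noteq> 0" by (simp add: D_def)
  have "poly_value (?\<Phi> w) h = 0" for w
  proof (rule ccontr)
    assume w: "poly_value (?\<Phi> w) h \<noteq> 0"
    have "\<exists>u. poly_value (?\<Phi> u) h \<noteq> 0 \<and> D u \<noteq> 0"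
      by (rule polyfun_common_nonzero[where F = "\<lambda>u. poly_value (?\<Phi> u) h" and G = D and I = "param_idx n 2",
            OF polyfun_family_form[OF fam h(1)] D w D1])
    then obtain u where u: "poly_value (?\<Phi> u) h \<noteq> 0" "D u \<noteq> 0" by blast
    have "mean (mixture_of n 2 u) 1 1 \<noteq> mean (mixture_of n 2 u) 2 1"
      using u(2) n by (simp add: D_def mixture_of_def)
    from two_component_polar(2)[OF n \<theta> this refl i] show False using u(1) hF by simp
  qed
  then have "vanishes_on (range (\<lambda>w. proj_point ?I (?\<Phi> w))) h"
    using vanishes_on_image[OF h(1), of ?\<Phi> UNIV] by simp
  then have "vanishes_on (Sec 2 n 3) h"
    unfolding Sec_eq_closure_family[OF two] moment_point_def
    using vanishes_on_closure[OF points_in_space[OF fam] h(1)] by blast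
  then have "vanishes_on {proj_point ?I v} h" using v(1) by (auto simp: vanishes_on_def)
  then have "poly_value v h = 0" using vanishes_on_proj_point[OF h(1)] by blast
  then show ?thesis using h(2)[rule_format, of v] v(2) by simp
qed

section \<open>Identifiability for two components\<close>

lemma cumulant3_commute:
  "cumulant3 v i j l = cumulant3 v j i l" "cumulant3 v i j l = cumulant3 v i l j"
  by (simp_all add: cumulant3_def add_ac)

text \<open>The moment of the first coordinate determines the weight since \<open>a\<close> and \<open>b\<close> are given; the
  polar determines the difference of the means up to a factor, and \<open>a - b\<close> fixes the factor.
  Then \<open>\<Delta>\<close> is determined because multiplication by a nonzero linear form is
  injective.\<close>

lemma two_component_unique:
  assumes n: "n \<ge> 3" and ab: "a \<noteq> b"
    and \<theta>: "\<theta> \<in> mixture_params n 2" "mean \<theta> 1 1 = a" "mean \<theta> 2 1 = b"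
      "\<forall>\<alpha>\<in>moment_indices n 3. moment n 3 2 \<theta> \<alpha> = v \<alpha>"
    and \<theta>': "\<theta>' \<in> mixture_params n 2" "mean \<theta>' 1 1 = a" "mean \<theta>' 2 1 = b"
      "\<forall>\<alpha>\<in>moment_indices n 3. moment n 3 2 \<theta>' \<alpha> = v \<alpha>"
    and gen: "polar (cumulant3 v) 1 \<noteq> 0" "v (ei 1) \<noteq> a" "v (ei 1) \<noteq> b"
  shows "\<theta> = \<theta>'"
proof -
  define \<delta> where "\<delta> \<theta> i = mean \<theta> 1 i - mean \<theta> 2 i" for \<theta> i
  define \<Delta> where "\<Delta> \<theta> i j = cov \<theta> 1 i j - cov \<theta> 2 i j" for \<theta> i j
  define r where "r \<theta> = weight \<theta> 1" for \<theta>
  have one: "1 \<in> {1..n}" using n by simp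
  have facts: "weight \<theta> 2 = 1 - r \<theta>"
    "\<And>i. i \<in> {1..n} \<Longrightarrow> v (ei i) = r \<theta> * mean \<theta> 1 i + (1 - r \<theta>) * mean \<theta> 2 i"
    "\<And>i j. i \<in> {1..n} \<Longrightarrow> j \<in> {1..n} \<Longrightarrow> v (ei i + ei j) =
      v (ei i) * v (ei j) + (r \<theta> * cov \<theta> 1 i j + (1 - r \<theta>) * cov \<theta> 2 i j + r \<theta> * (1 - r \<theta>) * \<delta> \<theta> i * \<delta> \<theta> j)"
    "\<And>i j l. i \<in> {1..n} \<Longrightarrow> j \<in> {1..n} \<Longrightarrow> l \<in> {1..n} \<Longrightarrow> cumulant3 v i j l = third_cumulant (r \<theta>) (\<delta> \<theta>) (\<Delta> \<theta>) i j l"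
    "\<And>i. i \<in> {1..n} \<Longrightarrow> polar (cumulant3 v) i = polar (cumulant3 v) 1 * (\<delta> \<theta> i / (a - b))"
    if \<theta>: "\<theta> \<in> mixture_params n 2" "mean \<theta> 1 1 = a" "mean \<theta> 2 1 = b"
      and v': "\<forall>\<alpha>\<in>moment_indices n 3. moment n 3 2 \<theta> \<alpha> = v \<alpha>" for \<theta>
  proof -
    note v = bspec[OF v']
    define M where "M = (\<lambda>i. r \<theta> * mean \<theta> 1 i + (1 - r \<theta>) * mean \<theta> 2 i)"
    define K where "K = (\<lambda>i j. r \<theta> * cov \<theta> 1 i j + (1 - r \<theta>) * cov \<theta> 2 i j + r \<theta> * (1 - r \<theta>) * \<delta> \<theta> i * \<delta> \<theta> j)"
    have eq: "with_pair n 2 \<theta> 1 (r \<theta>) M (\<delta> \<theta>) K (\<Delta> \<theta>) = \<theta>"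
      using two_component_with_pair[OF \<theta>(1)] unfolding r_def \<delta>_def \<Delta>_def M_def K_def by simp
    have m: "with_pair n 2 \<theta> 1 (r \<theta>) M (\<delta> \<theta>) K (\<Delta> \<theta>) \<in> mixture_params n 2" using \<theta>(1) eq by simp
    note tc = two_component_moments[OF m, unfolded eq]
    show "weight \<theta> 2 = 1 - r \<theta>"
      using mixture_paramsD(2)[OF \<theta>(1)] sum_split_pair[of 2 "weight \<theta>"] by (simp add: r_def eq_diff_eq add.commute)
    show 1: "v (ei i) = r \<theta> * mean \<theta> 1 i + (1 - r \<theta>) * mean \<theta> 2 i" if "i \<in> {1..n}" for i
      using tc(1)[OF that] v[OF ei_in_moment_indices(2)[OF that]] by (simp add: M_def)
    show "v (ei i + ei j) = v (ei i) * v (ei j) + (r \<theta> * cov \<theta> 1 i j + (1 - r \<theta>) * cov \<theta> 2 i j + r \<theta> * (1 - r \<theta>) * \<delta> \<theta> i * \<delta> \<theta> j)"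
      if "i \<in> {1..n}" "j \<in> {1..n}" for i j
      using tc(2)[OF that] v[OF ei_in_moment_indices(3)[OF that]] 1[OF that(1)] 1[OF that(2)] by (simp add: M_def K_def)
    show "cumulant3 v i j l = third_cumulant (r \<theta>) (\<delta> \<theta>) (\<Delta> \<theta>) i j l"
      if "i \<in> {1..n}" "j \<in> {1..n}" "l \<in> {1..n}" for i j l
    proof -
      have "cumulant3 v i j l = cumulant3 (moment n 3 2 \<theta>) i j l"
        unfolding cumulant3_def using that by (simp only: v ei_in_moment_indices)
      then show ?thesis using tc(3)[OF that] by simp
    qed
    show "polar (cumulant3 v) i = polar (cumulant3 v) 1 * (\<delta> \<theta> i / (a - b))" if "i \<in> {1..n}" for i
      using two_component_polar(1)[OF n \<theta>(1) _ v that] \<theta>(2,3) ab by (simp add: \<delta>_def)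
  qed
  note F = facts[OF \<theta>] and F' = facts[OF \<theta>']
  have "r \<theta> * a + (1 - r \<theta>) * b = r \<theta>' * a + (1 - r \<theta>') * b"
    using F(2)[OF one] F'(2)[OF one] \<theta>(2,3) \<theta>'(2,3) by simp
  then have "(r \<theta> - r \<theta>') * (a - b) = 0" by (simp add: algebra_simps)
  then have r: "r \<theta>' = r \<theta>" using ab by simp
  have r0: "r \<theta> \<noteq> 0" "1 - r \<theta> \<noteq> 0"
    using F(2)[OF one] \<theta>(2,3) gen(2,3) by auto
  have d: "\<delta> \<theta>' i = \<delta> \<theta> i" if "i \<in> {1..n}" for i
    using F(5)[OF that] F'(5)[OF that] gen(1) ab by simp
  have d1: "\<delta> \<theta> 1 \<noteq> 0" using \<theta>(2,3) ab by (simp add: \<delta>_def)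
  have mean2: "mean \<theta>' 2 i = mean \<theta> 2 i" if "i \<in> {1..n}" for i
  proof -
    have "v (ei i) = mean \<theta> 2 i + r \<theta> * \<delta> \<theta> i" "v (ei i) = mean \<theta>' 2 i + r \<theta> * \<delta> \<theta>' i"
      using F(2)[OF that] F'(2)[OF that] unfolding r by (simp_all add: \<delta>_def algebra_simps)
    then show ?thesis using d[OF that] by simp
  qed
  have mean1: "mean \<theta>' 1 i = mean \<theta> 1 i" if "i \<in> {1..n}" for i
    using mean2[OF that] d[OF that] by (simp add: \<delta>_def)
  define X where "X i j = \<Delta> \<theta>' i j - \<Delta> \<theta> i j" for i j
  have X: "\<delta> \<theta> i * X j l + \<delta> \<theta> j * X i l + \<delta> \<theta> l * X i j = 0"
    if "i \<in> {1..n}" "j \<in> {1..n}" "l \<in> {1..n}" for i j l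
  proof -
    have "third_cumulant (r \<theta>) (\<delta> \<theta>) (\<Delta> \<theta>) i j l = third_cumulant (r \<theta>) (\<delta> \<theta>') (\<Delta> \<theta>') i j l"
      using F(4)[OF that] F'(4)[OF that] r by simp
    then have "r \<theta> * (1 - r \<theta>) * (\<delta> \<theta> i * X j l + \<delta> \<theta> j * X i l + \<delta> \<theta> l * X i j) = 0"
      unfolding third_cumulant_def d[OF that(1)] d[OF that(2)] d[OF that(3)] X_def by algebra
    then show ?thesis using r0 by simp
  qed
  have X11: "X 1 1 = 0"
  proof -
    have "3 * (\<delta> \<theta> 1 * X 1 1) = 0" using X[OF one one one] by algebra
    then show ?thesis using d1 by simp
  qed
  have X1: "X 1 l = 0" if "l \<in> {1..n}" for l
  proof -
    have "2 * (\<delta> \<theta> 1 * X 1 l) = 0" using X[OF one one that] X11 by algebra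
    then show ?thesis using d1 by simp
  qed
  have X0: "X j l = 0" if "j \<in> {1..n}" "l \<in> {1..n}" for j l
    using X[OF one that] X1[OF that(1)] X1[OF that(2)] d1 by simp
  have cov2: "cov \<theta>' 2 i j = cov \<theta> 2 i j" if "i \<in> {1..n}" "j \<in> {1..n}" for i j
  proof -
    have "r \<theta> * cov \<theta> 1 i j + (1 - r \<theta>) * cov \<theta> 2 i j = r \<theta> * cov \<theta>' 1 i j + (1 - r \<theta>) * cov \<theta>' 2 i j"
      using F(3)[OF that] F'(3)[OF that] d[OF that(1)] d[OF that(2)] r by simp
    then show ?thesis using X0[OF that] unfolding X_def \<Delta>_def by algebra
  qed
  have cov1: "cov \<theta>' 1 i j = cov \<theta> 1 i j" if "i \<in> {1..n}" "j \<in> {1..n}" for i j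
    using cov2[OF that] X0[OF that] by (simp add: X_def \<Delta>_def)
  have two: "h = 1 \<or> h = 2" if "h \<in> {1..2}" for h :: nat using that by auto
  show ?thesis
  proof (rule mixture_eqI[OF \<theta>(1) \<theta>'(1)])
    show "weight \<theta> h = weight \<theta>' h" if "h \<in> {1..2}" for h
      using two[OF that] F(1) F'(1) r by (auto simp: r_def)
    show "mean \<theta> h i = mean \<theta>' h i" if "h \<in> {1..2}" "i \<in> {1..n}" for h i
      using two[OF that(1)] mean1[OF that(2)] mean2[OF that(2)] by auto
    show "cov \<theta> h i j = cov \<theta>' h i j" if "h \<in> {1..2}" "i \<in> {1..n}" "j \<in> {1..n}" for h i j
      using two[OF that(1)] cov1[OF that(2,3)] cov2[OF that(2,3)] by auto
  qed
qed

text \<open>The division of the third cumulant by its linear factor gives \<open>\<delta>\<close> and \<open>\<Delta>\<close>; the centre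
  and \<open>K\<close> are the first two cumulants.\<close>

lemma two_component_exists:
  assumes n: "n \<ge> 3" and ab: "a \<noteq> b" and v0: "v 0 = 1"
    and defect: "\<And>i j l. i \<in> {1..n} \<Longrightarrow> j \<in> {1..n} \<Longrightarrow> l \<in> {1..n} \<Longrightarrow> factor_defect (cumulant3 v) i j l = 0"
    and gen: "polar (cumulant3 v) 1 \<noteq> 0" "v (ei 1) \<noteq> a" "v (ei 1) \<noteq> b"
  shows "\<exists>\<theta>. \<theta> \<in> mixture_params n 2 \<and> mean \<theta> 1 1 = a \<and> mean \<theta> 2 1 = b \<and>
    (\<forall>\<alpha>\<in>moment_indices n 3. moment n 3 2 \<theta> \<alpha> = v \<alpha>)"
proof -
  define T where "T = cumulant3 v"
  define L where "L i = polar T i / polar T 1" for i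
  define Q where "Q i j = cofactor T i j / polar T 1 ^ 2" for i j
  define \<rho> where "\<rho> = (v (ei 1) - b) / (a - b)"
  define \<delta> where "\<delta> i = (a - b) * L i" for i
  define s where "s = (a - b) * (\<rho> * (1 - \<rho>))"
  define \<Delta> where "\<Delta> i j = Q i j / s - (1 - 2 * \<rho>) / 3 * \<delta> i * \<delta> j" for i j
  define M where "M i = v (ei i)" for i
  define K where "K i j = v (ei i + ei j) - v (ei i) * v (ei j)" for i j
  define \<theta> where "\<theta> = with_pair n 2 undefined 1 \<rho> M \<delta> K \<Delta>"
  have P: "polar T 1 \<noteq> 0" using gen(1) by (simp add: T_def)
  have \<rho>: "\<rho> \<noteq> 0" "1 - \<rho> \<noteq> 0" "v (ei 1) = b + \<rho> * (a - b)"
    using ab gen(2,3) by (auto simp: \<rho>_def field_simps)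
  have s: "s \<noteq> 0" using ab \<rho> by (simp add: s_def)
  have L1: "L 1 = 1" using P by (simp add: L_def)
  have d1: "\<delta> 1 = a - b" unfolding \<delta>_def L1 by simp
  have Q: "Q i j = Q j i" for i j
    unfolding Q_def cofactor_def T_def using cumulant3_commute(2)[of v 1 i j] by (simp add: algebra_simps)
  have T: "T i j l = L i * Q j l + L j * Q i l + L l * Q i j" if "i \<in> {1..n}" "j \<in> {1..n}" "l \<in> {1..n}" for i j l
  proof -
    have "polar T 1 ^ 3 * T i j l = polar T i * cofactor T j l + polar T j * cofactor T i l + polar T l * cofactor T i j"
      using defect[OF that] by (simp add: factor_defect_def T_def)
    then show ?thesis using P by (simp add: L_def Q_def field_simps power2_eq_square power3_eq_cube)
  qed
  have T3: "third_cumulant \<rho> \<delta> \<Delta> i j l = T i j l" if "i \<in> {1..n}" "j \<in> {1..n}" "l \<in> {1..n}" for i j l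
  proof -
    have q: "\<delta> 1 * (\<rho> * (1 - \<rho>)) * ((1 - 2 * \<rho>) / 3 * \<delta> j * \<delta> l + \<Delta> j l) = Q j l" for j l
      using s unfolding d1 s_def[symmetric] by (simp add: \<Delta>_def)
    have l: "\<delta> i / \<delta> 1 = L i" for i unfolding d1 using ab by (simp add: \<delta>_def)
    have "\<delta> 1 \<noteq> 0" using ab d1 by simp
    from third_cumulant_factors[where \<delta> = \<delta> and \<rho> = \<rho> and \<Delta> = \<Delta> and i = i and j = j and l = l, OF this]
    show ?thesis unfolding q l T[OF that] .
  qed
  have m: "\<theta> \<in> mixture_params n 2" unfolding \<theta>_def
  proof (rule with_pair_in_mixture_params)
    show "K i j = K j i" for i j by (simp add: K_def add.commute)
    show "\<Delta> i j = \<Delta> j i" for i j using Q[of i j] by (simp add: \<Delta>_def)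
  qed auto
  have means: "mean \<theta> 1 1 = a" "mean \<theta> 2 1 = b"
    using n \<rho>(3) d1 by (auto simp: \<theta>_def with_pair_def M_def algebra_simps)
  have "moment n 3 2 \<theta> \<alpha> = v \<alpha>" if "\<alpha> \<in> moment_indices n 3" for \<alpha>
    using that
  proof (cases rule: moment_indices_cases)
    case 1
    then show ?thesis using moment_formulas(1)[OF m] v0 by simp
  next
    case (2 i)
    then show ?thesis using two_component_moments(1)[OF m[unfolded \<theta>_def]] by (simp add: \<theta>_def M_def)
  next
    case (3 i j)
    then show ?thesis using two_component_moments(2)[OF m[unfolded \<theta>_def]] by (simp add: \<theta>_def M_def K_def)
  next
    case (4 i j l)
    have "cumulant3 (moment n 3 2 \<theta>) i j l = cumulant3 v i j l"
      using two_component_moments(3)[OF m[unfolded \<theta>_def] 4(1-3)] T3[OF 4(1-3)] by (simp add: \<theta>_def T_def)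
    moreover have "moment n 3 2 \<theta> (ei i) = v (ei i)" if "i \<in> {1..n}" for i
      using two_component_moments(1)[OF m[unfolded \<theta>_def] that] by (simp add: \<theta>_def M_def)
    moreover have "moment n 3 2 \<theta> (ei i + ei j) = v (ei i + ei j)" if "i \<in> {1..n}" "j \<in> {1..n}" for i j
      using two_component_moments(2)[OF m[unfolded \<theta>_def] that] by (simp add: \<theta>_def M_def K_def)
    ultimately show ?thesis using 4 by (simp add: cumulant3_def)
  qed
  then show ?thesis using m means by blast
qed

lemma chart_representative:
  assumes P: "P \<in> proj_space I" and z: "z \<in> I" and h: "form I e h" "\<not> vanishes_on {P} (var z * h)"
  obtains v where "P = proj_point I v" "v z = 1" "poly_value v h \<noteq> 0"
proof -
  obtain u where u: "P = proj_point I u" using P by (auto simp: proj_space_def)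
  have f: "form I (1 + e) (var z * h)" by (rule form_mult[OF form_var[OF z] h(1)])
  have "poly_value u (var z * h) \<noteq> 0"
    using h(2) vanishes_on_proj_point[OF f, of u] unfolding u by simp
  then have uz: "u z \<noteq> 0" by (simp add: poly_value_mult)
  let ?v = "\<lambda>i. u i / u z"
  have v: "P = proj_point I ?v" using proj_point_divide[OF uz, of I u] u by simp
  have "poly_value ?v (var z * h) \<noteq> 0"
    using h(2) vanishes_on_proj_point[OF f, of ?v] unfolding v by simp
  then show ?thesis using that[OF v] uz by (simp add: poly_value_mult)
qed

lemma proj_point_chart_inj:
  assumes "proj_point I u = proj_point I v" "u z = 1" "v z = 1" "z \<in> I" "i \<in> I"
  shows "u i = v i"
proof -
  have "(\<lambda>i\<in>I. 1 * u i) \<in> proj_point I u" unfolding proj_point_def by (intro CollectI exI[of _ 1]) simp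
  then have "(\<lambda>i\<in>I. 1 * u i) \<in> proj_point I v" unfolding assms(1) .
  then obtain c where c: "(\<lambda>i\<in>I. 1 * u i) = (\<lambda>i\<in>I. c * v i)"
    unfolding proj_point_def by blast
  show ?thesis using fun_cong[OF c, of z] fun_cong[OF c, of i] assms by simp
qed

text \<open>The general points are those in the chart where the reconstruction formula has nonzero
  denominator and where the weight computed from the first moment is neither \<open>0\<close> nor \<open>1\<close>.\<close>

lemma generic_unique_two_component:
  assumes n: "n \<ge> 3" and ab: "a \<noteq> b"
  shows "for_general_point (zariski (moment_indices n 3)) (Sec 2 n 3)
    (\<lambda>m. \<exists>!\<theta>. \<theta> \<in> mixture_params n 2 \<and> mean \<theta> 1 1 = a \<and> mean \<theta> 2 1 = b \<and> moment_point n 3 2 \<theta> = m)"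
proof -
  let ?I = "moment_indices n 3"
  let ?X = "zariski ?I"
  let ?\<Phi> = "\<lambda>w. moment n 3 2 (mixture_of n 2 w)"
  have two: "(1::nat) \<le> 2" by simp
  have one: "1 \<in> {1..n}" using n by simp
  note fam = family_mixture_of[OF two, of n]
  note z = ei_in_moment_indices(1)[of n]
  define F where "F v = polar (cumulant3 v) 1 * ((v (ei 1) - a) * (v (ei 1) - b))" for v
  have F: "polyfun ?I F" unfolding F_def
    using polyfun_factor_defect(1)[of n ?I cumulant3 1] polyfun_cumulant3 n one
    by (intro polyfun_mult polyfun_diff polyfun_var polyfun_const ei_in_moment_indices(2)) auto
  from polyfun_homogenize[OF F z]
  obtain e h where h: "form ?I e h" "\<forall>v. v 0 = 1 \<longrightarrow> poly_value v h = F v"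
    by (elim exE conjE) (rule that)
  have f: "form ?I (1 + e) (var 0 * h)" by (rule form_mult[OF form_var[OF z] h(1)])
  define U where "U = Sec 2 n 3 - zero_locus ?I {var 0 * h}"
  have Sec_sub: "Sec 2 n 3 \<subseteq> proj_space ?I"
    using closure_of_subset_topspace[of ?X] unfolding Sec_def by simp
  have "U = (topspace ?X - zero_locus ?I {var 0 * h}) \<inter> Sec 2 n 3"
    using Sec_sub by (auto simp: U_def)
  then have "openin (subtopology ?X (Sec 2 n 3)) U"
    unfolding openin_subtopology
    using openin_diff[OF openin_topspace closedin_zero_locus[OF f]] by blast
  moreover have "Sec 2 n 3 \<subseteq> ?X closure_of U"
  proof -
    let ?D = "\<lambda>w. poly_value (?\<Phi> w) (var 0 * h)"
    obtain c where c: "c \<noteq> a" "c \<noteq> b"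
      using ex_new_if_finite[OF infinite_UNIV_char_0, of "{a, b}"] by auto
    \<comment> \<open>\<open>\<Delta>\<close> is chosen so that the third cumulant is that of \<open>polar_diagonal_example\<close>\<close>
    define \<theta> where "\<theta> = with_pair n 2 undefined 1 (1/2) (\<lambda>i. if i = 1 then c else 0) (\<lambda>i. if i = 1 then 1 else 0)
      (\<lambda>_ _. 0) (\<lambda>i j. if i = j then if i = 1 then 4/3 else 4 else 0)"
    have \<theta>: "\<theta> \<in> mixture_params n 2"
      unfolding \<theta>_def by (rule with_pair_in_mixture_params) auto
    note m = two_component_moments[OF \<theta>[unfolded \<theta>_def], folded \<theta>_def]
    have "polar (cumulant3 (moment n 3 2 \<theta>)) 1 \<noteq> 0"
      by (rule polar_diagonal_example) (use n in \<open>simp_all add: m third_cumulant_def\<close>)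
    moreover have "moment n 3 2 \<theta> (ei 1) = c" using m(1)[OF one] by simp
    moreover have m0: "moment n 3 2 \<theta> 0 = 1" by (rule moment_formulas(1)[OF \<theta>])
    ultimately have nz: "poly_value (moment n 3 2 \<theta>) (var 0 * h) \<noteq> 0"
      using h(2) c by (simp add: poly_value_mult F_def)
    obtain w where "mixture_of n 2 w = \<theta>" using mixture_of_surj[OF \<theta> two] by blast
    then have w: "?D w \<noteq> 0" using nz by simp
    have "Sec 2 n 3 = ?X closure_of points ?I ?\<Phi> {w. ?D w \<noteq> 0}"
      unfolding Sec_eq_closure_family[OF two] moment_point_def
      using closure_of_generic_points[where D = ?D, OF fam polyfun_family_form[OF fam f] w] by simp
    also have "\<dots> \<subseteq> ?X closure_of U"
    proof (rule closure_of_mono, rule image_subsetI)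
      fix w assume "w \<in> {w. ?D w \<noteq> 0}"
      then have w: "?D w \<noteq> 0" by simp
      have "points ?I ?\<Phi> UNIV \<subseteq> Sec 2 n 3"
        unfolding Sec_eq_closure_family[OF two] moment_point_def
        using points_in_space[OF fam, of UNIV] by (intro closure_of_subset) simp
      then have "proj_point ?I (?\<Phi> w) \<in> Sec 2 n 3" by blast
      moreover have "proj_point ?I (?\<Phi> w) \<notin> zero_locus ?I {var 0 * h}"
        using vanishes_on_proj_point[OF f, of "?\<Phi> w"] w by (auto simp: zero_locus_def vanishes_on_def)
      ultimately show "proj_point ?I (?\<Phi> w) \<in> U" by (simp add: U_def)
    qed
    finally show ?thesis .
  qed
  moreover have "\<exists>!\<theta>. \<theta> \<in> mixture_params n 2 \<and> mean \<theta> 1 1 = a \<and> mean \<theta> 2 1 = b \<and> moment_point n 3 2 \<theta> = m"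
    if mU: "m \<in> U" for m
  proof -
    have m: "m \<in> Sec 2 n 3" "m \<in> proj_space ?I" using mU Sec_sub by (auto simp: U_def)
    have "\<not> vanishes_on {m} (var 0 * h)"
      using mU m(2) by (auto simp: U_def zero_locus_def vanishes_on_def)
    then obtain v where v: "m = proj_point ?I v" "v 0 = 1" "poly_value v h \<noteq> 0"
      using chart_representative[OF m(2) z h(1)] by blast
    then have "F v \<noteq> 0" using h(2) by simp
    then have gen: "polar (cumulant3 v) 1 \<noteq> 0" "v (ei 1) \<noteq> a" "v (ei 1) \<noteq> b" by (auto simp: F_def)
    have defect: "factor_defect (cumulant3 v) i j l = 0" if "i \<in> {1..n}" "j \<in> {1..n}" "l \<in> {1..n}" for i j l
      using Sec_factor_defect[of n v i j l] n that m(1) v(1,2) by simp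
    have mom: "moment_point n 3 2 \<theta> = m \<longleftrightarrow> (\<forall>\<alpha>\<in>?I. moment n 3 2 \<theta> \<alpha> = v \<alpha>)"
      if \<theta>: "\<theta> \<in> mixture_params n 2" for \<theta>
    proof
      assume "moment_point n 3 2 \<theta> = m"
      then have "proj_point ?I (moment n 3 2 \<theta>) = proj_point ?I v" using v(1) by (simp add: moment_point_def)
      then show "\<forall>\<alpha>\<in>?I. moment n 3 2 \<theta> \<alpha> = v \<alpha>"
        using proj_point_chart_inj[of ?I "moment n 3 2 \<theta>" v 0] moment_formulas(1)[OF \<theta>] v(2) z by simp
    next
      assume eq: "\<forall>\<alpha>\<in>?I. moment n 3 2 \<theta> \<alpha> = v \<alpha>"
      have "(\<lambda>\<alpha>\<in>?I. c * moment n 3 2 \<theta> \<alpha>) = (\<lambda>\<alpha>\<in>?I. c * v \<alpha>)" for c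
        by (rule restrict_ext) (simp add: eq)
      then show "moment_point n 3 2 \<theta> = m" by (simp add: v(1) moment_point_def proj_point_def)
    qed
    from two_component_exists[OF n ab v(2) defect gen]
    obtain \<theta> where \<theta>: "\<theta> \<in> mixture_params n 2" "mean \<theta> 1 1 = a" "mean \<theta> 2 1 = b"
      "\<forall>\<alpha>\<in>?I. moment n 3 2 \<theta> \<alpha> = v \<alpha>" by blast
    show ?thesis
    proof (rule ex1I[of _ \<theta>])
      show "\<theta> \<in> mixture_params n 2 \<and> mean \<theta> 1 1 = a \<and> mean \<theta> 2 1 = b \<and> moment_point n 3 2 \<theta> = m"
        using \<theta> mom[OF \<theta>(1)] by blast
      fix \<theta>' assume "\<theta>' \<in> mixture_params n 2 \<and> mean \<theta>' 1 1 = a \<and> mean \<theta>' 2 1 = b \<and> moment_point n 3 2 \<theta>' = m"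
      then have \<theta>': "\<theta>' \<in> mixture_params n 2" "mean \<theta>' 1 1 = a" "mean \<theta>' 2 1 = b"
        "\<forall>\<alpha>\<in>?I. moment n 3 2 \<theta>' \<alpha> = v \<alpha>" using mom[of \<theta>'] by auto
      show "\<theta>' = \<theta>"
        by (rule two_component_unique[OF n ab \<theta>' \<theta> gen])
    qed
  qed
  ultimately show ?thesis
    unfolding for_general_point_def by (intro exI[of _ U] conjI ballI)
qed

theorem theorem13:
  fixes n :: nat
  assumes "n \<ge> 1"
  shows "(\<forall>k\<ge>2. Sec k n 3 \<noteq> moment_space n 3 \<longrightarrow> defective k n 3) \<and>
    (Sec 2 n 3 \<noteq> moment_space n 3 \<longrightarrow>
      enat (n * (n + 3) + 1) - dim_Sec 2 n 3 = 2) \<and>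
    (Sec 2 n 3 \<noteq> moment_space n 3 \<longrightarrow> n \<ge> 3 \<longrightarrow>
      (\<forall>a b. a \<noteq> b \<longrightarrow>
        for_general_point (zariski (moment_indices n 3)) (Sec 2 n 3)
          (\<lambda>m. \<exists>!\<theta>. \<theta> \<in> mixture_params n 2 \<and> mean \<theta> 1 1 = a \<and> mean \<theta> 2 1 = b \<and>
                     moment_point n 3 2 \<theta> = m)))"
proof (intro conjI allI impI)
  show "defective k n 3" if "k \<ge> 2" "Sec k n 3 \<noteq> moment_space n 3" for k
    by (rule Sec_defective[OF assms that])
  have "n * (n + 3) \<ge> 1" using assms by simp
  then show "enat (n * (n + 3) + 1) - dim_Sec 2 n 3 = 2"
    unfolding dim_Sec_2[OF assms] by (simp add: numeral_eq_enat)
  show "for_general_point (zariski (moment_indices n 3)) (Sec 2 n 3)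
      (\<lambda>m. \<exists>!\<theta>. \<theta> \<in> mixture_params n 2 \<and> mean \<theta> 1 1 = a \<and> mean \<theta> 2 1 = b \<and> moment_point n 3 2 \<theta> = m)"
    if "n \<ge> 3" "a \<noteq> b" for a b
    by (rule generic_unique_two_component[OF that])
qed

end
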